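(* Let $N\ge1$ be an integer, let $\mathbf c$ be a rectifiable and open curve in $\mathbb R^{N+1}$, parameterized in arc-length by $\mathbf c:[0,L]\to\mathbb R^{N+1}$, with $L=\mathcal L(\mathbf c)$ its length and $I_L=(0,L)$, and let $\alpha\ge0$. Then for every exponent $p>1$ $$\mathcal F_{p,\alpha}(\mathbf c)<\infty\iff\mathbf c\in W^{2,p}(I_L,\mathbb R^{N+1}),$$ and in that case $$\mathcal F_{p,\alpha}(\mathbf c)=\int_0^L\|\ddot{\mathbf c}(s)\|^p\,ds .$$
   Context: Inscribed polygonals and modulus. A polygonal $P$ is inscribed in $\mathbf c$, written $P\ll\mathbf c$, if there is a finite partition $0=t_0<t_1<\dots<t_n=L$ such that $P$ is the polygonal with consecutive vertices $\mathbf c(t_0),\dots,\mathbf c(t_n)$. The modulus $\mu_{\mathbf c}(P)$ is the maximum of the diameters of the arcs of $\mathbf c$ determined by consecutive vertices of $P$. $\{P_h\}\ll\mathbf c$ means that $\{P_h\}$ is a sequence of polygonals each inscribed in $\mathbf c$. Modified $p$-rotation. For $p>1$ and $\alpha\ge0$ let $$f_{p,\alpha}(\theta):=2^{\alpha}\,\theta^{1-\alpha}\,\big(\tan(\theta/2)\big)^{p-1+\alpha},\qquad 0<\theta<\pi,$$ with $f_{p,\alpha}(0):=0$ and $f_{p,\alpha}(\pi):=+\infty$. Let $P$ be an open polygonal given by $n$ non-degenerate consecutive segments $\mathbf v_1,\dots,\mathbf v_n$ of lengths $\ell_i>0$, with turning (exterior) angles $\theta_i=\arccos\big(\frac{\mathbf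 v_i\bullet\mathbf v_{i+1}}{\ell_i\ell_{i+1}}\big)\in[0,\pi]$ and $r_i:=\min\{\ell_i,\ell_{i+1}\}$, $i=1,\dots,n-1$. Then $$\mathbf k_{p,\alpha}(P):=\sum_{i=1}^{n-1}\Big(\frac{r_i}{2}\Big)^{1-p}f_{p,\alpha}(\theta_i).$$ Finally $$\mathcal F_{p,\alpha}(\mathbf c):=\inf\Big\{\liminf_{h\to\infty}\mathbf k_{p,\alpha}(P_h)\ \Big|\ \{P_h\}\ll\mathbf c,\ \mu_{\mathbf c}(P_h)\to0\Big\}.$$ *)

theory Defs
  imports "HOL-Analysis.Analysis"
begin

definition partition_points :: "real \<Rightarrow> real \<Rightarrow> real list \<Rightarrow> bool" where
  "partition_points a b ts \<longleftrightarrow>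
     length ts \<ge> 2 \<and> sorted_wrt (<) ts \<and> hd ts = a \<and> last ts = b"

text \<open>For \<open>a = b\<close> there is no such partition, and the supremum of the empty set is \<open>0\<close>.\<close>

definition curve_length :: "(real \<Rightarrow> 'a::metric_space) \<Rightarrow> real \<Rightarrow> real \<Rightarrow> ennreal" where
  "curve_length c a b =
     Sup {\<Sum>i<length ts - 1. ennreal (dist (c (ts ! i)) (c (ts ! Suc i))) | ts.
            partition_points a b ts}"

definition rectifiable_curve :: "(real \<Rightarrow> 'a::metric_space) \<Rightarrow> real \<Rightarrow> real \<Rightarrow> bool" where
  "rectifiable_curve c a b \<longleftrightarrow> continuous_on {a..b} c \<and> curve_length c a b < \<infinity>"

definition arc_length_parametrized :: "(real \<Rightarrow> 'a::metric_space) \<Rightarrow> real \<Rightarrow> bool" where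
  "arc_length_parametrized c L \<longleftrightarrow> (\<forall>s\<in>{0..L}. curve_length c 0 s = ennreal s)"

text \<open>An open polygonal is given by the list of its consecutive vertices, so that
  a list of \<open>n + 1\<close> points describes \<open>n\<close> segments, indexed here from \<open>0\<close>.\<close>

definition nondegenerate_polygonal :: "'a list \<Rightarrow> bool" where
  "nondegenerate_polygonal P \<longleftrightarrow>
     length P \<ge> 2 \<and> (\<forall>i<length P - 1. P ! i \<noteq> P ! Suc i)"

definition segment_vector :: "'a::real_inner list \<Rightarrow> nat \<Rightarrow> 'a" where
  "segment_vector P i = P ! Suc i - P ! i"

definition turning_angle :: "'a::real_inner list \<Rightarrow> nat \<Rightarrow> real" where
  "turning_angle P i =
     arccos ((segment_vector P i \<bullet> segment_vector P (Suc i)) /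
             (norm (segment_vector P i) * norm (segment_vector P (Suc i))))"

definition min_adjacent_length :: "'a::real_inner list \<Rightarrow> nat \<Rightarrow> real" where
  "min_adjacent_length P i = min (norm (segment_vector P i)) (norm (segment_vector P (Suc i)))"

definition angle_weight :: "real \<Rightarrow> real \<Rightarrow> real \<Rightarrow> ennreal" where
  "angle_weight p \<alpha> \<theta> =
     (if \<theta> = 0 then 0
      else if \<theta> = pi then \<infinity>
      else ennreal (2 powr \<alpha> * \<theta> powr (1 - \<alpha>) * tan (\<theta> / 2) powr (p - 1 + \<alpha>)))"

text \<open>The \<open>n - 1\<close> interior vertices of a polygonal with \<open>n + 1\<close> vertices are counted by
  \<open>length P - 2\<close>. Meaningful for nondegenerate polygonals only.\<close>

definition modified_rotation :: "real \<Rightarrow> real \<Rightarrow> 'a::real_inner list \<Rightarrow> ennreal" where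
  "modified_rotation p \<alpha> P =
     (\<Sum>i<length P - 2.
        ennreal ((min_adjacent_length P i / 2) powr (1 - p)) *
        angle_weight p \<alpha> (turning_angle P i))"

text \<open>An inscribed polygonal is carried by the partition \<open>ts\<close> that produces it, since the arcs
  of the curve between consecutive vertices depend on \<open>ts\<close> when the curve is not injective.
  Its segments must be nondegenerate, as required for the modified rotation.\<close>

definition inscribed_polygonal ::
    "(real \<Rightarrow> 'a::metric_space) \<Rightarrow> real \<Rightarrow> real list \<Rightarrow> 'a list \<Rightarrow> bool" where
  "inscribed_polygonal c L ts P \<longleftrightarrow>
     partition_points 0 L ts \<and> P = map c ts \<and> nondegenerate_polygonal P"

definition polygonal_modulus :: "(real \<Rightarrow> 'a::metric_space) \<Rightarrow> real list \<Rightarrow> real" where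
  "polygonal_modulus c ts = Max ((\<lambda>i. diameter (c ` {ts ! i..ts ! Suc i})) ` {..<length ts - 1})"

definition relaxed_energy ::
    "real \<Rightarrow> real \<Rightarrow> (real \<Rightarrow> 'a::real_inner) \<Rightarrow> real \<Rightarrow> ennreal" where
  "relaxed_energy p \<alpha> c L =
     Inf {liminf (\<lambda>h. modified_rotation p \<alpha> (P h)) | P ts.
            (\<forall>h::nat. inscribed_polygonal c L (ts h) (P h)) \<and>
            (\<lambda>h. polygonal_modulus c (ts h)) \<longlonglongrightarrow> 0}"

definition test_function :: "real set \<Rightarrow> (real \<Rightarrow> real) \<Rightarrow> bool" where
  "test_function I \<phi> \<longleftrightarrow>
     (\<forall>j. (deriv ^^ j) \<phi> differentiable_on UNIV) \<and>
     (\<exists>K. compact K \<and> K \<subseteq> I \<and> (\<forall>x. x \<notin> K \<longrightarrow> \<phi> x = 0))"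

definition locally_integrable_on :: "real set \<Rightarrow> (real \<Rightarrow> 'a::euclidean_space) \<Rightarrow> bool" where
  "locally_integrable_on I u \<longleftrightarrow> (\<forall>K. compact K \<and> K \<subseteq> I \<longrightarrow> set_integrable lebesgue K u)"

definition has_weak_deriv ::
    "nat \<Rightarrow> real set \<Rightarrow> (real \<Rightarrow> 'a::euclidean_space) \<Rightarrow> (real \<Rightarrow> 'a) \<Rightarrow> bool" where
  "has_weak_deriv j I u v \<longleftrightarrow>
     locally_integrable_on I u \<and> locally_integrable_on I v \<and>
     (\<forall>\<phi>. test_function I \<phi> \<longrightarrow>
        (LINT x:I|lebesgue. (deriv ^^ j) \<phi> x *\<^sub>R u x) =
        (-1) ^ j *\<^sub>R (LINT x:I|lebesgue. \<phi> x *\<^sub>R v x))"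

definition in_Lp :: "real \<Rightarrow> real set \<Rightarrow> (real \<Rightarrow> 'a::euclidean_space) \<Rightarrow> bool" where
  "in_Lp p I u \<longleftrightarrow>
     u \<in> borel_measurable (lebesgue_on I) \<and> integrable (lebesgue_on I) (\<lambda>x. norm (u x) powr p)"

definition in_Sobolev ::
    "nat \<Rightarrow> real \<Rightarrow> real set \<Rightarrow> (real \<Rightarrow> 'a::euclidean_space) \<Rightarrow> bool" where
  "in_Sobolev k p I u \<longleftrightarrow>
     in_Lp p I u \<and> (\<forall>j\<in>{1..k}. \<exists>v. has_weak_deriv j I u v \<and> in_Lp p I v)"

end

theory Submission
  imports Defs
begin

text \<open>
  Let \<open>\<tau>\<^sub>i\<close> be the unit edges of an inscribed polygonal. Since \<open>tan x \<ge> x \<ge> sin x\<close>, the modified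
  rotation bounds the discrete energy \<open>\<Sum> |\<tau>\<^sub>i\<^sub>+\<^sub>1 - \<tau>\<^sub>i|\<^sup>p / m\<^sub>i\<^sup>p\<^sup>-\<^sup>1\<close> from above, where \<open>m\<^sub>i\<close> is the mean
  of the two parameter steps next to the vertex. By Hoelder's inequality the step functions \<open>\<tau>\<close> of a
  sequence of bounded energy are almost equicontinuous, and as the lengths of the polygonals tend to
  \<open>L\<close>, they converge to the derivative \<open>w\<close> of the curve. In the limit \<open>w\<close> satisfies the criterion of
  F. Riesz: its increments \<open>\<Delta>w\<close> over dyadic cells of size \<open>h\<close> obey \<open>\<Sum> |\<Delta>w|\<^sup>p / h\<^sup>p\<^sup>-\<^sup>1 \<le> M\<close>, so that \<open>w\<close>
  is the primitive of a function \<open>v\<close> whose \<open>p\<close>-th power has integral at most \<open>M\<close>.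
  Conversely, for a curve with weak second derivative \<open>v\<close> in \<open>L\<^sup>p\<close>, inscribe polygonals at uniform
  parameters. The difference quotients \<open>D\<^sub>i\<close> are uniformly close to unit vectors, the turning angles
  are uniformly small, and the rotation is asymptotically at most \<open>\<Sum> \<delta>\<^sup>1\<^sup>-\<^sup>p |D\<^sub>i\<^sub>+\<^sub>1 - D\<^sub>i|\<^sup>p\<close>, which Jensen's
  inequality, applied twice, bounds by the integral of \<open>|v|\<^sup>p\<close>.
\<close>

section \<open>Smooth ramps\<close>

text \<open>Three mismatches shape the proof. The rotation is scaled by chord lengths, the limit by
  parameter steps: a chord is never longer than its step and 1 - p < 0, so passing to steps lowers
  the energy, while the reverse passage costs a factor tending to 1 once |w| = 1 is known. The
  modulus measures diameters of arcs, so small parameter steps must be won from arc length: a long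
  arc of small diameter would add almost nothing to a polygonal whose length is nearly L. Membership
  in the Sobolev space is tested weakly, so a smoothed tent is built to show that a continuous
  function with vanishing weak second derivative is affine, which ties a weak derivative to an
  honest double primitive. The limit directions come from the curve itself: at each parameter the
  unit edge stays close to a difference quotient of the curve, which makes the directions a Cauchy
  sequence there. The density v is the L^1 limit of dyadic slopes, a martingale. The factor
  (r/2)^(1-p) is calibrated: since unit edges differ by \<open>2 * sin (\<theta> / 2)\<close>, the
  powers of 2 cancel and both bounds have constant 1.\<close>

text \<open>The extra parameters \<open>k\<close> and \<open>P\<close> make the family of bumps closed under differentiation.\<close>

definition bump :: "real \<Rightarrow> nat \<Rightarrow> real poly \<Rightarrow> real \<Rightarrow> real" where
  "bump e k P x =
     (if \<bar>x\<bar> < e then poly P x / (e\<^sup>2 - x\<^sup>2) ^ k * exp (- (1 / (e\<^sup>2 - x\<^sup>2))) else 0)"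

text \<open>One term of the exponential series at \<open>1 / q\<close> bounds
  \<open>exp (1 / q)\<close> from below. Thus the exponential beats every negative power of
  \<open>q\<close>.\<close>

lemma exp_minus_inverse_le:
  fixes q :: real
  assumes "q > 0"
  shows "exp (- (1 / q)) \<le> fact n * q ^ n"
proof -
  have "(1 / q) ^ n / fact n = (\<Sum>k\<in>{n}. (1 / q) ^ k /\<^sub>R fact k)"
    by (simp add: divide_inverse)
  also have "\<dots> \<le> (\<Sum>k. (1 / q) ^ k /\<^sub>R fact k)"
    by (rule sum_le_suminf) (use assms summable_exp_generic[of "1 / q"] in auto)
  finally have "(1 / q) ^ n / fact n \<le> exp (1 / q)"
    by (simp add: exp_def)
  then have "1 \<le> exp (1 / q) * (fact n * q ^ n)"
    using assms by (simp add: field_simps power_divide)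
  then show ?thesis
    by (simp add: exp_minus field_simps)
qed

text \<open>With q = e^2 - y^2 the exponential supplies k + 2 powers of q: k cancel the denominator,
  two remain, and q = (e - y)(e + y) is at most 2e|y - x| for either endpoint x. The quadratic order
  is what makes the derivative vanish at the edge of the support.\<close>

lemma bump_quadratic_at_boundary:
  assumes "e > 0" "\<bar>x\<bar> = e"
  obtains C where "C \<ge> 0" "\<And>y. \<bar>bump e k P y\<bar> \<le> C * (y - x)\<^sup>2"
proof -
  have "compact (poly P ` {-e..e})"
    by (intro compact_continuous_image continuous_intros) auto
  then obtain B where B: "\<And>y. y \<in> {-e..e} \<Longrightarrow> \<bar>poly P y\<bar> \<le> B"
    by (metis compact_imp_bounded bounded_iff real_norm_def imageI)
  have "B \<ge> 0" using B[of 0] assms by auto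
  let ?C = "B * (fact (k + 2) * (2 * e)\<^sup>2)"
  have "\<bar>bump e k P y\<bar> \<le> ?C * (y - x)\<^sup>2" for y
  proof (cases "\<bar>y\<bar> < e")
    case True
    then have y: "- e < y" "y < e" by auto
    define q where "q = e\<^sup>2 - y\<^sup>2"
    have q: "q > 0" unfolding q_def using True abs_le_square_iff[of e y] assms(1) by auto
    have "q = (e - y) * (e + y)" by (simp add: q_def power2_eq_square algebra_simps)
    also have "\<dots> \<le> 2 * e * \<bar>y - x\<bar>"
    proof (cases "x = e")
      case True
      then show ?thesis using y mult_left_mono[of "e + y" "2 * e" "e - y"] by (auto simp: mult.commute)
    next
      case False
      then have "x = - e" using assms by auto
      then show ?thesis using y mult_right_mono[of "e - y" "2 * e" "e + y"] by (auto simp: add.commute)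
    qed
    finally have q2: "q\<^sup>2 \<le> (2 * e)\<^sup>2 * (y - x)\<^sup>2"
      using q by (metis abs_of_pos less_imp_le power2_abs power_mono power_mult_distrib)
    have "\<bar>bump e k P y\<bar> = \<bar>poly P y\<bar> * (exp (- (1 / q)) / q ^ k)"
      using True q by (simp add: bump_def flip: q_def) (simp add: abs_mult)
    also have "\<dots> \<le> B * (fact (k + 2) * q\<^sup>2)"
    proof (intro mult_mono B)
      show "exp (- (1 / q)) / q ^ k \<le> fact (k + 2) * q\<^sup>2"
        using exp_minus_inverse_le[OF q, of "k + 2"] q
        by (subst pos_divide_le_eq) (auto simp: power_add power2_eq_square algebra_simps)
    qed (use True q \<open>B \<ge> 0\<close> in auto)
    also have "\<dots> \<le> B * (fact (k + 2) * ((2 * e)\<^sup>2 * (y - x)\<^sup>2))"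
      using q2 \<open>B \<ge> 0\<close> by (intro mult_left_mono) auto
    finally show ?thesis by (simp add: algebra_simps)
  qed (use \<open>B \<ge> 0\<close> in \<open>auto simp: bump_def\<close>)
  moreover have "?C \<ge> 0" using \<open>B \<ge> 0\<close> by auto
  ultimately show ?thesis using that by blast
qed

text \<open>Quotient rule over the common denominator q^(k+2); the exponent rises by 2 because the
  derivative of exp(-1/q) brings the factor q'/q^2. Outside the support the function is locally
  zero, and on its boundary the quadratic bound forces derivative 0.\<close>

lemma bump_has_derivative:
  assumes "e > 0"
  defines "q \<equiv> [:e\<^sup>2, 0, -1:]"
  shows "(bump e k P has_real_derivative
           bump e (k + 2) (pderiv P * q\<^sup>2 - smult (real k) (P * pderiv q * q) + P * pderiv q) x) (at x)"
    (is "(_ has_real_derivative bump e _ ?Q x) _")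
proof -
  consider "\<bar>x\<bar> < e" | "\<bar>x\<bar> > e" | "\<bar>x\<bar> = e" by linarith
  then show ?thesis
  proof cases
    case 1
    have qx: "poly q y = e\<^sup>2 - y\<^sup>2" "poly (pderiv q) y = - 2 * y" for y
      by (auto simp: q_def power2_eq_square pderiv_pCons)
    have pos: "e\<^sup>2 - x\<^sup>2 > 0"
      using 1 abs_le_square_iff[of e x] assms(1) by auto
    define g where "g = (\<lambda>x::real. (e\<^sup>2 - x\<^sup>2) ^ k)"
    define h where "h = (\<lambda>x::real. exp (- (1 / (e\<^sup>2 - x\<^sup>2))))"
    have g: "(g has_real_derivative real k * (e\<^sup>2 - x\<^sup>2) ^ (k - 1) * (- 2 * x)) (at x)"
      unfolding g_def by (rule derivative_eq_intros refl | simp)+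
    have h: "(h has_real_derivative h x * (- 2 * x / (e\<^sup>2 - x\<^sup>2)\<^sup>2)) (at x)"
      unfolding h_def by (rule derivative_eq_intros refl | use pos in \<open>simp add: power2_eq_square\<close>)+
    have "((\<lambda>x. poly P x / g x * h x) has_real_derivative
             (poly (pderiv P) x * g x - poly P x * (real k * (e\<^sup>2 - x\<^sup>2) ^ (k - 1) * (- 2 * x))) / (g x * g x) * h x
             + h x * (- 2 * x / (e\<^sup>2 - x\<^sup>2)\<^sup>2) * (poly P x / g x)) (at x)"
      using pos by (intro DERIV_mult DERIV_divide poly_DERIV g h) (auto simp: g_def)
    also have "(poly (pderiv P) x * g x - poly P x * (real k * (e\<^sup>2 - x\<^sup>2) ^ (k - 1) * (- 2 * x))) / (g x * g x) * h x
             + h x * (- 2 * x / (e\<^sup>2 - x\<^sup>2)\<^sup>2) * (poly P x / g x)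
        = poly ?Q x / (e\<^sup>2 - x\<^sup>2) ^ (k + 2) * h x"
    \<comment> \<open>The exponent \<open>k - 1\<close> is truncated at \<open>k = 0\<close>, where
      its term vanishes through the factor \<open>real k\<close>.\<close>
    proof (cases k)
      case 0
      have *: "a * h x + h x * (x' / W) * b = (a * W + b * x') / W * h x" if "W > 0" for a b x' W :: real
        using that by (simp add: field_simps)
      show ?thesis using *[of "(e\<^sup>2 - x\<^sup>2)\<^sup>2" "poly (pderiv P) x" "- 2 * x" "poly P x"] pos
        by (simp add: 0 qx g_def power2_eq_square)
    next
      case (Suc m)
      define w where "w = e\<^sup>2 - x\<^sup>2"
      have w: "w > 0" using pos by (simp add: w_def)
      have "w ^ m > 0" using w by simp
      then have "(poly (pderiv P) x * (w * w ^ m) - poly P x * (real k * w ^ m * (- 2 * x))) / (w * w ^ m * (w * w ^ m)) * h x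
             + h x * (- 2 * x / (w * w)) * (poly P x / (w * w ^ m))
        = (poly (pderiv P) x * (w * w) - real k * (poly P x * (- 2 * x) * w) + poly P x * (- 2 * x)) / (w * w * (w * w ^ m)) * h x"
        using w by (simp add: field_simps)
      then show ?thesis
        by (simp add: qx g_def Suc power2_eq_square flip: w_def[unfolded power2_eq_square]) 
    qed
    finally have "((\<lambda>x. poly P x / (e\<^sup>2 - x\<^sup>2) ^ k * exp (- (1 / (e\<^sup>2 - x\<^sup>2)))) has_real_derivative
             poly ?Q x / (e\<^sup>2 - x\<^sup>2) ^ (k + 2) * exp (- (1 / (e\<^sup>2 - x\<^sup>2)))) (at x)"
      by (simp add: g_def h_def)
    moreover have "eventually (\<lambda>y. bump e k P y = poly P y / (e\<^sup>2 - y\<^sup>2) ^ k * exp (- (1 / (e\<^sup>2 - y\<^sup>2)))) (nhds x)"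
      by (rule eventually_mono[OF eventually_nhds_in_open[of "{-e<..<e}" x]])
         (use 1 in \<open>auto simp: bump_def abs_less_iff\<close>)
    moreover have "bump e (k + 2) ?Q x = poly ?Q x / (e\<^sup>2 - x\<^sup>2) ^ (k + 2) * exp (- (1 / (e\<^sup>2 - x\<^sup>2)))"
      using 1 by (simp add: bump_def)
    ultimately show ?thesis
      by (subst DERIV_cong_ev[OF refl _ refl]) auto
  next
    case 2
    have "open {y. \<bar>y\<bar> > e}"
      by (intro open_Collect_less continuous_intros)
    then have "eventually (\<lambda>y. bump e k P y = 0) (nhds x)"
      by (rule eventually_mono[OF eventually_nhds_in_open[of "{y. \<bar>y\<bar> > e}" x]])
         (use 2 in \<open>auto simp: bump_def\<close>)
    then show ?thesis
      using 2 by (subst DERIV_cong_ev[OF refl _ refl]) (auto simp: bump_def)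
  next
    case 3
    obtain C where C: "C \<ge> 0" "\<And>y. \<bar>bump e k P y\<bar> \<le> C * (y - x)\<^sup>2"
      using bump_quadratic_at_boundary[OF assms(1) 3] by blast
    have x0: "bump e j Q x = 0" for j Q using 3 by (simp add: bump_def)
    have "((\<lambda>y. C * \<bar>y - x\<bar>) \<longlongrightarrow> C * \<bar>x - x\<bar>) (at x)"
      by (intro tendsto_intros)
    then have lim: "((\<lambda>y. C * \<bar>y - x\<bar>) \<longlongrightarrow> 0) (at x)" by simp
    have "\<forall>\<^sub>F y in at x. norm ((bump e k P y - bump e k P x) / (y - x)) \<le> C * \<bar>y - x\<bar>"
    proof (rule always_eventually, rule allI)
      fix y
      show "norm ((bump e k P y - bump e k P x) / (y - x)) \<le> C * \<bar>y - x\<bar>"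
        using C(2)[of y] C(1)
        by (cases "y = x") (auto simp: x0 abs_divide pos_divide_le_eq power2_eq_square abs_mult_self_eq mult.assoc)
    qed
    then have "((\<lambda>y. (bump e k P y - bump e k P x) / (y - x)) \<longlongrightarrow> 0) (at x)"
      using lim by (rule Lim_null_comparison)
    then show ?thesis by (simp add: has_field_derivative_iff x0)
  qed
qed

text \<open>Every iterated derivative is again a bump, with other parameters \<open>k\<close> and
  \<open>P\<close>.\<close>

lemma bump_smooth:
  assumes "e > 0"
  shows "(deriv ^^ j) (bump e k P) differentiable_on UNIV"
proof -
  have "\<exists>k' P'. (deriv ^^ j) (bump e k P) = bump e k' P'"
  proof (induction j)
    case (Suc j)
    then obtain k' P' where *: "(deriv ^^ j) (bump e k P) = bump e k' P'" by blast
    have "deriv (bump e k' P') = bump e (k' + 2) (pderiv P' * [:e\<^sup>2, 0, -1:]\<^sup>2 -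
        smult (real k') (P' * pderiv [:e\<^sup>2, 0, -1:] * [:e\<^sup>2, 0, -1:]) + P' * pderiv [:e\<^sup>2, 0, -1:])"
      by (intro ext DERIV_imp_deriv bump_has_derivative assms)
    then show ?case using * by auto
  qed auto
  then show ?thesis
    using bump_has_derivative[OF assms] unfolding differentiable_on_def real_differentiable_def
    by (metis UNIV_I at_within_open open_UNIV)
qed

text \<open>Starting the integral at \<open>a - 1\<close> instead of \<open>a\<close> puts every
  point from \<open>a\<close> on into the interior of an interval of integration, so the derivative
  is two-sided.\<close>

lemma antiderivative_vanishing_left:
  fixes f :: "real \<Rightarrow> real"
  assumes "continuous_on UNIV f" "\<And>x. x \<le> a \<Longrightarrow> f x = 0"
  defines "F \<equiv> \<lambda>x. integral {a - 1..x} f"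
  shows "(F has_real_derivative f x) (at x)" "x \<le> a \<Longrightarrow> F x = 0"
proof -
  show F0: "F x = 0" if "x \<le> a" for x
  proof -
    have "integral {a - 1..x} f = integral {a - 1..x} (\<lambda>_. 0)"
      by (intro Henstock_Kurzweil_Integration.integral_cong assms) (use that in auto)
    then show ?thesis by (simp add: F_def)
  qed
  show "(F has_real_derivative f x) (at x)"
  proof (cases "x < a")
    case True
    then have "eventually (\<lambda>y. F y = 0) (nhds x)"
      using eventually_nhds_in_open[of "{..<a}" x] by (auto elim!: eventually_mono intro: F0)
    then show ?thesis
      using True assms(2)[of x] by (subst DERIV_cong_ev[OF refl _ refl]) auto
  next
    case False
    have "(F has_real_derivative f x) (at x within {a - 1..x + 1})"
      unfolding F_def
      by (rule integral_has_real_derivative) (use assms(1) False in \<open>auto intro: continuous_on_subset\<close>)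
    then show ?thesis
      using False by (subst (asm) at_within_interior) auto
  qed
qed

text \<open>A bump integrated twice: \<open>H\<close> is a smoothed step of height \<open>K\<close>,
  the mass of the bump, and \<open>R\<close> a smoothed ramp of slope \<open>K\<close>. Combinations
  of shifted ramps give tents whose second derivative lives near the nodes.\<close>

lemma smooth_ramp_exists:
  assumes "e > 0"
  obtains R H \<eta> :: "real \<Rightarrow> real" and r K where
    "\<And>x. (R has_real_derivative H x) (at x)" "\<And>x. (H has_real_derivative \<eta> x) (at x)"
    "\<And>j. (deriv ^^ j) \<eta> differentiable_on UNIV"
    "\<And>x. \<eta> x \<ge> 0" "\<And>x. \<bar>x\<bar> \<ge> e \<Longrightarrow> \<eta> x = 0"
    "\<And>x. x \<le> - e \<Longrightarrow> R x = 0" "\<And>x. x \<ge> e \<Longrightarrow> R x = r + K * x"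
    "K > 0" "integral {-e..e} \<eta> = K"
proof -
  define \<eta> where "\<eta> = bump e 0 1"
  define H where "H = (\<lambda>x. integral {-e - 1..x} \<eta>)"
  define R where "R = (\<lambda>x. integral {-e - 1..x} H)"
  have c\<eta>: "continuous_on UNIV \<eta>" unfolding \<eta>_def
    using bump_smooth[OF assms, of 0] differentiable_imp_continuous_on by fastforce
  have \<eta>0: "\<eta> x = 0" if "\<bar>x\<bar> \<ge> e" for x using that by (simp add: \<eta>_def bump_def)
  have \<eta>p: "\<eta> x \<ge> 0" for x by (simp add: \<eta>_def bump_def)
  have H: "(H has_real_derivative \<eta> x) (at x)" "x \<le> - e \<Longrightarrow> H x = 0" for x
    unfolding H_def using antiderivative_vanishing_left[OF c\<eta>, of "-e" x] \<eta>0 assms by auto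
  have cH: "continuous_on UNIV H"
    using H(1) by (intro continuous_at_imp_continuous_on) (auto intro: DERIV_isCont)
  have R: "(R has_real_derivative H x) (at x)" "x \<le> - e \<Longrightarrow> R x = 0" for x
    unfolding R_def using antiderivative_vanishing_left[OF cH, of "-e" x] H(2) by auto
  have FTC: "integral {a..b} \<eta> = H b - H a" if "a \<le> b" for a b
    by (intro integral_unique fundamental_theorem_of_calculus that
         has_field_derivative_at_within[THEN has_real_derivative_iff_has_vector_derivative[THEN iffD1]] H(1))
  have FTC2: "integral {a..b} H = R b - R a" if "a \<le> b" for a b
    by (intro integral_unique fundamental_theorem_of_calculus that
         has_field_derivative_at_within[THEN has_real_derivative_iff_has_vector_derivative[THEN iffD1]] R(1))
  define K where "K = H e"
  have IK: "integral {-e..e} \<eta> = K"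
    using FTC[of "-e" e] assms H(2)[of "-e"] by (simp add: K_def)
  have Hc: "H x = K" if "x \<ge> e" for x
  proof -
    have "integral {e..x} \<eta> = integral {e..x} (\<lambda>_. 0)"
      by (intro Henstock_Kurzweil_Integration.integral_cong \<eta>0) auto
    then show ?thesis using FTC[OF that] by (simp add: K_def)
  qed
  have Rc: "R x = (R e - K * e) + K * x" if "x \<ge> e" for x
  proof -
    have "integral {e..x} H = integral {e..x} (\<lambda>_. K)"
      by (intro Henstock_Kurzweil_Integration.integral_cong Hc) auto
    then show ?thesis using FTC2[OF that] that by (simp add: algebra_simps)
  qed
  have "K \<noteq> 0"
  proof
    assume "K = 0"
    then have "integral {-e..e} \<eta> = 0" using IK by simp
    moreover have "- e < e" using assms by simp
    ultimately have "\<forall>x\<in>{-e..e}. \<eta> x = 0"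
      using integral_eq_0_iff[OF continuous_on_subset[OF c\<eta> subset_UNIV], of "-e" e] \<eta>p by blast
    then show False using assms by (auto simp: \<eta>_def bump_def dest: bspec[of _ _ 0])
  qed
  moreover have "K \<ge> 0" unfolding IK[symmetric]
    by (rule Henstock_Kurzweil_Integration.integral_nonneg
          [OF integrable_continuous_real[OF continuous_on_subset[OF c\<eta> subset_UNIV]] \<eta>p])
  ultimately have "K > 0" by simp
  have "(deriv ^^ j) \<eta> differentiable_on UNIV" for j
    unfolding \<eta>_def by (rule bump_smooth[OF assms])
  then show ?thesis
    using that[OF R(1) H(1) _ \<eta>p \<eta>0 R(2) Rc \<open>K > 0\<close> IK] by blast
qed

section \<open>Weak second derivatives on an interval\<close>

text \<open>The ramp and its first derivative are not bumps, so the smoothness of a tent is read off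
  its second derivative, a combination of shifted bumps.\<close>

lemma deriv_iterate_shifts:
  fixes f :: "real \<Rightarrow> real" and x y z :: real
  assumes "\<And>j. (deriv ^^ j) f differentiable_on UNIV"
  defines "g \<equiv> \<lambda>A B C j t. A * (deriv ^^ j) f (t - x) + B * (deriv ^^ j) f (t - y) + C * (deriv ^^ j) f (t - z)"
  shows "(deriv ^^ j) (g A B C 0) = g A B C j" "g A B C j differentiable_on UNIV"
proof -
  have d: "((deriv ^^ j) f has_real_derivative (deriv ^^ Suc j) f t) (at t)" for j t
    using assms(1)[of j] by (auto simp: differentiable_on_def intro!: DERIV_deriv_iff_real_differentiable[THEN iffD2])
  have ds: "((\<lambda>t. (deriv ^^ j) f (t - x)) has_real_derivative (deriv ^^ Suc j) f (t - x)) (at t)" for j t x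
    using DERIV_shift[of "(deriv ^^ j) f" "(deriv ^^ Suc j) f (t - x)" t "- x"] d[of j "t - x"] by simp
  have gd: "(g A B C j has_real_derivative g A B C (Suc j) t) (at t)" for j t
    unfolding g_def by (intro DERIV_add DERIV_cmult ds)
  show "g A B C j differentiable_on UNIV"
    using gd unfolding differentiable_on_def real_differentiable_def by (metis UNIV_I at_within_open open_UNIV)
  show "(deriv ^^ j) (g A B C 0) = g A B C j"
  proof (induction j)
    case (Suc j)
    then show ?case using DERIV_imp_deriv[OF gd, of j] by auto
  qed simp
qed

text \<open>The estimate for an approximate identity of mass \<open>K\<close>.\<close>

lemma bump_average:
  fixes u :: "real \<Rightarrow> 'a::euclidean_space" and \<eta> :: "real \<Rightarrow> real"
  assumes "continuous_on {x - e..x + e} u" "continuous_on UNIV \<eta>" "\<And>t. \<eta> t \<ge> 0"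
    and "integral {-e..e} \<eta> = K" and "\<And>t. t \<in> {x - e..x + e} \<Longrightarrow> norm (u t - u x) \<le> \<epsilon>"
  shows "norm (integral {x - e..x + e} (\<lambda>t. \<eta> (t - x) *\<^sub>R u t) - K *\<^sub>R u x) \<le> K * \<epsilon>"
proof -
  have c: "continuous_on {x - e..x + e} (\<lambda>t. \<eta> (t - x))"
    by (rule continuous_on_compose2[OF assms(2)]) (auto intro!: continuous_intros)
  have "integral {x - e..x + e} (\<lambda>t. \<eta> (t - x)) = integral {-e..e} \<eta>"
    using integral_shift_Icc_real[of "-e" e "\<lambda>t. \<eta> (t - x)" x] by (simp add: o_def add.commute)
  then have K: "integral {x - e..x + e} (\<lambda>t. \<eta> (t - x)) = K" using assms(4) by simp
  have "integral {x - e..x + e} (\<lambda>t. \<eta> (t - x) *\<^sub>R u t) - K *\<^sub>R u x =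
      integral {x - e..x + e} (\<lambda>t. \<eta> (t - x) *\<^sub>R u t) - integral {x - e..x + e} (\<lambda>t. \<eta> (t - x) *\<^sub>R u x)"
    using K integral_unique[OF has_integral_scaleR_left[OF integrable_integral[OF integrable_continuous_real[OF c]], of "u x"]]
    by simp
  also have "\<dots> = integral {x - e..x + e} (\<lambda>t. \<eta> (t - x) *\<^sub>R u t - \<eta> (t - x) *\<^sub>R u x)"
    by (intro Henstock_Kurzweil_Integration.integral_diff[symmetric] integrable_continuous_real continuous_intros c assms)
  finally have "norm (integral {x - e..x + e} (\<lambda>t. \<eta> (t - x) *\<^sub>R u t) - K *\<^sub>R u x)
      = norm (integral {x - e..x + e} (\<lambda>t. \<eta> (t - x) *\<^sub>R u t - \<eta> (t - x) *\<^sub>R u x))" by simp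
  also have "\<dots> \<le> integral {x - e..x + e} (\<lambda>t. \<eta> (t - x) * \<epsilon>)"
    by (intro integral_norm_bound_integral integrable_continuous_real continuous_intros c assms)
      (use assms in \<open>auto simp flip: scaleR_diff_right intro!: mult_left_mono\<close>)
  finally show ?thesis using K by simp
qed

text \<open>The test function is a smoothed multiple of the tent with nodes \<open>x\<close>, \<open>y\<close>, \<open>z\<close>; its second
  derivative is concentrated near the three nodes.\<close>

lemma weakly_affine_three_points:
  fixes u :: "real \<Rightarrow> 'a::euclidean_space"
  assumes cont: "continuous_on {a<..<b} u"
    and weak: "\<And>\<phi>. test_function {a<..<b} \<phi> \<Longrightarrow>
           (LINT t:{a<..<b}|lebesgue. deriv (deriv \<phi>) t *\<^sub>R u t) = 0"
    and xyz: "a < x" "x < y" "y < z" "z < b"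
  shows "(z - y) *\<^sub>R u x + (x - z) *\<^sub>R u y + (y - x) *\<^sub>R u z = 0"
proof (rule ccontr)
  \<comment> \<open>These weights satisfy A + B + C = 0 and A x + B y + C z = 0. Hence the
    combination of the three shifted ramps vanishes to the right of all nodes, which gives compact
    support.\<close>
  define A B C where "A = z - y" and "B = x - z" and "C = y - x"
  define v where "v = A *\<^sub>R u x + B *\<^sub>R u y + C *\<^sub>R u z"
  assume "\<not> ?thesis"
  then have v: "norm v > 0" by (simp add: v_def A_def B_def C_def)
  \<comment> \<open>The three averaging errors, weighted by |A|, |B|, |C|, then add up to only half
    of \<open>K * norm v\<close>, a contradiction.\<close>
  define \<epsilon> where "\<epsilon> = norm v / (2 * (\<bar>A\<bar> + \<bar>B\<bar> + \<bar>C\<bar>))"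
  have pos: "\<bar>A\<bar> + \<bar>B\<bar> + \<bar>C\<bar> > 0" using xyz by (simp add: A_def B_def C_def)
  have \<epsilon>: "\<epsilon> > 0" using v pos by (simp add: \<epsilon>_def)
  have near: "\<exists>d>0. \<forall>t. \<bar>t - p\<bar> \<le> d \<longrightarrow> a < t \<and> t < b \<and> norm (u t - u p) \<le> \<epsilon>"
    if "a < p" "p < b" for p
  proof -
    have "isCont u p" using cont that by (simp add: continuous_on_eq_continuous_at)
    then obtain d where d: "d > 0" "\<And>t. \<bar>t - p\<bar> < d \<Longrightarrow> norm (u t - u p) < \<epsilon>"
      using \<epsilon> unfolding continuous_at_eps_delta dist_norm by (metis real_norm_def)
    show ?thesis
    proof (intro exI[of _ "min (d / 2) (min ((p - a) / 2) ((b - p) / 2))"] conjI allI impI)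
      fix t assume t: "\<bar>t - p\<bar> \<le> min (d / 2) (min ((p - a) / 2) ((b - p) / 2))"
      then show "norm (u t - u p) \<le> \<epsilon>" using d(1) by (intro less_imp_le[OF d(2)]) auto
      have *: "\<bar>t - p\<bar> \<le> (p - a) / 2" "\<bar>t - p\<bar> \<le> (b - p) / 2" using t by auto
      then show "a < t" using that abs_ge_minus_self[of "t - p"] by argo
      show "t < b" using * that abs_ge_self[of "t - p"] by argo
    qed (use d that in auto)
  qed
  obtain d1 where d1: "d1 > 0" "\<And>t. \<bar>t - x\<bar> \<le> d1 \<Longrightarrow> a < t \<and> t < b \<and> norm (u t - u x) \<le> \<epsilon>"
    using near[of x] xyz by auto
  obtain d2 where d2: "d2 > 0" "\<And>t. \<bar>t - y\<bar> \<le> d2 \<Longrightarrow> a < t \<and> t < b \<and> norm (u t - u y) \<le> \<epsilon>"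
    using near[of y] xyz by auto
  obtain d3 where d3: "d3 > 0" "\<And>t. \<bar>t - z\<bar> \<le> d3 \<Longrightarrow> a < t \<and> t < b \<and> norm (u t - u z) \<le> \<epsilon>"
    using near[of z] xyz by auto
  define e where "e = min d1 (min d2 d3)"
  have e: "e > 0" using d1 d2 d3 by (simp add: e_def)
  have ed: "e \<le> d1" "e \<le> d2" "e \<le> d3" by (auto simp: e_def)
  obtain R H \<eta> r K where R: "\<And>t. (R has_real_derivative H t) (at t)"
    and H: "\<And>t. (H has_real_derivative \<eta> t) (at t)"
    and \<eta>: "\<And>j. (deriv ^^ j) \<eta> differentiable_on UNIV"
    and \<eta>0: "\<And>t. \<eta> t \<ge> 0" "\<And>t. \<bar>t\<bar> \<ge> e \<Longrightarrow> \<eta> t = 0"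
    and R0: "\<And>t. t \<le> - e \<Longrightarrow> R t = 0" and R1: "\<And>t. t \<ge> e \<Longrightarrow> R t = r + K * t"
    and K: "K > 0" "integral {-e..e} \<eta> = K"
    using smooth_ramp_exists[OF e] by metis
  define \<phi> where "\<phi> = (\<lambda>t. A * R (t - x) + B * R (t - y) + C * R (t - z))"
  define \<phi>'' where "\<phi>'' = (\<lambda>t. A * \<eta> (t - x) + B * \<eta> (t - y) + C * \<eta> (t - z))"
  have shift: "((\<lambda>t. F (t - p)) has_real_derivative G (t - p)) (at t)"
    if "\<And>t. (F has_real_derivative G t) (at t)" for F G :: "real \<Rightarrow> real" and p t
    using DERIV_shift[of F "G (t - p)" t "- p"] that[of "t - p"] by simp
  have D1: "(\<phi> has_real_derivative A * H (t - x) + B * H (t - y) + C * H (t - z)) (at t)" for t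
    unfolding \<phi>_def by (intro DERIV_add DERIV_cmult shift R)
  then have d\<phi>: "deriv \<phi> = (\<lambda>t. A * H (t - x) + B * H (t - y) + C * H (t - z))"
    by (auto intro!: DERIV_imp_deriv)
  have D2: "(deriv \<phi> has_real_derivative \<phi>'' t) (at t)" for t
    unfolding \<phi>''_def d\<phi> by (intro DERIV_add DERIV_cmult shift H)
  then have dd\<phi>: "deriv (deriv \<phi>) = \<phi>''"
    by (auto intro!: DERIV_imp_deriv)
  have "test_function {a<..<b} \<phi>"
    unfolding test_function_def
  proof (intro conjI allI exI[of _ "{x - e..z + e}"] impI)
    fix j
    show "(deriv ^^ j) \<phi> differentiable_on UNIV"
    proof (cases j)
      case 0
      then show ?thesis using D1 unfolding differentiable_on_def real_differentiable_def
        by (metis UNIV_I at_within_open open_UNIV funpow_0)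
    next
      case (Suc k)
      show ?thesis
      proof (cases k)
        case 0
        then show ?thesis using D2 Suc unfolding differentiable_on_def real_differentiable_def
          by (metis UNIV_I at_within_open open_UNIV funpow_0 funpow.simps(2) comp_apply)
      next
        case (Suc i)
        have "(deriv ^^ j) \<phi> = (deriv ^^ i) \<phi>''"
          using dd\<phi> Suc \<open>j = Suc k\<close> by (simp add: funpow_swap1)
        then show ?thesis
          using deriv_iterate_shifts[OF \<eta>, where j = i and A = A and B = B and C = C and x = x and y = y and z = z]
          by (simp add: \<phi>''_def)
      qed
    qed
  next
    show "{x - e..z + e} \<subseteq> {a<..<b}"
      using d1(2)[of "x - e"] d3(2)[of "z + e"] e ed by auto
  next
    fix t assume "t \<notin> {x - e..z + e}"
    then consider "t < x - e" | "t > z + e" by force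
    then show "\<phi> t = 0"
    proof cases
      case 1
      then show ?thesis using xyz by (simp add: \<phi>_def R0)
    next
      case 2
      then have "\<phi> t = A * (r + K * (t - x)) + B * (r + K * (t - y)) + C * (r + K * (t - z))"
        using xyz by (simp add: \<phi>_def R1)
      then show ?thesis by (simp add: A_def B_def C_def algebra_simps)
    qed
  qed auto
  from weak[OF this] have I0: "(LINT t:{a<..<b}|lebesgue. \<phi>'' t *\<^sub>R u t) = 0"
    by (simp add: dd\<phi>)
  define J where "J p = integral {p - e..p + e} (\<lambda>t. \<eta> (t - p) *\<^sub>R u t)" for p
  have c\<eta>: "continuous_on UNIV \<eta>"
    using \<eta>[of 0] differentiable_imp_continuous_on by fastforce
  have cu: "continuous_on {p - e..p + e} u" and sub: "{p - e..p + e} \<subseteq> {a<..<b}"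
    and J: "set_integrable lebesgue {a<..<b} (\<lambda>t. \<eta> (t - p) *\<^sub>R u t)"
       "(LINT t:{a<..<b}|lebesgue. \<eta> (t - p) *\<^sub>R u t) = J p"
    if p: "p \<in> {x, y, z}" for p
  proof -
    have dp: "a < t \<and> t < b" if "\<bar>t - p\<bar> \<le> e" for t
      using p that d1(2)[of t] d2(2)[of t] d3(2)[of t] by (auto simp: e_def)
    show sub: "{p - e..p + e} \<subseteq> {a<..<b}"
      using dp by (auto simp: abs_le_iff)
    show cu: "continuous_on {p - e..p + e} u"
      using sub cont continuous_on_subset by blast
    have c: "continuous_on {p - e..p + e} (\<lambda>t. \<eta> (t - p) *\<^sub>R u t)"
      by (intro continuous_intros cu continuous_on_compose2[OF c\<eta>]) auto
    have eq: "indicator {a<..<b} t *\<^sub>R (\<eta> (t - p) *\<^sub>R u t) = indicator {p - e..p + e} t *\<^sub>R (\<eta> (t - p) *\<^sub>R u t)" for t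
      using sub \<eta>0(2)[of "t - p"] by (cases "t \<in> {p - e..p + e}") (auto simp: indicator_def abs_if)
    have si: "set_integrable lebesgue {p - e..p + e} (\<lambda>t. \<eta> (t - p) *\<^sub>R u t)"
      by (rule absolutely_integrable_continuous_real[OF c])
    then show "set_integrable lebesgue {a<..<b} (\<lambda>t. \<eta> (t - p) *\<^sub>R u t)"
      unfolding set_integrable_def eq .
    show "(LINT t:{a<..<b}|lebesgue. \<eta> (t - p) *\<^sub>R u t) = J p"
      using set_lebesgue_integral_eq_integral(2)[OF si] unfolding J_def set_lebesgue_integral_def eq .
  qed
  have "(LINT t:{a<..<b}|lebesgue. \<phi>'' t *\<^sub>R u t) =
     (LINT t:{a<..<b}|lebesgue. A *\<^sub>R (\<eta> (t - x) *\<^sub>R u t) + B *\<^sub>R (\<eta> (t - y) *\<^sub>R u t) + C *\<^sub>R (\<eta> (t - z) *\<^sub>R u t))"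
    by (simp add: \<phi>''_def scaleR_add_left)
  also have "\<dots> = A *\<^sub>R J x + B *\<^sub>R J y + C *\<^sub>R J z"
    using J by (simp add: set_integral_add set_integral_scaleR_right set_integrable_scaleR_right del: scaleR_scaleR)
  finally have S0: "A *\<^sub>R J x + B *\<^sub>R J y + C *\<^sub>R J z = 0" using I0 by simp
  have est: "norm (J p - K *\<^sub>R u p) \<le> K * \<epsilon>" if p: "p \<in> {x, y, z}" for p
    unfolding J_def
  proof (rule bump_average[OF cu[OF p] c\<eta> \<eta>0(1) K(2)])
    fix t assume "t \<in> {p - e..p + e}"
    then have "\<bar>t - p\<bar> \<le> e" by auto
    then show "norm (u t - u p) \<le> \<epsilon>"
      using p d1(2)[of t] d2(2)[of t] d3(2)[of t] by (auto simp: e_def)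
  qed
  have "K *\<^sub>R v = - (A *\<^sub>R (J x - K *\<^sub>R u x) + B *\<^sub>R (J y - K *\<^sub>R u y) + C *\<^sub>R (J z - K *\<^sub>R u z))"
    using S0 by (simp add: v_def algebra_simps)
  then have "K * norm v = norm (A *\<^sub>R (J x - K *\<^sub>R u x) + B *\<^sub>R (J y - K *\<^sub>R u y) + C *\<^sub>R (J z - K *\<^sub>R u z))"
    using K by (metis abs_of_pos norm_minus_cancel norm_scaleR)
  also have "\<dots> \<le> \<bar>A\<bar> * (K * \<epsilon>) + \<bar>B\<bar> * (K * \<epsilon>) + \<bar>C\<bar> * (K * \<epsilon>)"
    by (intro norm_triangle_mono) (auto intro!: mult_left_mono est)
  also have "\<dots> = K * ((\<bar>A\<bar> + \<bar>B\<bar> + \<bar>C\<bar>) * \<epsilon>)" by (simp add: algebra_simps)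
  also have "(\<bar>A\<bar> + \<bar>B\<bar> + \<bar>C\<bar>) * \<epsilon> = norm v / 2"
  proof -
    have "S * (n / (2 * S)) = n / 2" if "S > 0" for S n :: real using that by simp
    from this[OF pos] show ?thesis unfolding \<epsilon>_def .
  qed
  finally show False using v K by simp
qed

text \<open>Two fixed nodes at the thirds of the interval determine the affine function; the
  three-point identity, used for each position of \<open>t\<close> relative to them, puts
  \<open>u t\<close> on it.\<close>

lemma weakly_affine:
  fixes u :: "real \<Rightarrow> 'a::euclidean_space"
  assumes cont: "continuous_on {a<..<b} u"
    and weak: "\<And>\<phi>. test_function {a<..<b} \<phi> \<Longrightarrow>
           (LINT t:{a<..<b}|lebesgue. deriv (deriv \<phi>) t *\<^sub>R u t) = 0"
  obtains A B where "\<And>t. t \<in> {a<..<b} \<Longrightarrow> u t = A + t *\<^sub>R B"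
proof (cases "a < b")
  case True
  define x where "x = a + (b - a) / 3"
  define z where "z = a + 2 * (b - a) / 3"
  have xz: "a < x" "x < z" "z < b" using True by (auto simp: x_def z_def field_simps)
  define B where "B = (1 / (z - x)) *\<^sub>R (u z - u x)"
  note T = weakly_affine_three_points[OF cont weak]
  have "u t = (u x - x *\<^sub>R B) + t *\<^sub>R B" if "t \<in> {a<..<b}" for t
  proof -
    have *: "(z - x) *\<^sub>R u t = (z - x) *\<^sub>R u x + (t - x) *\<^sub>R (u z - u x)"
    proof -
      consider "t < x" | "t = x" | "x < t" "t < z" | "t = z" | "z < t" by linarith
      then show ?thesis
      proof cases
        case 1
        then show ?thesis using T[of t x z] xz that by (simp add: algebra_simps)
      next
        case 3
        then show ?thesis using T[of x t z] xz that by (simp add: algebra_simps)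
      next
        case 5
        then show ?thesis using T[of x z t] xz that by (simp add: algebra_simps)
      qed (auto simp: algebra_simps)
    qed
    have "(z - x) *\<^sub>R u t = (z - x) *\<^sub>R ((u x - x *\<^sub>R B) + t *\<^sub>R B)"
    proof -
      have "(z - x) *\<^sub>R B = u z - u x" using xz by (simp add: B_def)
      moreover have "(z - x) *\<^sub>R ((u x - x *\<^sub>R B) + t *\<^sub>R B) = (z - x) *\<^sub>R u x + (t - x) *\<^sub>R ((z - x) *\<^sub>R B)"
        by (simp add: algebra_simps)
      ultimately show ?thesis unfolding * by simp
    qed
    then show ?thesis using xz by simp
  qed
  then show ?thesis using that by blast
qed (use that in auto)

section \<open>Fubini's theorem and integration by parts against test functions\<close>

lemma lebesgue_integrable_borel_version:
  fixes f :: "real \<Rightarrow> 'a::euclidean_space"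
  assumes "integrable lebesgue f"
  obtains g where "integrable lborel g" "AE x in lebesgue. f x = g x"
proof -
  have "\<forall>b\<in>Basis. \<exists>g\<in>borel_measurable lborel. AE x in lborel. f x \<bullet> b = (g x :: real)"
    by (intro ballI completion_ex_borel_measurable_real borel_measurable_inner borel_measurable_const
        borel_measurable_integrable assms)
  then obtain g where g: "\<And>b. b \<in> Basis \<Longrightarrow> g b \<in> borel_measurable lborel"
      "\<And>b. b \<in> Basis \<Longrightarrow> AE x in lborel. f x \<bullet> b = (g b x :: real)"
    by metis
  define h where "h x = (\<Sum>b\<in>Basis. g b x *\<^sub>R b)" for x
  have hm: "h \<in> borel_measurable lborel"
    unfolding h_def using g(1) by (intro borel_measurable_sum borel_measurable_scaleR) auto
  have "AE x in lborel. \<forall>b\<in>Basis. f x \<bullet> b = g b x"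
    using g(2) by (subst AE_finite_all) auto
  then have ae: "AE x in lborel. f x = h x"
  proof eventually_elim
    case (elim x)
    then have "h x = (\<Sum>b\<in>Basis. (f x \<bullet> b) *\<^sub>R b)" by (simp add: h_def)
    then show ?case by (simp add: euclidean_representation)
  qed
  then have ae': "AE x in lebesgue. f x = h x"
    by (rule AE_completion)
  have "integrable lebesgue h"
    by (rule integrable_cong_AE_imp[OF assms]) (use ae' hm in \<open>auto intro: measurable_completion elim: eventually_mono\<close>)
  then have "integrable lborel h"
    using hm integrable_completion by blast
  then show ?thesis using that ae' by blast
qed

text \<open>Fubini's theorem on the triangle s <= t, encoded in the kernel \<open>G\<close>. It
  replaces an integration by parts in which one factor is merely the primitive of an integrable
  function.\<close>

lemma integral_scaleR_primitive:
  fixes g :: "real \<Rightarrow> real" and v :: "real \<Rightarrow> 'a::euclidean_space"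
  assumes g: "continuous_on {a..b} g" and v: "v absolutely_integrable_on {a..b}"
  shows "integral {a..b} (\<lambda>t. g t *\<^sub>R integral {a..t} v) = integral {a..b} (\<lambda>s. integral {s..b} g *\<^sub>R v s)"
proof -
  \<comment> \<open>The product measure below is built from \<open>lborel\<close>, so the Lebesgue
    integrable \<open>v\<close>, cut off to the interval, is exchanged for a Borel version.\<close>
  obtain f where f: "integrable lborel f"
    and ae: "AE x in lebesgue. indicator {a..b} x *\<^sub>R v x = f x"
    using v lebesgue_integrable_borel_version unfolding set_integrable_def by blast
  have fm[measurable]: "f \<in> borel_measurable borel" using f by auto
  define g' where "g' = (\<lambda>t. indicator {a..b} t *\<^sub>R g t)"
  have g'm[measurable]: "g' \<in> borel_measurable borel"
    unfolding g'_def using g by (intro borel_measurable_continuous_on_indicator) auto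
  have g'i: "integrable lborel g'"
    using borel_integrable_atLeastAtMost'[OF g] by (simp add: set_integrable_def g'_def)
  define G where "G = (\<lambda>s t. (of_bool (s \<le> t) * g' t) *\<^sub>R f s)"
  have Gm[measurable]: "case_prod G \<in> borel_measurable (lborel \<Otimes>\<^sub>M lborel)"
    unfolding G_def by measurable
  define C where "C = (\<integral>t. \<bar>g' t\<bar> \<partial>lborel)"
  have int_t: "integrable lborel (G s)" for s
  proof (rule Bochner_Integration.integrable_bound)
    show "integrable lborel (\<lambda>t. \<bar>g' t\<bar> * norm (f s))" using g'i by auto
  qed (auto simp: G_def)
  have int_s: "integrable lborel (\<lambda>s. \<integral>t. norm (G s t) \<partial>lborel)"
  proof (rule Bochner_Integration.integrable_bound)
    show "integrable lborel (\<lambda>s. C * norm (f s))" using f by auto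
    have "norm (\<integral>t. norm (G s t) \<partial>lborel) \<le> norm (C * norm (f s))" for s
    proof -
      have "(\<integral>t. norm (G s t) \<partial>lborel) \<le> (\<integral>t. \<bar>g' t\<bar> * norm (f s) \<partial>lborel)"
        using g'i by (intro integral_mono integrable_norm int_t integrable_mult_left) (auto simp: G_def)
      then show ?thesis by (simp add: C_def)
    qed
    then show "AE s in lborel. norm (\<integral>t. norm (G s t) \<partial>lborel) \<le> norm (C * norm (f s))" by simp
  qed simp
  have "integrable (lborel \<Otimes>\<^sub>M lborel) (case_prod G)"
    by (rule lborel_pair.Fubini_integrable) (use int_s int_t in auto)
  then have swap: "(\<integral>t. (\<integral>s. G s t \<partial>lborel) \<partial>lborel) = (\<integral>s. (\<integral>t. G s t \<partial>lborel) \<partial>lborel)"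
    by (rule lborel_pair.Fubini_integral)
  have "AE x in lebesgue. x \<in> {a..b} \<longrightarrow> v x = f x"
    using ae by eventually_elim (auto simp: indicator_def)
  then obtain N where N: "negligible N" "\<And>x. x \<in> {a..b} - N \<Longrightarrow> v x = f x"
    by (auto simp: eventually_ae_filter_negligible)
  \<comment> \<open>The kernel does not cut off in \<open>s\<close> to the left of \<open>a\<close>;
    the vanishing of \<open>f\<close> there, up to a null set, does it.\<close>
  have f0: "AE x in lborel. x \<notin> {a..b} \<longrightarrow> f x = 0"
  proof -
    have "AE x in lebesgue. x \<notin> {a..b} \<longrightarrow> f x = 0"
      using ae by eventually_elim (auto simp: indicator_def)
    then show ?thesis by (subst (asm) AE_completion_iff) auto
  qed
  have inner1: "(\<integral>s. G s t \<partial>lborel) = indicator {a..b} t *\<^sub>R (g t *\<^sub>R integral {a..t} v)" for t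
  proof (cases "t \<in> {a..b}")
    case True
    have "(\<integral>s. G s t \<partial>lborel) = (\<integral>s. g t *\<^sub>R (indicator {a..t} s *\<^sub>R f s) \<partial>lborel)"
    proof (rule integral_cong_AE)
      show "AE s in lborel. G s t = g t *\<^sub>R indicat_real {a..t} s *\<^sub>R f s"
        using f0 by eventually_elim (use True in \<open>auto simp: G_def g'_def indicator_def\<close>)
    qed (auto simp: G_def)
    also have "\<dots> = g t *\<^sub>R (LINT s:{a..t}|lborel. f s)"
      by (simp add: set_lebesgue_integral_def del: scaleR_scaleR)
    also have "(LINT s:{a..t}|lborel. f s) = integral {a..t} f"
      using f by (intro set_borel_integral_eq_integral(2)) (auto simp: set_integrable_def intro: integrable_mult_indicator)
    also have "\<dots> = integral {a..t} v"
      by (rule integral_spike[OF N(1)]) (use True N(2) in auto)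
    finally show ?thesis using True by simp
  qed (simp add: G_def g'_def)
  have inner2: "(\<integral>t. G s t \<partial>lborel) = integral {s..b} g *\<^sub>R f s" if "a \<le> s" for s
  proof -
    have "integrable lborel (\<lambda>t. indicator {s..b} t *\<^sub>R g t)"
      using borel_integrable_atLeastAtMost'[of s b g] continuous_on_subset[OF g, of "{s..b}"] that
      by (simp add: set_integrable_def)
    moreover have "(\<integral>t. G s t \<partial>lborel) = (\<integral>t. (indicator {s..b} t *\<^sub>R g t) *\<^sub>R f s \<partial>lborel)"
      by (rule Bochner_Integration.integral_cong) (use that in \<open>auto simp: G_def g'_def indicator_def\<close>)
    ultimately have "(\<integral>t. G s t \<partial>lborel) = (\<integral>t. indicator {s..b} t *\<^sub>R g t \<partial>lborel) *\<^sub>R f s"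
      by (simp del: real_scaleR_def)
    also have "(\<integral>t. indicator {s..b} t *\<^sub>R g t \<partial>lborel) = integral {s..b} g"
      using set_borel_integral_eq_integral(2)[of "{s..b}" g] borel_integrable_atLeastAtMost'[of s b g] that
        continuous_on_subset[OF g, of "{s..b}"] by (simp add: set_lebesgue_integral_def)
    finally show ?thesis .
  qed
  have cP: "continuous_on {a..b} (\<lambda>t. integral {a..t} v)"
    by (rule indefinite_integral_continuous_1) (use v absolutely_integrable_on_def in blast)
  have "integral {a..b} (\<lambda>t. g t *\<^sub>R integral {a..t} v) = (LINT t:{a..b}|lborel. g t *\<^sub>R integral {a..t} v)"
    by (intro set_borel_integral_eq_integral(2)[symmetric] borel_integrable_atLeastAtMost' continuous_intros g cP)
  also have "\<dots> = (\<integral>t. (\<integral>s. G s t \<partial>lborel) \<partial>lborel)"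
    by (simp add: inner1 set_lebesgue_integral_def)
  also note swap
  also have "(\<integral>s. (\<integral>t. G s t \<partial>lborel) \<partial>lborel) = (LINT s:{a..b}|lborel. integral {s..b} g *\<^sub>R f s)"
    unfolding set_lebesgue_integral_def
  proof (rule integral_cong_AE)
    show "(\<lambda>s. \<integral>t. G s t \<partial>lborel) \<in> borel_measurable lborel" by simp
    have "(\<lambda>s. indicator {a..b} s *\<^sub>R (integral {s..b} g *\<^sub>R f s)) = (\<lambda>s. indicator {a..b} s *\<^sub>R (\<integral>t. G s t \<partial>lborel))"
      using inner2 by (auto simp: indicator_def)
    then show "(\<lambda>s. indicator {a..b} s *\<^sub>R (integral {s..b} g *\<^sub>R f s)) \<in> borel_measurable lborel"
      by simp
    show "AE s in lborel. (\<integral>t. G s t \<partial>lborel) = indicator {a..b} s *\<^sub>R (integral {s..b} g *\<^sub>R f s)"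
      using f0
    proof eventually_elim
      case (elim s)
      then show ?case
        by (cases "s \<in> {a..b}") (simp add: inner2, auto simp: G_def)
    qed
  qed
  also have "\<dots> = integral {a..b} (\<lambda>s. integral {s..b} g *\<^sub>R f s)"
  proof (rule set_borel_integral_eq_integral(2))
    have "integrable lborel (\<lambda>s. indicator {a..b} s *\<^sub>R (\<integral>t. G s t \<partial>lborel))"
      using lborel_pair.integrable_fst'[OF \<open>integrable (lborel \<Otimes>\<^sub>M lborel) (case_prod G)\<close>]
      by (intro integrable_mult_indicator) auto
    moreover have "(\<lambda>s. indicator {a..b} s *\<^sub>R (integral {s..b} g *\<^sub>R f s)) = (\<lambda>s. indicator {a..b} s *\<^sub>R (\<integral>t. G s t \<partial>lborel))"
      using inner2 by (auto simp: indicator_def)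
    ultimately show "set_integrable lborel {a..b} (\<lambda>s. integral {s..b} g *\<^sub>R f s)"
      by (simp add: set_integrable_def)
  qed
  also have "\<dots> = integral {a..b} (\<lambda>s. integral {s..b} g *\<^sub>R v s)"
    by (rule integral_spike[OF N(1)]) (use N(2) in auto)
  finally show ?thesis .
qed

text \<open>The compact support is enlarged to an interval strictly inside (a, b), so that all
  boundary terms at \<open>a\<close> and \<open>b\<close> vanish; for an empty support the midpoint
  serves as that interval.\<close>

lemma test_functionE:
  assumes "test_function {a<..<b} \<phi>" "a < b"
  obtains l r where "a < l" "l \<le> r" "r < b"
    "\<And>t. t \<notin> {l..r} \<Longrightarrow> \<phi> t = 0 \<and> deriv \<phi> t = 0 \<and> deriv (deriv \<phi>) t = 0"
    "\<And>t. (\<phi> has_real_derivative deriv \<phi> t) (at t)"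
    "\<And>t. (deriv \<phi> has_real_derivative deriv (deriv \<phi>) t) (at t)"
    "continuous_on UNIV (deriv (deriv \<phi>))"
proof -
  have d: "(deriv ^^ j) \<phi> differentiable_on UNIV" for j
    using assms by (auto simp: test_function_def)
  have D: "((deriv ^^ j) \<phi> has_real_derivative deriv ((deriv ^^ j) \<phi>) t) (at t)" for j t
    using d[of j] by (auto simp: differentiable_on_def intro!: DERIV_deriv_iff_real_differentiable[THEN iffD2])
  obtain K where K: "compact K" "K \<subseteq> {a<..<b}" "\<And>t. t \<notin> K \<Longrightarrow> \<phi> t = 0"
    using assms by (auto simp: test_function_def)
  obtain l r where lr: "a < l" "l \<le> r" "r < b" "K \<subseteq> {l..r}"
  proof (cases "K = {}")
    case True
    then show ?thesis using that[of "(a + b) / 2" "(a + b) / 2"] assms by auto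
  next
    case False
    then obtain l r where "l \<in> K" "\<forall>t\<in>K. l \<le> t" "r \<in> K" "\<forall>t\<in>K. t \<le> r"
      using compact_attains_inf[OF K(1)] compact_attains_sup[OF K(1)] by metis
    then show ?thesis using that[of l r] K(2) by (auto simp: subset_iff)
  qed
  have op: "open (- {l..r})" by (simp add: open_Compl)
  have z0: "\<phi> t = 0" if "t \<notin> {l..r}" for t using K(3) lr that by blast
  have z: "deriv \<psi> t = 0" if "\<And>t. t \<notin> {l..r} \<Longrightarrow> \<psi> t = 0" "t \<notin> {l..r}" for \<psi> :: "real \<Rightarrow> real" and t
  proof -
    have "eventually (\<lambda>y. \<psi> y = 0) (nhds t)"
      by (rule eventually_mono[OF eventually_nhds_in_open[OF op, of t]]) (use that in auto)
    then have "(\<psi> has_real_derivative 0) (at t)"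
      by (subst DERIV_cong_ev[OF refl _ refl]) auto
    then show ?thesis by (rule DERIV_imp_deriv)
  qed
  have z1: "deriv \<phi> t = 0" if "t \<notin> {l..r}" for t using z[of \<phi> t] z0 that by blast
  have z2: "deriv (deriv \<phi>) t = 0" if "t \<notin> {l..r}" for t using z[of "deriv \<phi>" t] z1 that by blast
  have "continuous_on UNIV (deriv (deriv \<phi>))"
    using d[of 2] differentiable_imp_continuous_on by (simp add: numeral_2_eq_2)
  then show ?thesis
    using that[OF lr(1-3)] z0 z1 z2 D[of 0] D[of 1] by simp
qed

lemma LINT_Ioo:
  fixes f :: "real \<Rightarrow> 'a::euclidean_space"
  assumes "f absolutely_integrable_on {a..b}"
  shows "(LINT t:{a<..<b}|lebesgue. f t) = integral {a..b} f"
  using assms set_lebesgue_integral_eq_integral(2)[of "{a<..<b}" f]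
  by (simp add: absolutely_integrable_on_Icc_iff_Ioo integral_open_interval_real)

lemma absolutely_integrable_continuous_scaleR:
  fixes f :: "real \<Rightarrow> 'a::euclidean_space" and g :: "real \<Rightarrow> real"
  assumes "continuous_on {a..b} g" "f absolutely_integrable_on {a..b}"
  shows "(\<lambda>t. g t *\<^sub>R f t) absolutely_integrable_on {a..b}"
proof (rule absolutely_integrable_bounded_measurable_product[where h = "(*\<^sub>R)", OF _ _ _ _ assms(2)])
  show "bilinear ((*\<^sub>R) :: real \<Rightarrow> 'a \<Rightarrow> 'a)" by (simp add: bilinear_conv_bounded_bilinear bounded_bilinear_scaleR)
  show "g \<in> borel_measurable (lebesgue_on {a..b})"
    by (rule continuous_imp_measurable_on_sets_lebesgue[OF assms(1)]) auto
  show "bounded (g ` {a..b})"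
    by (intro compact_imp_bounded compact_continuous_image assms) auto
qed auto

lemma integral_by_parts_vanishing:
  fixes c w :: "real \<Rightarrow> 'a::euclidean_space" and \<psi> \<psi>' :: "real \<Rightarrow> real"
  assumes "a < b" "\<And>t. (\<psi> has_real_derivative \<psi>' t) (at t)" "\<psi> a = 0" "\<psi> b = 0"
    and "continuous_on UNIV \<psi>'"
    and "\<And>t. t \<in> {a..b} \<Longrightarrow> (c has_vector_derivative w t) (at t within {a..b})"
    and "continuous_on {a..b} w"
  shows "integral {a..b} (\<lambda>t. \<psi>' t *\<^sub>R c t) = - integral {a..b} (\<lambda>t. \<psi> t *\<^sub>R w t)"
proof -
  have c\<psi>: "continuous_on {a..b} \<psi>"
    by (rule DERIV_continuous_on[OF has_field_derivative_at_within[OF assms(2)]])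
  have cc: "continuous_on {a..b} c"
    using assms(6) continuous_on_vector_derivative by blast
  have "((\<lambda>t. \<psi> t *\<^sub>R w t + \<psi>' t *\<^sub>R c t) has_integral (\<psi> b *\<^sub>R c b - \<psi> a *\<^sub>R c a)) {a..b}"
    using assms(1)
    by (intro fundamental_theorem_of_calculus has_vector_derivative_scaleR
        has_field_derivative_at_within[OF assms(2)] assms(6)) auto
  then have "integral {a..b} (\<lambda>t. \<psi> t *\<^sub>R w t + \<psi>' t *\<^sub>R c t) = 0"
    using assms by (simp add: integral_unique)
  moreover have "integral {a..b} (\<lambda>t. \<psi> t *\<^sub>R w t + \<psi>' t *\<^sub>R c t) =
     integral {a..b} (\<lambda>t. \<psi> t *\<^sub>R w t) + integral {a..b} (\<lambda>t. \<psi>' t *\<^sub>R c t)"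
    using assms(5,7) c\<psi> cc
    by (intro Henstock_Kurzweil_Integration.integral_add integrable_continuous_real continuous_intros)
      (auto intro: continuous_on_subset)
  ultimately show ?thesis by (simp add: eq_neg_iff_add_eq_0 add.commute)
qed

text \<open>The classical picture of an integrable weak second derivative: \<open>c\<close> has a
  derivative \<open>w\<close>, one-sided at the endpoints, and \<open>w\<close> is absolutely
  continuous with density \<open>v\<close>. Both directions of the theorem pass through it.\<close>

locale twice_primitive =
  fixes a b :: real and c w v :: "real \<Rightarrow> 'a::euclidean_space"
  assumes ab: "a < b"
    and v: "v absolutely_integrable_on {a..b}"
    and w: "\<And>t. t \<in> {a..b} \<Longrightarrow> w t = w a + integral {a..t} v"
    and c: "\<And>t. t \<in> {a..b} \<Longrightarrow> (c has_vector_derivative w t) (at t within {a..b})"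
begin

lemma continuous_primitive: "continuous_on {a..b} (\<lambda>t. integral {a..t} v)"
  by (rule indefinite_integral_continuous_1) (use v absolutely_integrable_on_def in blast)

lemma continuous_w: "continuous_on {a..b} w"
proof (rule continuous_on_eq)
  show "continuous_on {a..b} (\<lambda>t. w a + integral {a..t} v)"
    by (intro continuous_intros continuous_primitive)
qed (rule w[symmetric])

lemma continuous_c: "continuous_on {a..b} c"
  using c continuous_on_vector_derivative by blast

lemma weak_first:
  assumes "test_function {a<..<b} \<phi>"
  shows "(LINT t:{a<..<b}|lebesgue. deriv \<phi> t *\<^sub>R c t) = - (LINT t:{a<..<b}|lebesgue. \<phi> t *\<^sub>R w t)"
proof -
  obtain l r where lr: "a < l" "l \<le> r" "r < b"
    "\<And>t. t \<notin> {l..r} \<Longrightarrow> \<phi> t = 0 \<and> deriv \<phi> t = 0 \<and> deriv (deriv \<phi>) t = 0"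
    and D: "\<And>t. (\<phi> has_real_derivative deriv \<phi> t) (at t)"
    "\<And>t. (deriv \<phi> has_real_derivative deriv (deriv \<phi>) t) (at t)"
    using test_functionE[OF assms ab] by metis
  have c1: "continuous_on S \<phi>" "continuous_on S (deriv \<phi>)" for S
    by (rule DERIV_continuous_on[OF has_field_derivative_at_within[OF D(1)]]
          DERIV_continuous_on[OF has_field_derivative_at_within[OF D(2)]])+
  have "integral {a..b} (\<lambda>t. deriv \<phi> t *\<^sub>R c t) = - integral {a..b} (\<lambda>t. \<phi> t *\<^sub>R w t)"
    using lr by (intro integral_by_parts_vanishing[OF ab D(1)] c1 c continuous_w) auto
  then show ?thesis
    by (subst (1 2) LINT_Ioo)
       (auto intro!: absolutely_integrable_continuous_real continuous_intros c1 continuous_c continuous_w)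
qed

text \<open>One derivative moves from the test function to \<open>c\<close> by ordinary integration
  by parts. The other is moved by Fubini's theorem, since \<open>w\<close> is only a primitive of
  \<open>v\<close>; the constant \<open>w a\<close> drops out because the derivative of the test
  function has integral 0.\<close>

lemma weak_second:
  assumes "test_function {a<..<b} \<phi>"
  shows "(LINT t:{a<..<b}|lebesgue. deriv (deriv \<phi>) t *\<^sub>R c t) = (LINT t:{a<..<b}|lebesgue. \<phi> t *\<^sub>R v t)"
proof -
  obtain l r where lr: "a < l" "l \<le> r" "r < b"
    "\<And>t. t \<notin> {l..r} \<Longrightarrow> \<phi> t = 0 \<and> deriv \<phi> t = 0 \<and> deriv (deriv \<phi>) t = 0"
    and D: "\<And>t. (\<phi> has_real_derivative deriv \<phi> t) (at t)"
    "\<And>t. (deriv \<phi> has_real_derivative deriv (deriv \<phi>) t) (at t)"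
    and c2: "continuous_on UNIV (deriv (deriv \<phi>))"
    using test_functionE[OF assms ab] by metis
  have c1: "continuous_on S \<phi>" "continuous_on S (deriv \<phi>)" for S
    by (rule DERIV_continuous_on[OF has_field_derivative_at_within[OF D(1)]]
          DERIV_continuous_on[OF has_field_derivative_at_within[OF D(2)]])+
  have FTC: "integral {s..b} (deriv \<phi>) = - \<phi> s" if "s \<in> {a..b}" for s
  proof -
    have "(deriv \<phi> has_integral (\<phi> b - \<phi> s)) {s..b}"
      using that
      by (intro fundamental_theorem_of_calculus
          has_field_derivative_at_within[THEN has_real_derivative_iff_has_vector_derivative[THEN iffD1]] D) auto
    then show ?thesis using lr by (auto dest!: integral_unique)
  qed
  have "integral {a..b} (\<lambda>t. deriv (deriv \<phi>) t *\<^sub>R c t) = - integral {a..b} (\<lambda>t. deriv \<phi> t *\<^sub>R w t)"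
    using lr by (intro integral_by_parts_vanishing[OF ab D(2)] c2 c continuous_w) auto
  also have "integral {a..b} (\<lambda>t. deriv \<phi> t *\<^sub>R w t) =
      integral {a..b} (\<lambda>t. deriv \<phi> t *\<^sub>R w a + deriv \<phi> t *\<^sub>R integral {a..t} v)"
    by (rule Henstock_Kurzweil_Integration.integral_cong) (metis w scaleR_add_right)
  also have "\<dots> = integral {a..b} (\<lambda>t. deriv \<phi> t *\<^sub>R w a) + integral {a..b} (\<lambda>t. deriv \<phi> t *\<^sub>R integral {a..t} v)"
    by (intro Henstock_Kurzweil_Integration.integral_add integrable_continuous_real continuous_intros c1 continuous_primitive)
  also have "integral {a..b} (\<lambda>t. deriv \<phi> t *\<^sub>R w a) = 0"
    using integral_unique[OF has_integral_scaleR_left[where c = "w a", OF integrable_integral[OF integrable_continuous_real[OF c1(2)]], of a b]]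
      FTC[of a] ab lr by simp
  also have "integral {a..b} (\<lambda>t. deriv \<phi> t *\<^sub>R integral {a..t} v) = integral {a..b} (\<lambda>s. integral {s..b} (deriv \<phi>) *\<^sub>R v s)"
    by (rule integral_scaleR_primitive[OF c1(2) v])
  also have "\<dots> = integral {a..b} (\<lambda>s. - (\<phi> s *\<^sub>R v s))"
    by (rule Henstock_Kurzweil_Integration.integral_cong) (simp add: FTC)
  finally have "integral {a..b} (\<lambda>t. deriv (deriv \<phi>) t *\<^sub>R c t) = integral {a..b} (\<lambda>t. \<phi> t *\<^sub>R v t)"
    by simp
  then show ?thesis
    using LINT_Ioo[OF absolutely_integrable_continuous_scaleR[OF c1(1) v]]
      LINT_Ioo[OF absolutely_integrable_continuous_real[OF continuous_on_scaleR[OF continuous_on_subset[OF c2] continuous_c]]]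
    by simp
qed

lemma locally_integrable_on_Ioo:
  fixes f :: "real \<Rightarrow> 'b::euclidean_space"
  assumes "f absolutely_integrable_on {a..b}"
  shows "locally_integrable_on {a<..<b} f"
  unfolding locally_integrable_on_def
proof (intro allI impI)
  fix K assume K: "compact K \<and> K \<subseteq> {a<..<b}"
  then have "K \<subseteq> {a..b}" by auto
  then show "f absolutely_integrable_on K"
    by (intro set_integrable_subset[OF assms]) (use K in \<open>auto intro: compact_imp_closed lborelD borel_closed\<close>)
qed

lemma has_weak_deriv_1: "has_weak_deriv 1 {a<..<b} c w"
  unfolding has_weak_deriv_def
  using weak_first by (auto intro!: locally_integrable_on_Ioo absolutely_integrable_continuous_real continuous_c continuous_w)

lemma has_weak_deriv_2: "has_weak_deriv 2 {a<..<b} c v"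
  unfolding has_weak_deriv_def
  using weak_second by (auto intro!: locally_integrable_on_Ioo absolutely_integrable_continuous_real continuous_c v simp: numeral_2_eq_2)

end

lemma twice_primitive_canonical:
  fixes v :: "real \<Rightarrow> 'a::euclidean_space"
  assumes "a < b" "v absolutely_integrable_on {a..b}"
  defines "W \<equiv> \<lambda>t. integral {a..t} v"
  shows "twice_primitive a b (\<lambda>t. integral {a..t} W) W v"
proof
  show "W t = W a + integral {a..t} v" for t by (simp add: W_def)
  have "continuous_on {a..b} W"
    unfolding W_def by (rule indefinite_integral_continuous_1) (use assms absolutely_integrable_on_def in blast)
  then show "((\<lambda>t. integral {a..t} W) has_vector_derivative W t) (at t within {a..b})" if "t \<in> {a..b}" for t
    by (rule integral_has_vector_derivative[OF _ that])
qed (use assms in auto)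

section \<open>Almost everywhere uniqueness of the weak second derivative\<close>

lemma test_function_mono:
  assumes "test_function I \<phi>" "I \<subseteq> J"
  shows "test_function J \<phi>"
  using assms unfolding test_function_def by blast

lemma LINT_test_function_mono:
  fixes f :: "real \<Rightarrow> 'a::euclidean_space"
  assumes "\<And>t. t \<notin> I \<Longrightarrow> \<psi> t = 0" "I \<subseteq> J"
  shows "(LINT t:J|lebesgue. \<psi> t *\<^sub>R f t) = (LINT t:I|lebesgue. \<psi> t *\<^sub>R f t)"
  unfolding set_lebesgue_integral_def
  by (rule Bochner_Integration.integral_cong) (use assms in \<open>auto simp: indicator_def\<close>)

text \<open>Lebesgue differentiation: almost everywhere \<open>f x\<close> is the limit of its means
  over [x, x + h], and these are differences of integrals assumed to vanish. The extension by zero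
  provides integrability on every box.\<close>

lemma AE_zero_if_interval_integrals_zero:
  fixes f :: "real \<Rightarrow> 'a::euclidean_space"
  assumes "f absolutely_integrable_on {a..b}" "\<And>t. t \<in> {a..b} \<Longrightarrow> integral {a..t} f = 0"
  shows "AE t in lebesgue. t \<in> {a<..<b} \<longrightarrow> f t = 0"
proof -
  have fi: "f integrable_on {a..b}" using assms(1) absolutely_integrable_on_def by blast
  define g where "g t = (if t \<in> {a..b} then f t else 0)" for t
  have gi: "g integrable_on cbox x y" for x y
  proof -
    have "g integrable_on UNIV" using fi unfolding g_def by (subst integrable_restrict_UNIV)
    then show ?thesis using integrable_on_subcbox by blast
  qed
  obtain N where N: "negligible N"
    and lim: "\<And>x e. \<lbrakk>x \<notin> N; 0 < e\<rbrakk> \<Longrightarrow> \<exists>d>0. \<forall>h. 0 < h \<and> h < d \<longrightarrow>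
        norm (integral (cbox x (x + h *\<^sub>R One)) g /\<^sub>R h ^ DIM(real) - g x) < e"
    using integrable_ccontinuous_explicit[of g, OF gi] by metis
  have "f x = 0" if "x \<notin> N" "x \<in> {a<..<b}" for x
  proof (rule ccontr)
    assume "f x \<noteq> 0"
    then have "norm (f x) > 0" by simp
    then obtain d where d: "d > 0" and *: "\<And>h. 0 < h \<and> h < d \<Longrightarrow>
        norm (integral (cbox x (x + h *\<^sub>R One)) g /\<^sub>R h ^ DIM(real) - g x) < norm (f x)"
      using lim[OF \<open>x \<notin> N\<close>] by metis
    define h where "h = min (d / 2) (b - x)"
    have h: "0 < h" "h < d" "x + h \<le> b" using d that by (auto simp: h_def)
    have "integral {a..x} f + integral {x..x + h} f = integral {a..x + h} f"
      by (rule Henstock_Kurzweil_Integration.integral_combine)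
         (use h that integrable_on_subinterval[OF fi] in auto)
    then have "integral {x..x + h} f = 0" using assms(2) that h by auto
    moreover have "integral {x..x + h} g = integral {x..x + h} f"
      by (rule Henstock_Kurzweil_Integration.integral_cong) (use that h in \<open>auto simp: g_def\<close>)
    ultimately show False using *[of h] h that by (auto simp: g_def)
  qed
  then show ?thesis using N by (auto simp: eventually_ae_filter_negligible)
qed

text \<open>The double primitive of the difference has weak second derivative zero, hence is affine.
  So the single primitive is constant, and it vanishes at its base point. Since the weak derivatives
  are only locally integrable, this is done on compact subintervals.\<close>

lemma weak_second_deriv_AE_unique:
  fixes c v v' :: "real \<Rightarrow> 'a::euclidean_space"
  assumes "has_weak_deriv 2 {a<..<b} c v" "has_weak_deriv 2 {a<..<b} c v'"
  shows "AE t in lebesgue. t \<in> {a<..<b} \<longrightarrow> v t = v' t"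
proof -
  define f where "f t = v t - v' t" for t
  have local: "AE t in lebesgue. t \<in> {l<..<r} \<longrightarrow> f t = 0" if lr: "a < l" "l < r" "r < b" for l r
  proof -
    have sub: "{l..r} \<subseteq> {a<..<b}" "{l<..<r} \<subseteq> {a<..<b}" using lr by auto
    have vi: "v absolutely_integrable_on {l..r}" "v' absolutely_integrable_on {l..r}"
      using assms sub(1) unfolding has_weak_deriv_def locally_integrable_on_def by (meson compact_Icc)+
    then have fi: "f absolutely_integrable_on {l..r}"
      unfolding f_def by (rule set_integral_diff(1))
    interpret twice_primitive l r "\<lambda>t. integral {l..t} (\<lambda>t. integral {l..t} f)" "\<lambda>t. integral {l..t} f" f
      by (rule twice_primitive_canonical[OF lr(2) fi])
    have weak0: "(LINT t:{l<..<r}|lebesgue. deriv (deriv \<phi>) t *\<^sub>R integral {l..t} (\<lambda>t. integral {l..t} f)) = 0"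
      if \<phi>: "test_function {l<..<r} \<phi>" for \<phi>
    proof -
      have \<phi>': "test_function {a<..<b} \<phi>" using test_function_mono[OF \<phi> sub(2)] .
      obtain l' r' where lr': "l < l'" "r' < r" and z:
        "\<And>t. t \<notin> {l'..r'} \<Longrightarrow> \<phi> t = 0 \<and> deriv \<phi> t = 0 \<and> deriv (deriv \<phi>) t = 0"
        and D: "\<And>t. (\<phi> has_real_derivative deriv \<phi> t) (at t)"
        using test_functionE[OF \<phi> ab] by metis
      have c\<phi>: "continuous_on S \<phi>" for S
        by (rule DERIV_continuous_on[OF has_field_derivative_at_within[OF D]])
      have z': "\<phi> t = 0" if "t \<notin> {l<..<r}" for t using z[of t] lr' that by auto
      have eq: "(LINT t:{a<..<b}|lebesgue. \<phi> t *\<^sub>R g t) = (LINT t:{l<..<r}|lebesgue. \<phi> t *\<^sub>R g t)" for g :: "real \<Rightarrow> 'a"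
        by (rule LINT_test_function_mono[OF z' sub(2)])
      have "(LINT t:{a<..<b}|lebesgue. \<phi> t *\<^sub>R v t) = (LINT t:{a<..<b}|lebesgue. \<phi> t *\<^sub>R v' t)"
        using assms \<phi>' by (simp add: has_weak_deriv_def numeral_2_eq_2)
      then have *: "integral {l..r} (\<lambda>t. \<phi> t *\<^sub>R v t) = integral {l..r} (\<lambda>t. \<phi> t *\<^sub>R v' t)"
        unfolding eq by (simp add: LINT_Ioo absolutely_integrable_continuous_scaleR c\<phi> vi)
      have "(LINT t:{l<..<r}|lebesgue. deriv (deriv \<phi>) t *\<^sub>R integral {l..t} (\<lambda>t. integral {l..t} f)) =
          (LINT t:{l<..<r}|lebesgue. \<phi> t *\<^sub>R f t)"
        by (rule weak_second[OF \<phi>])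
      also have "\<dots> = integral {l..r} (\<lambda>t. \<phi> t *\<^sub>R f t)"
        by (rule LINT_Ioo[OF absolutely_integrable_continuous_scaleR[OF c\<phi> fi]])
      also have "\<dots> = integral {l..r} (\<lambda>t. \<phi> t *\<^sub>R v t - \<phi> t *\<^sub>R v' t)"
        by (simp add: f_def scaleR_diff_right)
      also have "\<dots> = 0"
        using * absolutely_integrable_continuous_scaleR[OF c\<phi> vi(1)] absolutely_integrable_continuous_scaleR[OF c\<phi> vi(2)]
        by (subst Henstock_Kurzweil_Integration.integral_diff) (auto simp: absolutely_integrable_on_def)
      finally show ?thesis .
    qed
    have cC: "continuous_on {l<..<r} (\<lambda>t. integral {l..t} (\<lambda>t. integral {l..t} f))"
      by (rule continuous_on_subset[OF continuous_c]) auto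
    obtain A B where AB: "\<And>t. t \<in> {l<..<r} \<Longrightarrow> integral {l..t} (\<lambda>t. integral {l..t} f) = A + t *\<^sub>R B"
      using weakly_affine[OF cC weak0] by blast
    have const: "integral {l..t} f = B" if "t \<in> {l<..<r}" for t
    proof -
      have "((\<lambda>t. integral {l..t} (\<lambda>t. integral {l..t} f)) has_vector_derivative integral {l..t} f) (at t)"
        using c[of t] that by (simp add: at_within_Icc_at)
      moreover have "((\<lambda>t. integral {l..t} (\<lambda>t. integral {l..t} f)) has_vector_derivative B) (at t)"
      proof (rule has_vector_derivative_transform_within_open[OF _ open_greaterThanLessThan that])
        show "((\<lambda>t. A + t *\<^sub>R B) has_vector_derivative B) (at t)"
          by (auto intro!: derivative_eq_intros)
      qed (use AB in auto)
      ultimately show ?thesis using vector_derivative_unique_at by blast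
    qed
    have W0: "integral {l..t} f = B" if "t \<in> {l..r}" for t
    proof -
      have "continuous_on {l..r} (\<lambda>t. integral {l..t} f)" by (rule continuous_primitive)
      then have "continuous_on (closure {l<..<r}) (\<lambda>t. integral {l..t} f)" using lr by simp
      then show ?thesis
        using continuous_constant_on_closure[of "{l<..<r}" "\<lambda>t. integral {l..t} f" B t] const that lr by simp
    qed
    have "B = 0" using W0[of l] lr by simp
    then show ?thesis using AE_zero_if_interval_integrals_zero[OF fi] W0 by blast
  qed
  \<comment> \<open>A countable exhaustion of (a, b), so that the exceptional null sets may be
    united.\<close>
  have "AE t in lebesgue. \<forall>n. t \<in> {a + inverse (real (Suc n))<..<b - inverse (real (Suc n))} \<longrightarrow> f t = 0"
  proof (subst AE_all_countable, rule allI)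
    fix n
    show "AE t in lebesgue. t \<in> {a + inverse (real (Suc n))<..<b - inverse (real (Suc n))} \<longrightarrow> f t = 0"
    proof (cases "a + inverse (real (Suc n)) < b - inverse (real (Suc n))")
      case True
      then show ?thesis by (intro local) auto
    qed auto
  qed
  then show ?thesis
  proof eventually_elim
    case (elim t)
    show ?case
    proof
      assume t: "t \<in> {a<..<b}"
      then obtain n where "inverse (real (Suc n)) < min (t - a) (b - t)"
        using reals_Archimedean[of "min (t - a) (b - t)"] by auto
      then show "v t = v' t" using elim[rule_format, of n] by (auto simp: f_def)
    qed
  qed
qed

text \<open>A twofold primitive of the weak second derivative differs from the function by an affine map.\<close>

lemma twice_primitive_of_weak_deriv:
  fixes c v :: "real \<Rightarrow> 'a::euclidean_space"
  assumes ab: "a < b" and cont: "continuous_on {a..b} c"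
    and weak: "has_weak_deriv 2 {a<..<b} c v" and v: "v absolutely_integrable_on {a..b}"
  obtains w where "twice_primitive a b c w v"
proof -
  define W where "W t = integral {a..t} v" for t
  define C where "C t = integral {a..t} W" for t
  interpret C: twice_primitive a b C W v
    using twice_primitive_canonical[OF ab v] by (simp add: W_def[abs_def] C_def[abs_def])
  have cu: "continuous_on {a..b} (\<lambda>t. c t - C t)"
    by (intro continuous_intros cont C.continuous_c)
  have weak0: "(LINT t:{a<..<b}|lebesgue. deriv (deriv \<phi>) t *\<^sub>R (c t - C t)) = 0"
    if \<phi>: "test_function {a<..<b} \<phi>" for \<phi>
  proof -
    have c2: "continuous_on S (deriv (deriv \<phi>))" for S
      using test_functionE[OF \<phi> ab] continuous_on_subset by (metis subset_UNIV)
    have ai: "(\<lambda>t. deriv (deriv \<phi>) t *\<^sub>R c t) absolutely_integrable_on {a<..<b}"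
      "(\<lambda>t. deriv (deriv \<phi>) t *\<^sub>R C t) absolutely_integrable_on {a<..<b}"
      by (subst absolutely_integrable_on_Icc_iff_Ioo[symmetric];
          intro absolutely_integrable_continuous_real continuous_intros c2 cont C.continuous_c)+
    have "(LINT t:{a<..<b}|lebesgue. deriv (deriv \<phi>) t *\<^sub>R (c t - C t)) =
      (LINT t:{a<..<b}|lebesgue. deriv (deriv \<phi>) t *\<^sub>R c t) - (LINT t:{a<..<b}|lebesgue. deriv (deriv \<phi>) t *\<^sub>R C t)"
      using set_integral_diff(2)[OF ai] by (simp add: scaleR_diff_right)
    also have "\<dots> = 0"
      using weak \<phi> C.weak_second[OF \<phi>] by (simp add: has_weak_deriv_def numeral_2_eq_2)
    finally show ?thesis .
  qed
  have cu': "continuous_on {a<..<b} (\<lambda>t. c t - C t)"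
    by (rule continuous_on_subset[OF cu]) auto
  obtain A B where AB: "\<And>t. t \<in> {a<..<b} \<Longrightarrow> c t - C t = A + t *\<^sub>R B"
    using weakly_affine[OF cu' weak0] by blast
  \<comment> \<open>Continuity on the closed interval carries the identity to the endpoints, where
    the one-sided derivatives of \<open>c\<close> are needed too.\<close>
  have eq: "c t = A + t *\<^sub>R B + C t" if "t \<in> {a..b}" for t
  proof -
    have "continuous_on (closure {a<..<b}) (\<lambda>t. c t - C t - (A + t *\<^sub>R B))"
      using ab by (auto intro!: continuous_intros cont C.continuous_c)
    then have "c t - C t - (A + t *\<^sub>R B) = 0"
      using continuous_constant_on_closure[of "{a<..<b}" "\<lambda>t. c t - C t - (A + t *\<^sub>R B)" 0 t] AB that ab by simp
    then show ?thesis by (simp add: algebra_simps)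
  qed
  have "twice_primitive a b c (\<lambda>t. B + W t) v"
  proof
    fix t assume t: "t \<in> {a..b}"
    show "B + W t = B + W a + integral {a..t} v" by (simp add: W_def)
    have "((\<lambda>t. A + t *\<^sub>R B + C t) has_vector_derivative B + W t) (at t within {a..b})"
      by (rule has_vector_derivative_eq_rhs[OF has_vector_derivative_add[OF _ C.c[OF t]]])
        (auto intro!: derivative_eq_intros)
    then show "(c has_vector_derivative B + W t) (at t within {a..b})"
      by (rule has_vector_derivative_transform[OF t, rotated]) (use eq in auto)
  qed (use ab v in auto)
  then show ?thesis by (rule that)
qed

section \<open>The criterion of F. Riesz\<close>

text \<open>A smooth, strictly convex stand-in for the norm. Its linear growth keeps its integrals
  under control of the p-th powers; its strict convexity lets the gap in Jensen's inequality detect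
  oscillation.\<close>

definition soft_norm :: "'a::real_inner \<Rightarrow> real" where
  "soft_norm x = sqrt (1 + x \<bullet> x)"

text \<open>The height of \<open>soft_norm\<close> at \<open>y\<close> above its tangent plane at
  \<open>x\<close>, the gradient at \<open>x\<close> being \<open>x / soft_norm x\<close>.\<close>

definition bregman :: "'a::real_inner \<Rightarrow> 'a \<Rightarrow> real" where
  "bregman x y = soft_norm y - soft_norm x - (x \<bullet> (y - x)) / soft_norm x"

lemma soft_norm_ge_1: "soft_norm x \<ge> 1"
  by (simp add: soft_norm_def)

lemma soft_norm_le: "soft_norm x \<le> 1 + norm x"
  unfolding soft_norm_def by (rule real_le_lsqrt) (auto simp: power2_norm_eq_inner[symmetric] power2_eq_square algebra_simps)

lemma soft_norm_sq: "soft_norm x * soft_norm x = 1 + x \<bullet> x"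
  unfolding soft_norm_def by (rule real_sqrt_mult_self[THEN trans]) (simp add: abs_of_nonneg add_nonneg_nonneg)

text \<open>Regard (1, x) and (1, y) as vectors with product of norms P and inner product Q. Then
  \<open>soft_norm x * bregman x y\<close> is P - Q, and P^2 - Q^2 is |x - y|^2 plus the Gram
  determinant of x and y. Dividing by P + Q <= 2P gives the bound.\<close>

lemma bregman_ge: "(norm (x - y))\<^sup>2 \<le> bregman x y * (2 * (soft_norm x * soft_norm x * soft_norm y))"
proof -
  define P Q where "P = soft_norm x * soft_norm y" and "Q = 1 + x \<bullet> y"
  note s = soft_norm_ge_1[of x] soft_norm_ge_1[of y]
  have sx: "soft_norm x > 0" "soft_norm y > 0" using s by auto
  have P: "P > 0" unfolding P_def using sx by simp
  have "bregman x y * soft_norm x = P - soft_norm x * soft_norm x - x \<bullet> (y - x)"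
    using sx by (simp add: bregman_def P_def field_simps)
  then have B: "bregman x y * soft_norm x = P - Q"
    by (simp add: soft_norm_sq Q_def inner_diff_right)
  have cs: "(x \<bullet> y)\<^sup>2 \<le> (x \<bullet> x) * (y \<bullet> y)" by (rule Cauchy_Schwarz_ineq)
  have "P\<^sup>2 = (soft_norm x * soft_norm x) * (soft_norm y * soft_norm y)"
    by (simp add: P_def power2_eq_square algebra_simps)
  also have "\<dots> = (1 + x \<bullet> x) * (1 + y \<bullet> y)" by (simp add: soft_norm_sq)
  finally have P2: "P\<^sup>2 = (1 + x \<bullet> x) * (1 + y \<bullet> y)" .
  have n: "(norm (x - y))\<^sup>2 = x \<bullet> x + y \<bullet> y - 2 * (x \<bullet> y)"
    by (simp add: power2_norm_eq_inner inner_diff_left inner_diff_right inner_commute)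
  have PQ: "(norm (x - y))\<^sup>2 \<le> P\<^sup>2 - Q\<^sup>2"
    using cs unfolding P2 Q_def n by (simp add: power2_eq_square algebra_simps)
  then have "Q\<^sup>2 \<le> P\<^sup>2" by (smt (verit) zero_le_power2)
  then have QP: "\<bar>Q\<bar> \<le> P" using P by (metis abs_le_square_iff abs_of_pos)
  have "P\<^sup>2 - Q\<^sup>2 = (P - Q) * (P + Q)" by (simp add: power2_eq_square algebra_simps)
  also have "\<dots> \<le> (P - Q) * (2 * P)"
    using QP by (intro mult_left_mono) auto
  also have "\<dots> = (bregman x y * soft_norm x) * (2 * P)" by (simp only: B)
  also have "\<dots> = bregman x y * (2 * (soft_norm x * soft_norm x * soft_norm y))"
    by (simp add: P_def)
  finally show ?thesis using PQ by simp
qed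

lemma bregman_nonneg: "bregman x y \<ge> 0"
proof -
  have "soft_norm x * soft_norm x * soft_norm y > 0"
    using soft_norm_ge_1[of x] soft_norm_ge_1[of y] by (intro mult_pos_pos) auto
  moreover have "0 \<le> bregman x y * (2 * (soft_norm x * soft_norm x * soft_norm y))"
    using bregman_ge[of x y] by (meson order_trans zero_le_power2)
  ultimately show ?thesis by (auto simp: zero_le_mult_iff)
qed

text \<open>On bounded sets the Bregman distance controls the squared distance; far away
  superlinear growth takes over.\<close>

lemma norm_diff_le_bregman:
  fixes p \<epsilon> :: real
  assumes "p > 1" "\<epsilon> > 0"
  obtains A where "A \<ge> 0"
    "\<And>x y :: 'a::real_inner. norm (x - y) \<le> A * bregman x y + \<epsilon> * (1 + norm x powr p + norm y powr p)"
proof -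
  \<comment> \<open>Beyond this radius 2z is at most \<epsilon> z^p, because z^(p-1) exceeds
    2/\<epsilon>.\<close>
  define K where "K = max 1 ((2 / \<epsilon>) powr (1 / (p - 1)))"
  have K: "K \<ge> 1" by (simp add: K_def)
  have "2 / \<epsilon> = ((2 / \<epsilon>) powr (1 / (p - 1))) powr (p - 1)"
    using assms by (simp add: powr_powr)
  also have "\<dots> \<le> K powr (p - 1)"
    using assms by (intro powr_mono2) (auto simp: K_def)
  finally have Kp: "2 / \<epsilon> \<le> K powr (p - 1)" .
  have far: "2 * z \<le> \<epsilon> * z powr p" if "z > K" for z
  proof -
    have "2 / \<epsilon> \<le> z powr (p - 1)"
      using Kp powr_mono2[of "p - 1" K z] assms K that by simp
    then have "2 / \<epsilon> * z \<le> z powr (p - 1) * z"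
      using that K by (intro mult_right_mono) auto
    also have "\<dots> = z powr p"
      using that K powr_add[of z "p - 1" 1] by simp
    finally show ?thesis using assms by (simp add: field_simps)
  qed
  \<comment> \<open>In the ball of radius \<open>K\<close> each soft norm is at most 1 + K. For a
    distance d > \<epsilon>, d is at most d^2/\<epsilon>, and \<open>bregman_ge\<close> bounds
    d^2.\<close>
  define A where "A = 2 * (1 + K) ^ 3 / \<epsilon>"
  have "A \<ge> 0" using K assms by (simp add: A_def)
  moreover have "norm (x - y) \<le> A * bregman x y + \<epsilon> * (1 + norm x powr p + norm y powr p)" for x y :: 'a
  proof (cases "norm x \<le> K \<and> norm y \<le> K")
    case True
    define d where "d = norm (x - y)"
    have pos: "\<epsilon> * (norm x powr p + norm y powr p) \<ge> 0" using assms by simp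
    have bA: "A * bregman x y \<ge> 0" by (rule mult_nonneg_nonneg[OF \<open>A \<ge> 0\<close> bregman_nonneg])
    show ?thesis
    proof (cases "d \<le> \<epsilon>")
      case True
      then show ?thesis using pos bA by (simp add: d_def algebra_simps)
    next
      case False
      have "soft_norm x \<le> 1 + K" "soft_norm y \<le> 1 + K"
        using \<open>norm x \<le> K \<and> norm y \<le> K\<close> soft_norm_le[of x] soft_norm_le[of y] by auto
      then have "soft_norm x * soft_norm x * soft_norm y \<le> (1 + K) * (1 + K) * (1 + K)"
        using soft_norm_ge_1[of x] soft_norm_ge_1[of y] K by (intro mult_mono) auto
      then have "bregman x y * (2 * (soft_norm x * soft_norm x * soft_norm y)) \<le> bregman x y * (2 * (1 + K) ^ 3)"
        by (intro mult_left_mono bregman_nonneg) (auto simp: power3_eq_cube)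
      then have "d\<^sup>2 \<le> bregman x y * (2 * (1 + K) ^ 3)"
        unfolding d_def by (rule order_trans[OF bregman_ge])
      then have "d\<^sup>2 / \<epsilon> \<le> A * bregman x y"
        using assms by (simp add: A_def field_simps)
      moreover have "d \<le> d\<^sup>2 / \<epsilon>"
        using False assms by (simp add: field_simps power2_eq_square d_def mult_right_mono)
      moreover have "\<epsilon> * (1 + norm x powr p + norm y powr p) \<ge> 0" using assms by (intro mult_nonneg_nonneg) auto
      ultimately show ?thesis by (simp add: d_def)
    qed
  next
    case False
    define z where "z = max (norm x) (norm y)"
    have "norm (x - y) \<le> 2 * z"
      using norm_triangle_ineq4[of x y] by (simp add: z_def max_def)
    also have "\<dots> \<le> \<epsilon> * z powr p"
      using False by (intro far) (auto simp: z_def)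
    also have "\<dots> \<le> \<epsilon> * (1 + norm x powr p + norm y powr p)"
      using assms by (intro mult_left_mono) (auto simp: z_def max_def)
    also have "\<dots> \<le> A * bregman x y + \<dots>"
      using mult_nonneg_nonneg[OF \<open>A \<ge> 0\<close> bregman_nonneg[of x y]] by simp
    finally show ?thesis .
  qed
  ultimately show ?thesis using that by blast
qed

text \<open>The dyadic slopes of \<open>w\<close> form a martingale bounded in \<open>L\<^sup>p\<close>. The integrals of \<open>soft_norm\<close> along it
  increase, hence converge, and their increments are integrals of Bregman distances; so the
  martingale is Cauchy in \<open>L\<^sup>1\<close>.\<close>

locale dyadic_slopes =
  fixes L :: real and w :: "real \<Rightarrow> 'a::euclidean_space" and p M :: real
  assumes L: "L > 0" and p: "p > 1"
    and cont: "continuous_on {0..L} w"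
    and bound: "\<And>n. (\<Sum>k<2 ^ n. norm (w (real (Suc k) * (L / 2 ^ n)) - w (real k * (L / 2 ^ n))) powr p
                  / (L / 2 ^ n) powr (p - 1)) \<le> M"
begin

definition h :: "nat \<Rightarrow> real" where "h n = L / 2 ^ n"

text \<open>Half-open, so that the cells of one level partition [0, L) exactly and a sum over cells
  reduces to one term.\<close>

definition cell :: "nat \<Rightarrow> nat \<Rightarrow> real set" where
  "cell n k = {real k * h n ..< real (Suc k) * h n}"

definition slope :: "nat \<Rightarrow> nat \<Rightarrow> 'a" where
  "slope n k = (1 / h n) *\<^sub>R (w (real (Suc k) * h n) - w (real k * h n))"

definition step :: "nat \<Rightarrow> real \<Rightarrow> 'a" where
  "step n t = (\<Sum>k<2 ^ n. indicator (cell n k) t *\<^sub>R slope n k)"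

lemma h_pos: "h n > 0" using L by (simp add: h_def)

lemma h_Suc: "h n = 2 * h (Suc n)" by (simp add: h_def)

lemma h_total: "2 ^ n * h n = L" by (simp add: h_def)

lemma M_nonneg: "M \<ge> 0"
  using bound[of 0] by (rule order_trans[rotated]) (auto intro!: sum_nonneg)

lemma cell_iff: "t \<in> cell n k \<longleftrightarrow> t \<ge> 0 \<and> k = nat \<lfloor>t / h n\<rfloor>"
proof -
  have "t \<in> cell n k \<longleftrightarrow> real k \<le> t / h n \<and> t / h n < real k + 1"
    using h_pos[of n] by (auto simp: cell_def field_simps)
  also have "\<dots> \<longleftrightarrow> \<lfloor>t / h n\<rfloor> = int k"
    by (simp add: floor_eq_iff)
  also have "\<dots> \<longleftrightarrow> t \<ge> 0 \<and> k = nat \<lfloor>t / h n\<rfloor>"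
  proof -
    have "\<lfloor>t / h n\<rfloor> \<ge> 0 \<longleftrightarrow> t \<ge> 0" using h_pos[of n] by (simp add: zero_le_divide_iff)
    then show ?thesis
      by (cases "t \<ge> 0") (metis int_nat_eq nat_int, metis of_nat_0_le_iff)
  qed
  finally show ?thesis .
qed

lemma cell_bound: "t \<ge> 0 \<Longrightarrow> nat \<lfloor>t / h n\<rfloor> < 2 ^ n \<longleftrightarrow> t < L"
proof -
  assume "t \<ge> 0"
  then have "\<lfloor>t / h n\<rfloor> \<ge> 0" using h_pos[of n] by simp
  then have "nat \<lfloor>t / h n\<rfloor> < 2 ^ n \<longleftrightarrow> \<lfloor>t / h n\<rfloor> < 2 ^ n"
    by (simp add: nat_less_iff)
  also have "\<dots> \<longleftrightarrow> t / h n < 2 ^ n" by (simp add: floor_less_iff)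
  also have "\<dots> \<longleftrightarrow> t < L" using h_pos[of n] h_total[of n] by (simp add: pos_divide_less_eq)
  finally show ?thesis .
qed

lemma sum_cells:
  fixes f :: "nat \<Rightarrow> 'b::real_vector"
  shows "(\<Sum>k<2 ^ n. indicator (cell n k) t *\<^sub>R f k) =
     (if t \<in> {0..<L} then f (nat \<lfloor>t / h n\<rfloor>) else 0)"
proof -
  have "(\<Sum>k<2 ^ n. indicator (cell n k) t *\<^sub>R f k) = (\<Sum>k<2 ^ n. if k = nat \<lfloor>t / h n\<rfloor> then (if t \<ge> 0 then f k else 0) else 0)"
    by (intro sum.cong) (auto simp: indicator_def cell_iff)
  also have "\<dots> = (if t \<in> {0..<L} then f (nat \<lfloor>t / h n\<rfloor>) else 0)"
    using cell_bound[of t n] by (subst sum.delta) auto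
  finally show ?thesis .
qed

lemma step_eq: "step n t = (if t \<in> {0..<L} then slope n (nat \<lfloor>t / h n\<rfloor>) else 0)"
  unfolding step_def by (rule sum_cells)

lemma step_cell: "k < 2 ^ n \<Longrightarrow> t \<in> cell n k \<Longrightarrow> step n t = slope n k"
  using cell_bound[of t n] by (auto simp: step_eq cell_iff)

lemma cell_sets[measurable]: "cell n k \<in> sets borel" by (simp add: cell_def)

lemma cell_measure: "measure lborel (cell n k) = h n" "emeasure lborel (cell n k) = ennreal (h n)"
  using h_pos[of n] by (auto simp: cell_def algebra_simps)

lemma indicator_cell_integrable: "integrable lborel (indicat_real (cell n k))"
  by (rule integrable_real_indicator) (auto simp: cell_measure)

lemma integrable_step_fun:
  fixes F :: "'a \<Rightarrow> 'b::{banach, second_countable_topology}"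
  shows "integrable lborel (\<lambda>t. indicator {0..<L} t *\<^sub>R F (step n t))"
    and "(LINT t|lborel. indicator {0..<L} t *\<^sub>R F (step n t)) = (\<Sum>k<2 ^ n. h n *\<^sub>R F (slope n k))"
proof -
  have eq: "(\<lambda>t. indicator {0..<L} t *\<^sub>R F (step n t)) = (\<lambda>t. \<Sum>k<2 ^ n. indicator (cell n k) t *\<^sub>R F (slope n k))"
    unfolding sum_cells by (auto simp: step_eq)
  show "integrable lborel (\<lambda>t. indicator {0..<L} t *\<^sub>R F (step n t))"
    unfolding eq by (intro Bochner_Integration.integrable_sum integrable_scaleR_left indicator_cell_integrable)
  show "(LINT t|lborel. indicator {0..<L} t *\<^sub>R F (step n t)) = (\<Sum>k<2 ^ n. h n *\<^sub>R F (slope n k))"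
    unfolding eq by (subst Bochner_Integration.integral_sum) (auto simp: indicator_cell_integrable cell_measure)
qed

lemma step_indicator: "indicator {0..<L} t *\<^sub>R step n t = step n t"
  by (simp add: step_eq)

lemma integrable_step: "integrable lborel (step n)"
  using integrable_step_fun(1)[of "\<lambda>x. x" n] by (simp add: step_indicator)

lemma step_measurable[measurable]: "step n \<in> borel_measurable borel"
  using integrable_step by auto

lemma cell_split: "cell n k = cell (Suc n) (2 * k) \<union> cell (Suc n) (Suc (2 * k))"
  "cell (Suc n) (2 * k) \<inter> cell (Suc n) (Suc (2 * k)) = {}"
  using h_pos[of "Suc n"] by (auto simp: cell_def h_Suc[of n] algebra_simps)

text \<open>The martingale property: a cell splits into two halves whose increments of
  \<open>w\<close> add up to that of the whole, so refining the level does not change the integral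
  over a coarse cell.\<close>

lemma integral_step_cell:
  assumes "k < 2 ^ n"
  shows "(LINT t:cell n k|lborel. step (n + d) t) = h n *\<^sub>R slope n k"
  using assms
proof (induction d arbitrary: n k)
  case 0
  have "(LINT t:cell n k|lborel. step (n + 0) t) = (LINT t:cell n k|lborel. slope n k)"
    by (intro set_lebesgue_integral_cong) (use 0 in \<open>auto simp: step_cell\<close>)
  then show ?case by (simp add: set_lebesgue_integral_def indicator_cell_integrable cell_measure)
next
  case (Suc d)
  have k: "2 * k < 2 ^ Suc n" "Suc (2 * k) < 2 ^ Suc n" using Suc.prems by auto
  have i: "set_integrable lborel A (step m)" if "A \<in> sets borel" for A m
    unfolding set_integrable_def using that by (intro integrable_mult_indicator integrable_step) auto
  have "(LINT t:cell n k|lborel. step (n + Suc d) t) =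
      (LINT t:cell (Suc n) (2 * k)|lborel. step (Suc n + d) t) + (LINT t:cell (Suc n) (Suc (2 * k))|lborel. step (Suc n + d) t)"
    unfolding cell_split(1)[of n k] by (subst set_integral_Un) (auto simp: cell_split(2) i)
  also have "\<dots> = h (Suc n) *\<^sub>R slope (Suc n) (2 * k) + h (Suc n) *\<^sub>R slope (Suc n) (Suc (2 * k))"
    using Suc.IH[OF k(1)] Suc.IH[OF k(2)] by simp
  also have "\<dots> = h n *\<^sub>R slope n k"
    using h_pos[of n] h_pos[of "Suc n"] by (simp add: slope_def) (simp add: h_Suc[of n] algebra_simps)
  finally show ?case .
qed

lemma integral_step_powr: "(LINT t|lborel. indicator {0..<L} t *\<^sub>R (norm (step n t) powr p)) \<le> M"
proof -
  have "(LINT t|lborel. indicator {0..<L} t *\<^sub>R (norm (step n t) powr p)) = (\<Sum>k<2 ^ n. h n *\<^sub>R (norm (slope n k) powr p))"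
    by (rule integrable_step_fun(2))
  also have "\<dots> = (\<Sum>k<2 ^ n. norm (w (real (Suc k) * h n) - w (real k * h n)) powr p / h n powr (p - 1))"
  proof (intro sum.cong refl)
    fix k
    have "h n * (D / h n) powr p = D powr p / h n powr (p - 1)" if "D \<ge> 0" for D
      using that h_pos[of n] by (simp add: powr_divide powr_diff)
    then show "h n *\<^sub>R (norm (slope n k) powr p) = norm (w (real (Suc k) * h n) - w (real k * h n)) powr p / h n powr (p - 1)"
      using h_pos[of n] by (simp add: slope_def)
  qed
  also have "\<dots> \<le> M" using bound[of n] unfolding h_def .
  finally show ?thesis .
qed

definition energy :: "nat \<Rightarrow> real" where
  "energy n = (LINT t|lborel. indicator {0..<L} t *\<^sub>R soft_norm (step n t))"

text \<open>The function paired with \<open>step m\<close> is constant on the cells of level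
  \<open>n\<close>, so it sees only the integrals over these cells, which do not depend on the finer
  level.\<close>

lemma orthogonality:
  fixes n m
  defines "u \<equiv> \<lambda>x::'a. (1 / soft_norm x) *\<^sub>R x"
  assumes "n \<le> m"
  shows "integrable lborel (\<lambda>t. u (step n t) \<bullet> step m t)"
    and "(LINT t|lborel. u (step n t) \<bullet> step m t) = (LINT t|lborel. u (step n t) \<bullet> step n t)"
proof -
  have eq: "(\<lambda>t. u (step n t) \<bullet> step j t) = (\<lambda>t. \<Sum>k<2 ^ n. u (slope n k) \<bullet> (indicator (cell n k) t *\<^sub>R step j t))" for j
  proof
    fix t
    have "(\<Sum>k<2 ^ n. u (slope n k) \<bullet> (indicator (cell n k) t *\<^sub>R step j t)) =
      (\<Sum>k<2 ^ n. indicator (cell n k) t *\<^sub>R u (slope n k)) \<bullet> step j t"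
      by (simp add: inner_sum_left)
    also have "\<dots> = u (step n t) \<bullet> step j t"
      unfolding sum_cells by (auto simp: step_eq)
    finally show "u (step n t) \<bullet> step j t = (\<Sum>k<2 ^ n. u (slope n k) \<bullet> (indicator (cell n k) t *\<^sub>R step j t))" by simp
  qed
  have i: "integrable lborel (\<lambda>t. indicator (cell n k) t *\<^sub>R step j t)" for k j
    by (intro integrable_mult_indicator integrable_step) auto
  have val: "(LINT t|lborel. u (step n t) \<bullet> step j t) = (\<Sum>k<2 ^ n. u (slope n k) \<bullet> (h n *\<^sub>R slope n k))"
    if "n \<le> j" for j
  proof -
    have "(LINT t|lborel. u (step n t) \<bullet> step j t) = (\<Sum>k<2 ^ n. LINT t|lborel. u (slope n k) \<bullet> (indicator (cell n k) t *\<^sub>R step j t))"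
      unfolding eq by (rule Bochner_Integration.integral_sum) (intro integrable_inner_right i)
    also have "\<dots> = (\<Sum>k<2 ^ n. u (slope n k) \<bullet> (LINT t:cell n k|lborel. step j t))"
      unfolding set_lebesgue_integral_def by (intro sum.cong refl integral_inner_right i)
    also have "\<dots> = (\<Sum>k<2 ^ n. u (slope n k) \<bullet> (h n *\<^sub>R slope n k))"
      using integral_step_cell[where n = n and d = "j - n"] that by (intro sum.cong) auto
    finally show ?thesis .
  qed
  show "integrable lborel (\<lambda>t. u (step n t) \<bullet> step m t)"
    unfolding eq by (intro Bochner_Integration.integrable_sum integrable_inner_right i)
  show "(LINT t|lborel. u (step n t) \<bullet> step m t) = (LINT t|lborel. u (step n t) \<bullet> step n t)"
    using val assms by simp
qed

text \<open>The linear term of the Bregman distance integrates to 0 by orthogonality; what remains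
  is the gain in energy between the two levels.\<close>

lemma integral_bregman:
  assumes "n \<le> m"
  shows "integrable lborel (\<lambda>t. indicator {0..<L} t *\<^sub>R bregman (step n t) (step m t))"
    and "(LINT t|lborel. indicator {0..<L} t *\<^sub>R bregman (step n t) (step m t)) = energy m - energy n"
proof -
  define u where "u = (\<lambda>x::'a. (1 / soft_norm x) *\<^sub>R x)"
  have eq: "(\<lambda>t. indicator {0..<L} t *\<^sub>R bregman (step n t) (step m t)) =
     (\<lambda>t. (indicator {0..<L} t *\<^sub>R soft_norm (step m t) - indicator {0..<L} t *\<^sub>R soft_norm (step n t))
       - (u (step n t) \<bullet> step m t - u (step n t) \<bullet> step n t))"
    by (auto simp: bregman_def u_def indicator_def step_eq inner_diff_right diff_divide_distrib)
  have o: "integrable lborel (\<lambda>t. u (step n t) \<bullet> step m t)"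
    "(LINT t|lborel. u (step n t) \<bullet> step m t) = (LINT t|lborel. u (step n t) \<bullet> step n t)"
    "integrable lborel (\<lambda>t. u (step n t) \<bullet> step n t)"
    unfolding u_def using orthogonality[OF assms] orthogonality(1)[OF order_refl, of n] by blast+
  show "integrable lborel (\<lambda>t. indicator {0..<L} t *\<^sub>R bregman (step n t) (step m t))"
    unfolding eq by (intro Bochner_Integration.integrable_diff integrable_step_fun o)
  show "(LINT t|lborel. indicator {0..<L} t *\<^sub>R bregman (step n t) (step m t)) = energy m - energy n"
  proof -
    have "(LINT t|lborel. indicator {0..<L} t *\<^sub>R bregman (step n t) (step m t)) =
      (LINT t|lborel. indicator {0..<L} t *\<^sub>R soft_norm (step m t) - indicator {0..<L} t *\<^sub>R soft_norm (step n t))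
      - (LINT t|lborel. u (step n t) \<bullet> step m t - u (step n t) \<bullet> step n t)"
      unfolding eq by (intro Bochner_Integration.integral_diff Bochner_Integration.integrable_diff integrable_step_fun o)
    also have "(LINT t|lborel. u (step n t) \<bullet> step m t - u (step n t) \<bullet> step n t) = 0"
      using Bochner_Integration.integral_diff[OF o(1,3)] o(2) by simp
    also have "(LINT t|lborel. indicator {0..<L} t *\<^sub>R soft_norm (step m t) - indicator {0..<L} t *\<^sub>R soft_norm (step n t))
        = energy m - energy n"
      unfolding energy_def by (intro Bochner_Integration.integral_diff integrable_step_fun)
    finally show ?thesis by simp
  qed
qed

lemma energy_mono: "n \<le> m \<Longrightarrow> energy n \<le> energy m"
proof -
  assume "n \<le> m"
  have "0 \<le> (LINT t|lborel. indicator {0..<L} t *\<^sub>R bregman (step n t) (step m t))"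
    by (intro integral_nonneg_AE) (auto simp: bregman_nonneg)
  then show ?thesis using integral_bregman(2)[OF \<open>n \<le> m\<close>] by simp
qed

lemma integral_indicator: "(LINT t|lborel. indicat_real {0..<L} t) = L" "integrable lborel (indicat_real {0..<L})"
  using L by auto

lemma energy_bounded: "energy n \<le> 2 * L + M"
proof -
  have "energy n \<le> (LINT t|lborel. 2 * indicator {0..<L} t + indicator {0..<L} t *\<^sub>R (norm (step n t) powr p))"
    unfolding energy_def
  proof (intro integral_mono integrable_step_fun Bochner_Integration.integrable_add integrable_mult_right integral_indicator)
    fix t
    have "soft_norm (step n t) \<le> 2 + norm (step n t) powr p"
    proof (cases "norm (step n t) \<le> 1")
      case True
      then show ?thesis
        using soft_norm_le[of "step n t"] powr_ge_zero[of "norm (step n t)" p] by linarith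
    next
      case False
      then have "norm (step n t) powr 1 \<le> norm (step n t) powr p" using p by (intro powr_mono) auto
      then show ?thesis using soft_norm_le[of "step n t"] by simp
    qed
    then show "indicator {0..<L} t *\<^sub>R soft_norm (step n t) \<le> 2 * indicator {0..<L} t + indicator {0..<L} t *\<^sub>R (norm (step n t) powr p)"
      by (auto simp: indicator_def)
  qed
  also have "\<dots> = 2 * L + (LINT t|lborel. indicator {0..<L} t *\<^sub>R (norm (step n t) powr p))"
  proof -
    have "(LINT t|lborel. 2 * indicat_real {0..<L} t) = 2 * L"
      by (simp only: integral_mult_right_zero integral_indicator)
    then show ?thesis
      using Bochner_Integration.integral_add[OF integrable_mult_right[OF integral_indicator(2), of 2]
          integrable_step_fun(1)[of "\<lambda>x. norm x powr p" n]] by simp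
  qed
  also have "\<dots> \<le> 2 * L + M" using integral_step_powr by simp
  finally show ?thesis .
qed

lemma step_L1_Cauchy:
  assumes "e > 0"
  shows "\<exists>N. \<forall>i\<ge>N. \<forall>j\<ge>N. (LINT t|lborel. norm (step i t - step j t)) < e"
proof -
  \<comment> \<open>Makes the far-field contribution, at most \<epsilon>(L + 2M), equal to
    e/2.\<close>
  define \<epsilon> where "\<epsilon> = e / (2 * (L + 2 * M))"
  have LM: "L + 2 * M > 0" using L M_nonneg by simp
  then have \<epsilon>: "\<epsilon> > 0" using assms by (simp add: \<epsilon>_def)
  obtain A where A: "A \<ge> 0"
    "\<And>x y :: 'a. norm (x - y) \<le> A * bregman x y + \<epsilon> * (1 + norm x powr p + norm y powr p)"
    using norm_diff_le_bregman[OF p \<epsilon>] by blast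
  have "convergent energy"
  proof (rule Bseq_mono_convergent)
    have "norm (energy n) \<le> \<bar>energy 0\<bar> + \<bar>2 * L + M\<bar>" for n
      using energy_mono[of 0 n] energy_bounded[of n] by simp
    then show "Bseq energy" by (rule BseqI')
  qed (use energy_mono in auto)
  then have "Cauchy energy" by (rule convergent_Cauchy)
  \<comment> \<open>\<open>A + 1\<close> in place of \<open>A\<close>, which may be 0.\<close>
  moreover have "e / (2 * (A + 1)) > 0" using assms A by simp
  ultimately obtain N where N: "\<And>i j. i \<ge> N \<Longrightarrow> j \<ge> N \<Longrightarrow> \<bar>energy i - energy j\<bar> < e / (2 * (A + 1))"
    unfolding Cauchy_def dist_real_def by metis
  have main: "(LINT t|lborel. norm (step n t - step m t)) < e" if nm: "N \<le> n" "n \<le> m" for n m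
  proof -
    have "(LINT t|lborel. norm (step n t - step m t)) \<le>
      (LINT t|lborel. A * (indicator {0..<L} t *\<^sub>R bregman (step n t) (step m t)) +
         \<epsilon> * (indicator {0..<L} t + indicator {0..<L} t *\<^sub>R (norm (step n t) powr p) + indicator {0..<L} t *\<^sub>R (norm (step m t) powr p)))"
    proof (intro integral_mono Bochner_Integration.integrable_add integrable_mult_right integral_indicator integrable_step_fun
        integral_bregman nm integrable_norm Bochner_Integration.integrable_diff integrable_step)
      fix t
      show "norm (step n t - step m t) \<le> A * (indicator {0..<L} t *\<^sub>R bregman (step n t) (step m t)) +
         \<epsilon> * (indicator {0..<L} t + indicator {0..<L} t *\<^sub>R (norm (step n t) powr p) + indicator {0..<L} t *\<^sub>R (norm (step m t) powr p))"
        using A(2)[of "step n t" "step m t"] by (cases "t \<in> {0..<L}") (auto simp: step_eq)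
    qed
    also have "\<dots> = A * (energy m - energy n) + \<epsilon> * (L + (LINT t|lborel. indicator {0..<L} t *\<^sub>R (norm (step n t) powr p))
        + (LINT t|lborel. indicator {0..<L} t *\<^sub>R (norm (step m t) powr p)))"
    proof -
      have lin: "(LINT t|lborel. A * B t + \<epsilon> * (I t + P t + Q t)) =
          A * (LINT t|lborel. B t) + \<epsilon> * ((LINT t|lborel. I t) + (LINT t|lborel. P t) + (LINT t|lborel. Q t))"
        if "integrable lborel B" "integrable lborel I" "integrable lborel P" "integrable lborel Q" for B I P Q :: "real \<Rightarrow> real"
        using that by simp
      show ?thesis
        unfolding lin[OF integral_bregman(1)[OF nm(2)] integral_indicator(2)
            integrable_step_fun(1)[of "\<lambda>x. norm x powr p" n] integrable_step_fun(1)[of "\<lambda>x. norm x powr p" m]]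
          integral_bregman(2)[OF nm(2)] integral_indicator(1) ..
    qed
    also have "\<dots> \<le> A * (energy m - energy n) + \<epsilon> * (L + M + M)"
      using \<epsilon> A(1) integral_step_powr by (intro add_mono mult_left_mono order_refl) auto
    also have "\<epsilon> * (L + M + M) = e / 2" using LM by (simp add: \<epsilon>_def field_simps)
    also have "A * (energy m - energy n) \<le> A * (e / (2 * (A + 1)))"
      using A(1) N[of m n] nm by (intro mult_left_mono) auto
    also have "A * (e / (2 * (A + 1))) < e / 2"
      using A(1) assms by (simp add: field_simps)
    finally show ?thesis by simp
  qed
  show ?thesis
  proof (intro exI[of _ N] allI impI)
    fix i j assume "N \<le> i" "N \<le> j"
    then show "(LINT t|lborel. norm (step i t - step j t)) < e"
      using main[of i j] main[of j i] by (cases "i \<le> j") (auto simp: norm_minus_commute)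
  qed
qed

text \<open>A subsequence of the slopes converges almost everywhere and in L^1. Convergence in L^1
  passes the cell integrals to the limit, so \<open>v\<close> integrates to the increments of
  \<open>w\<close> between dyadic nodes, and continuity of \<open>w\<close> covers all other points.
  Fatou's lemma gives the bound on the p-th power.\<close>

theorem riesz_representation:
  obtains v where "integrable lborel v" "\<And>t. t \<in> {0..L} \<Longrightarrow> w t = w 0 + integral {0..t} v"
    "(\<integral>\<^sup>+t. ennreal (norm (v t) powr p) \<partial>lborel) \<le> ennreal M"
proof -
  obtain r where r: "strict_mono r" and "AE t in lborel. Cauchy (\<lambda>i. step (r i) t)"
    using cauchy_L1_AE_cauchy_subseq[OF integrable_step step_L1_Cauchy] by metis
  define v where "v t = lim (\<lambda>i. step (r i) t)" for t
  have [measurable]: "v \<in> borel_measurable borel"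
    unfolding v_def by measurable
  have lim: "AE t in lborel. (\<lambda>i. step (r i) t) \<longlonglongrightarrow> v t"
    using \<open>AE t in lborel. Cauchy _\<close>
    by eventually_elim (simp add: v_def Cauchy_convergent_iff convergent_LIMSEQ_iff)
  \<comment> \<open>Fatou's lemma in the second index turns the Cauchy property into convergence to
    \<open>v\<close>.\<close>
  have L1: "\<exists>N. \<forall>i\<ge>N. (\<integral>\<^sup>+t. ennreal (norm (step (r i) t - v t)) \<partial>lborel) \<le> ennreal e" if e: "e > 0" for e
  proof -
    obtain N where N: "\<And>i j. i \<ge> N \<Longrightarrow> j \<ge> N \<Longrightarrow> (LINT t|lborel. norm (step i t - step j t)) < e"
      using step_L1_Cauchy[OF e] by blast
    have "(\<integral>\<^sup>+t. ennreal (norm (step (r i) t - v t)) \<partial>lborel) \<le> ennreal e" if i: "i \<ge> N" for i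
    proof -
      have "(\<integral>\<^sup>+t. ennreal (norm (step (r i) t - v t)) \<partial>lborel) =
         (\<integral>\<^sup>+t. liminf (\<lambda>j. ennreal (norm (step (r i) t - step (r j) t))) \<partial>lborel)"
      proof (rule nn_integral_cong_AE)
        show "AE t in lborel. ennreal (norm (step (r i) t - v t)) = liminf (\<lambda>j. ennreal (norm (step (r i) t - step (r j) t)))"
          using lim
        proof eventually_elim
          case (elim t)
          have "(\<lambda>j. ennreal (norm (step (r i) t - step (r j) t))) \<longlonglongrightarrow> ennreal (norm (step (r i) t - v t))"
            by (intro tendsto_ennrealI tendsto_intros elim)
          then show ?case by (rule lim_imp_Liminf[OF sequentially_bot, symmetric])
        qed
      qed
      also have "\<dots> \<le> liminf (\<lambda>j. \<integral>\<^sup>+t. ennreal (norm (step (r i) t - step (r j) t)) \<partial>lborel)"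
        by (rule nn_integral_liminf) auto
      also have "\<dots> \<le> ennreal e"
      proof (rule Liminf_le)
        show "\<forall>\<^sub>F j in sequentially. (\<integral>\<^sup>+t. ennreal (norm (step (r i) t - step (r j) t)) \<partial>lborel) \<le> ennreal e"
          using eventually_ge_at_top[of N]
        proof eventually_elim
          case (elim j)
          have "(\<integral>\<^sup>+t. ennreal (norm (step (r i) t - step (r j) t)) \<partial>lborel) = ennreal (LINT t|lborel. norm (step (r i) t - step (r j) t))"
            by (intro nn_integral_eq_integral integrable_norm Bochner_Integration.integrable_diff integrable_step) auto
          also have "\<dots> \<le> ennreal e"
            using N[of "r i" "r j"] i elim seq_suble[OF r] by (intro ennreal_leI less_imp_le) (auto intro: order_trans)
          finally show ?case .
        qed
      qed simp
      finally show ?thesis .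
    qed
    then show ?thesis by blast
  qed
  have vi: "integrable lborel v"
  proof -
    obtain N where N: "(\<integral>\<^sup>+t. ennreal (norm (step (r N) t - v t)) \<partial>lborel) \<le> ennreal 1"
      using L1[of 1] by auto
    have "integrable lborel (\<lambda>t. step (r N) t - v t)"
      by (rule integrableI_bounded) (use N in \<open>auto intro: le_less_trans simp: ennreal_one_less_top\<close>)
    then have "integrable lborel (\<lambda>t. step (r N) t - (step (r N) t - v t))"
      by (rule Bochner_Integration.integrable_diff[OF integrable_step])
    then show ?thesis by (rule back_subst[where P = "integrable lborel"]) auto
  qed
  have cellv: "(LINT t:cell n k|lborel. v t) = w (real (Suc k) * h n) - w (real k * h n)" if k: "k < 2 ^ n" for n k
  proof -
    have s: "(LINT t:cell n k|lborel. step (r i) t) = w (real (Suc k) * h n) - w (real k * h n)" if "i \<ge> n" for i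
      using integral_step_cell[OF k, of "r i - n"] seq_suble[OF r, of i] that h_pos[of n]
      by (simp add: slope_def)
    have "norm ((LINT t:cell n k|lborel. v t) - (w (real (Suc k) * h n) - w (real k * h n))) \<le> e" if e: "e > 0" for e
    proof -
      obtain N where N: "\<And>i. i \<ge> N \<Longrightarrow> (\<integral>\<^sup>+t. ennreal (norm (step (r i) t - v t)) \<partial>lborel) \<le> ennreal e"
        using L1[OF e] by blast
      define i where "i = max N n"
      have "(LINT t:cell n k|lborel. v t) - (LINT t:cell n k|lborel. step (r i) t) =
         (LINT t:cell n k|lborel. v t - step (r i) t)"
        by (rule set_integral_diff(2)[symmetric]) (auto simp: set_integrable_def intro!: integrable_mult_indicator vi integrable_step)
      also have "norm \<dots> \<le> (LINT t|lborel. norm (step (r i) t - v t))"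
        unfolding set_lebesgue_integral_def
        by (intro integral_norm_bound[THEN order_trans] integral_mono integrable_norm integrable_mult_indicator
            Bochner_Integration.integrable_diff vi integrable_step) (auto simp: indicator_def norm_minus_commute)
      also have "\<dots> \<le> e"
      proof -
        have "ennreal (LINT t|lborel. norm (step (r i) t - v t)) = (\<integral>\<^sup>+t. ennreal (norm (step (r i) t - v t)) \<partial>lborel)"
          by (intro nn_integral_eq_integral[symmetric] integrable_norm Bochner_Integration.integrable_diff vi integrable_step) auto
        also have "\<dots> \<le> ennreal e" by (rule N) (simp add: i_def)
        finally show ?thesis using e by (simp add: ennreal_le_iff)
      qed
      finally show ?thesis using s[of i] by (simp add: i_def)
    qed
    then show ?thesis by (metis eq_iff_diff_eq_0 field_le_epsilon add_0 norm_le_zero_iff)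
  qed
  have vint: "v integrable_on {a..b}" for a b
    using integrable_on_lborel[OF vi] integrable_on_subcbox[of v UNIV a b] by simp
  have node: "integral {0..real k * h n} v = w (real k * h n) - w 0" if "k \<le> 2 ^ n" for n k
    using that
  proof (induction k)
    case (Suc k)
    have "integral {0..real k * h n} v + integral {real k * h n..real (Suc k) * h n} v = integral {0..real (Suc k) * h n} v"
      by (rule Henstock_Kurzweil_Integration.integral_combine) (use h_pos[of n] vint in auto)
    moreover have "integral {real k * h n..real (Suc k) * h n} v = (LINT t:cell n k|lborel. v t)"
    proof -
      have "(LINT t:cell n k|lborel. v t) = integral (cell n k) v"
        by (rule set_borel_integral_eq_integral(2)) (auto simp: set_integrable_def intro!: integrable_mult_indicator vi)
      also have "\<dots> = integral {real k * h n..real (Suc k) * h n} v"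
        by (rule integral_subset_negligible) (auto simp: cell_def intro: negligible_subset[of "{real (Suc k) * h n}"])
      finally show ?thesis by simp
    qed
    ultimately show ?case using Suc cellv[of k n] by simp
  qed simp
  have prim: "w t = w 0 + integral {0..t} v" if t: "t \<in> {0..L}" for t
  proof -
    \<comment> \<open>The node of level \<open>n\<close> just below \<open>t\<close>; at t = L it is
      \<open>L\<close> itself.\<close>
    define s where "s n = real (nat \<lfloor>t / h n\<rfloor>) * h n" for n
    have k: "nat \<lfloor>t / h n\<rfloor> \<le> 2 ^ n" and st: "s n \<le> t" "t - s n \<le> h n" "0 \<le> s n" for n
    proof -
      have "t / h n \<le> 2 ^ n" using t h_pos[of n] h_total[of n] by (simp add: pos_divide_le_eq)
      then have "\<lfloor>t / h n\<rfloor> \<le> 2 ^ n" by (simp add: floor_le_iff)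
      then show "nat \<lfloor>t / h n\<rfloor> \<le> 2 ^ n" by (simp add: nat_le_iff)
      have f: "real (nat \<lfloor>t / h n\<rfloor>) = of_int \<lfloor>t / h n\<rfloor>" using t h_pos[of n] by simp
      have "of_int \<lfloor>t / h n\<rfloor> * h n \<le> t / h n * h n" "t / h n * h n \<le> (of_int \<lfloor>t / h n\<rfloor> + 1) * h n"
        using h_pos[of n] by (intro mult_right_mono; linarith)+
      then show "s n \<le> t" "t - s n \<le> h n" using h_pos[of n] unfolding s_def f
        by (simp_all add: algebra_simps)
      show "0 \<le> s n" using h_pos[of n] by (simp add: s_def)
    qed
    have "h \<longlonglongrightarrow> 0"
      unfolding h_def using LIMSEQ_divide_realpow_zero[of 2 L] by simp
    then have "(\<lambda>n. t - s n) \<longlonglongrightarrow> 0"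
      by (rule tendsto_sandwich[rotated 3]) (use st in auto)
    then have sl: "s \<longlonglongrightarrow> t"
      using tendsto_diff[of "\<lambda>_. t" t sequentially "\<lambda>n. t - s n" 0] by simp
    have s_in: "s n \<in> {0..L}" for n using st[of n] t by auto
    have "(\<lambda>n. w (s n)) \<longlonglongrightarrow> w t"
      using cont s_in t sl unfolding continuous_on_sequentially comp_def by blast
    moreover have "(\<lambda>n. integral {0..s n} v) \<longlonglongrightarrow> integral {0..t} v"
      using indefinite_integral_continuous_1[OF vint, of 0 L] s_in t sl unfolding continuous_on_sequentially comp_def by blast
    moreover have "integral {0..s n} v = w (s n) - w 0" for n
      unfolding s_def by (rule node[OF k])
    ultimately have l: "(\<lambda>n. w (s n)) \<longlonglongrightarrow> w t" "(\<lambda>n. w (s n) - w 0) \<longlonglongrightarrow> integral {0..t} v" by auto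
    have "integral {0..t} v = w t - w 0"
      by (rule LIMSEQ_unique[OF l(2) tendsto_diff[OF l(1) tendsto_const]])
    then show ?thesis by simp
  qed
  have "(\<integral>\<^sup>+t. ennreal (norm (v t) powr p) \<partial>lborel) =
      (\<integral>\<^sup>+t. liminf (\<lambda>i. ennreal (norm (step (r i) t) powr p)) \<partial>lborel)"
  proof (rule nn_integral_cong_AE)
    show "AE t in lborel. ennreal (norm (v t) powr p) = liminf (\<lambda>i. ennreal (norm (step (r i) t) powr p))"
      using lim
    proof eventually_elim
      case (elim t)
      have "(\<lambda>i. ennreal (norm (step (r i) t) powr p)) \<longlonglongrightarrow> ennreal (norm (v t) powr p)"
        using p by (intro tendsto_ennrealI tendsto_powr' tendsto_norm elim tendsto_const) auto
      then show ?case by (rule lim_imp_Liminf[OF sequentially_bot, symmetric])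
    qed
  qed
  also have "\<dots> \<le> liminf (\<lambda>i. \<integral>\<^sup>+t. ennreal (norm (step (r i) t) powr p) \<partial>lborel)"
    by (rule nn_integral_liminf) auto
  also have "\<dots> \<le> ennreal M"
  proof (rule Liminf_le)
    have "(\<integral>\<^sup>+t. ennreal (norm (step n t) powr p) \<partial>lborel) \<le> ennreal M" for n
    proof -
      have "(\<integral>\<^sup>+t. ennreal (norm (step n t) powr p) \<partial>lborel) = (\<integral>\<^sup>+t. ennreal (indicator {0..<L} t *\<^sub>R (norm (step n t) powr p)) \<partial>lborel)"
        by (intro nn_integral_cong) (auto simp: step_eq)
      also have "\<dots> = ennreal (LINT t|lborel. indicator {0..<L} t *\<^sub>R (norm (step n t) powr p))"
        by (intro nn_integral_eq_integral integrable_step_fun) auto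
      also have "\<dots> \<le> ennreal M" by (intro ennreal_leI integral_step_powr)
      finally show ?thesis .
    qed
    then show "\<forall>\<^sub>F i in sequentially. (\<integral>\<^sup>+t. ennreal (norm (step (r i) t) powr p) \<partial>lborel) \<le> ennreal M" by simp
  qed simp
  finally show ?thesis using that vi prim by blast
qed

end

section \<open>Curves parametrized by arc length\<close>

definition polygon_length :: "(real \<Rightarrow> 'a::metric_space) \<Rightarrow> real list \<Rightarrow> real" where
  "polygon_length c ts = (\<Sum>i<length ts - 1. dist (c (ts ! i)) (c (ts ! Suc i)))"

definition mesh :: "real list \<Rightarrow> real" where
  "mesh ts = Max ((\<lambda>i. ts ! Suc i - ts ! i) ` {..<length ts - 1})"

text \<open>The restriction on \<open>i\<close> assigns the right endpoint of the interval to the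
  last cell, so that every parameter has a segment.\<close>

definition cell_index :: "real list \<Rightarrow> real \<Rightarrow> nat" where
  "cell_index ts u = Max {i. i < length ts - 1 \<and> ts ! i \<le> u}"

lemma partition_pointsD:
  assumes "partition_points a b ts"
  shows "length ts \<ge> 2" "ts ! 0 = a" "ts ! (length ts - 1) = b"
    "\<And>i j. i < j \<Longrightarrow> j < length ts \<Longrightarrow> ts ! i < ts ! j"
    "\<And>i j. i \<le> j \<Longrightarrow> j < length ts \<Longrightarrow> ts ! i \<le> ts ! j"
    "\<And>i. i < length ts \<Longrightarrow> ts ! i \<in> {a..b}" "a < b"
proof -
  show l: "length ts \<ge> 2" using assms by (simp add: partition_points_def)
  then have ne: "ts \<noteq> []" by auto
  show z: "ts ! 0 = a" "ts ! (length ts - 1) = b"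
    using assms ne by (auto simp: partition_points_def hd_conv_nth last_conv_nth)
  show lt: "ts ! i < ts ! j" if "i < j" "j < length ts" for i j
    using assms that by (auto simp: partition_points_def sorted_wrt_iff_nth_less)
  show le: "ts ! i \<le> ts ! j" if "i \<le> j" "j < length ts" for i j
    using lt[of i j] that by (cases "i = j") auto
  show "ts ! i \<in> {a..b}" if "i < length ts" for i
    using le[of 0 i] le[of i "length ts - 1"] that l z by auto
  show "a < b" using lt[of 0 "length ts - 1"] l z by auto
qed

lemma mesh_ge: "i < length ts - 1 \<Longrightarrow> ts ! Suc i - ts ! i \<le> mesh ts"
  unfolding mesh_def by (intro Max_ge) auto

lemma mesh_le:
  assumes "length ts \<ge> 2" "\<And>i. i < length ts - 1 \<Longrightarrow> ts ! Suc i - ts ! i \<le> d"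
  shows "mesh ts \<le> d"
  unfolding mesh_def using assms by (subst Max_le_iff) (auto simp: lessThan_empty_iff)

lemma mesh_pos: "partition_points a b ts \<Longrightarrow> mesh ts > 0"
  using mesh_ge[of 0 ts] partition_pointsD(4)[of a b ts 0 1] partition_pointsD(1)[of a b ts] by force

lemma cell_index:
  assumes "partition_points a b ts" "u \<in> {a..b}"
  shows "cell_index ts u < length ts - 1" "ts ! cell_index ts u \<le> u" "u \<le> ts ! Suc (cell_index ts u)"
    "u < b \<Longrightarrow> u < ts ! Suc (cell_index ts u)"
proof -
  let ?S = "{i. i < length ts - 1 \<and> ts ! i \<le> u}"
  note P = partition_pointsD[OF assms(1)]
  have "0 \<in> ?S" using P assms by auto
  moreover have "finite ?S" by simp
  ultimately have "cell_index ts u \<in> ?S"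
    using Max_in[of ?S] unfolding cell_index_def by blast
  then show k: "cell_index ts u < length ts - 1" "ts ! cell_index ts u \<le> u" by auto
  have next_gt: "u < ts ! Suc (cell_index ts u)" if "Suc (cell_index ts u) < length ts - 1"
  proof (rule ccontr)
    assume "\<not> ?thesis"
    then have "Suc (cell_index ts u) \<in> ?S" using that by auto
    then have "Suc (cell_index ts u) \<le> cell_index ts u"
      unfolding cell_index_def by (intro Max_ge) auto
    then show False by simp
  qed
  show lt: "u < ts ! Suc (cell_index ts u)" if "u < b"
  proof (cases "Suc (cell_index ts u) < length ts - 1")
    case False
    then have "Suc (cell_index ts u) = length ts - 1" using k by simp
    then show ?thesis using P that by simp
  qed (rule next_gt)
  show "u \<le> ts ! Suc (cell_index ts u)"
  proof (cases "Suc (cell_index ts u) < length ts - 1")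
    case False
    then have "Suc (cell_index ts u) = length ts - 1" using k by simp
    then show ?thesis using P assms by simp
  qed (use next_gt in auto)
qed

lemma cell_index_mono:
  assumes "partition_points a b ts" "u \<in> {a..b}" "u \<le> u'"
  shows "cell_index ts u \<le> cell_index ts u'"
proof -
  have "0 \<in> {i. i < length ts - 1 \<and> ts ! i \<le> u}"
    using partition_pointsD[OF assms(1)] assms by auto
  then have "{i. i < length ts - 1 \<and> ts ! i \<le> u} \<noteq> {}" by blast
  then show ?thesis
    unfolding cell_index_def by (rule Max_mono[rotated]) (use assms(3) in auto)
qed

lemma polygon_length_sum_ge:
  assumes "j < length ts" "i \<le> j"
  shows "dist (c (ts ! i)) (c (ts ! j)) \<le> (\<Sum>k=i..<j. dist (c (ts ! k)) (c (ts ! Suc k)))"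
  using assms(2,1)
proof (induction j rule: dec_induct)
  case (step j)
  then have "dist (c (ts ! i)) (c (ts ! Suc j)) \<le>
    (\<Sum>k=i..<j. dist (c (ts ! k)) (c (ts ! Suc k))) + dist (c (ts ! j)) (c (ts ! Suc j))"
    using dist_triangle[of "c (ts ! i)" "c (ts ! Suc j)" "c (ts ! j)"] by auto
  then show ?case using step by simp
qed simp

section \<open>Lengths of inscribed polygonals and parameter meshes\<close>

locale arc_length_curve =
  fixes c :: "real \<Rightarrow> 'a::metric_space" and L :: real
  assumes arc: "arc_length_parametrized c L" and L_pos: "L > 0"
begin

lemma curve_length_eq: "s \<in> {0..L} \<Longrightarrow> curve_length c 0 s = ennreal s"
  using arc by (simp add: arc_length_parametrized_def)

lemma ennreal_polygon_length:
  "(\<Sum>i<length ts - 1. ennreal (dist (c (ts ! i)) (c (ts ! Suc i)))) = ennreal (polygon_length c ts)"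
  unfolding polygon_length_def by (rule sum_ennreal) simp

lemma polygon_length_le:
  assumes "partition_points 0 s ts" "s \<le> L"
  shows "polygon_length c ts \<le> s"
proof -
  have "0 < s" using partition_pointsD(7)[OF assms(1)] .
  have "ennreal (polygon_length c ts) \<le> curve_length c 0 s"
    unfolding curve_length_def ennreal_polygon_length using assms(1) by (intro Sup_upper) auto
  then show ?thesis using \<open>0 < s\<close> assms(2) by (simp add: curve_length_eq)
qed

lemma polygon_length_approx:
  assumes "0 < s" "s \<le> L" "e > 0"
  obtains ts where "partition_points 0 s ts" "s - e < polygon_length c ts"
proof -
  \<comment> \<open>The maximum keeps the real number nonnegative, so that the comparison can be
    carried back from \<open>ennreal\<close>.\<close>
  have "ennreal (max 0 (s - e)) < curve_length c 0 s"
    using assms by (subst curve_length_eq) (auto intro!: ennreal_lessI)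
  then obtain ts where ts: "partition_points 0 s ts" "ennreal (max 0 (s - e)) < ennreal (polygon_length c ts)"
    unfolding curve_length_def ennreal_polygon_length less_Sup_iff by auto
  then have "max 0 (s - e) < polygon_length c ts"
    by (subst (asm) ennreal_less_iff) auto
  then show ?thesis using that ts(1) by auto
qed

text \<open>Append \<open>t\<close> to a partition of [0, s] whose polygonal has length above s - e:
  the longer polygonal has length at most \<open>t\<close>, so its last segment is at most t - s +
  e. The case s = 0 is separate, as [0, 0] has no partition.\<close>

lemma dist_le:
  assumes "0 \<le> s" "s \<le> t" "t \<le> L"
  shows "dist (c s) (c t) \<le> t - s"
proof -
  consider "s = t" | "s = 0" "s < t" | "0 < s" "s < t" using assms by linarith
  then show ?thesis
  proof cases
    case 2
    then have "partition_points 0 t [0, t]" by (simp add: partition_points_def)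
    from polygon_length_le[OF this] assms 2 show ?thesis by (simp add: polygon_length_def)
  next
    case 3
    have "dist (c s) (c t) \<le> (t - s) + e" if e: "e > 0" for e
    proof -
      obtain ts where ts: "partition_points 0 s ts" "s - e < polygon_length c ts"
        using polygon_length_approx[of s e] 3 assms e by auto
      note P = partition_pointsD[OF ts(1)]
      have ne: "ts \<noteq> []" using P(1) by auto
      have "partition_points 0 t (ts @ [t])"
        using ts(1) P(6) 3 ne by (fastforce simp: partition_points_def sorted_wrt_append in_set_conv_nth)
      then have "polygon_length c (ts @ [t]) \<le> t" using polygon_length_le assms by blast
      moreover have "polygon_length c (ts @ [t]) = polygon_length c ts + dist (c s) (c t)"
      proof -
        obtain n where n: "length ts = Suc n" using ne by (cases ts) auto
        have "polygon_length c (ts @ [t]) = (\<Sum>i<n. dist (c ((ts @ [t]) ! i)) (c ((ts @ [t]) ! Suc i)))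
            + dist (c ((ts @ [t]) ! n)) (c ((ts @ [t]) ! Suc n))"
          by (simp add: polygon_length_def n)
        also have "(\<Sum>i<n. dist (c ((ts @ [t]) ! i)) (c ((ts @ [t]) ! Suc i))) = polygon_length c ts"
          by (simp add: polygon_length_def n nth_append)
        also have "(ts @ [t]) ! n = s" using P(3) by (auto simp: n nth_append)
        also have "(ts @ [t]) ! Suc n = t" by (auto simp: n nth_append)
        finally show ?thesis .
      qed
      ultimately show ?thesis using ts(2) by simp
    qed
    then show ?thesis by (rule field_le_epsilon)
  qed simp
qed

lemma dist_le_abs: "s \<in> {0..L} \<Longrightarrow> t \<in> {0..L} \<Longrightarrow> dist (c s) (c t) \<le> \<bar>t - s\<bar>"
  using dist_le[of s t] dist_le[of t s] by (cases "s \<le> t") (auto simp: dist_commute)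

lemma continuous_curve: "continuous_on {0..L} c"
proof -
  have "1-lipschitz_on {0..L} c"
    by (rule lipschitz_onI) (use dist_le_abs in \<open>auto simp: dist_real_def abs_minus_commute\<close>)
  then show ?thesis by (rule lipschitz_on_continuous_on)
qed

text \<open>Moving each vertex of a fixed polygonal to the preceding vertex of a fine one changes its
  length by at most twice the mesh per segment.\<close>

lemma polygon_length_le_fine:
  assumes "partition_points 0 L us" "partition_points 0 L ts"
  shows "polygon_length c us \<le> polygon_length c ts + 2 * real (length us - 1) * mesh ts"
proof -
  note U = partition_pointsD[OF assms(1)] and T = partition_pointsD[OF assms(2)]
  note I = cell_index[OF assms(2)]
  define k where "k j = cell_index ts (us ! j)" for j
  define S where "S n = (\<Sum>i<n. dist (c (ts ! i)) (c (ts ! Suc i)))" for n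
  have near: "dist (c (us ! j)) (c (ts ! k j)) \<le> mesh ts" if "j < length us" for j
  proof -
    have u: "us ! j \<in> {0..L}" using U(6) that by simp
    have "dist (c (ts ! k j)) (c (us ! j)) \<le> us ! j - ts ! k j"
      unfolding k_def using I[OF u] T(6)[of "cell_index ts (us ! j)"] u by (intro dist_le) auto
    also have "\<dots> \<le> mesh ts"
      using I(1,3)[OF u] mesh_ge[of "k j" ts] by (simp add: k_def)
    finally show ?thesis by (simp add: dist_commute)
  qed
  have seg: "dist (c (us ! j)) (c (us ! Suc j)) \<le> (S (k (Suc j)) - S (k j)) + 2 * mesh ts"
    if j: "j < length us - 1" for j
  proof -
    have kk: "k j \<le> k (Suc j)"
      unfolding k_def using U(5)[of j "Suc j"] U(6)[of j] j by (intro cell_index_mono[OF assms(2)]) auto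
    have kl: "k (Suc j) < length ts"
      using I(1)[OF U(6)[of "Suc j"]] less_diff_conv[THEN iffD1, OF j] by (auto simp: k_def)
    have "dist (c (ts ! k j)) (c (ts ! k (Suc j))) \<le> (\<Sum>i=k j..<k (Suc j). dist (c (ts ! i)) (c (ts ! Suc i)))"
      by (rule polygon_length_sum_ge[OF kl kk])
    also have "\<dots> = S (k (Suc j)) - S (k j)"
      unfolding S_def using kk by (simp add: sum_diff_nat_ivl lessThan_atLeast0)
    finally have "dist (c (ts ! k j)) (c (ts ! k (Suc j))) \<le> S (k (Suc j)) - S (k j)" .
    moreover have "dist (c (us ! j)) (c (us ! Suc j)) \<le>
      dist (c (us ! j)) (c (ts ! k j)) + dist (c (ts ! k j)) (c (ts ! k (Suc j))) + dist (c (us ! Suc j)) (c (ts ! k (Suc j)))"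
      using dist_triangle[of "c (us ! j)" "c (us ! Suc j)" "c (ts ! k j)"]
        dist_triangle2[of "c (ts ! k j)" "c (us ! Suc j)" "c (ts ! k (Suc j))"] by (simp add: dist_commute)
    moreover have "j < length us" "Suc j < length us" using j by linarith+
    ultimately show ?thesis using near[of j] near[of "Suc j"] by linarith
  qed
  have Smono: "S a \<le> S b" if "a \<le> b" for a b
    unfolding S_def using that by (intro sum_mono2) auto
  have "polygon_length c us \<le> (\<Sum>j<length us - 1. (S (k (Suc j)) - S (k j)) + 2 * mesh ts)"
    unfolding polygon_length_def by (intro sum_mono seg) auto
  also have "\<dots> = S (k (length us - 1)) - S (k 0) + 2 * real (length us - 1) * mesh ts"
    by (simp add: sum.distrib sum_lessThan_telescope[of "\<lambda>j. S (k j)"])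
  also have "S (k (length us - 1)) \<le> S (length ts - 1)"
  proof (rule Smono)
    show "k (length us - 1) \<le> length ts - 1"
      using I(1)[of "us ! (length us - 1)"] U(6)[of "length us - 1"] U(1) by (simp add: k_def)
  qed
  also have "S (length ts - 1) = polygon_length c ts" by (simp add: S_def polygon_length_def)
  finally show ?thesis using Smono[of 0 "k 0"] by (simp add: S_def)
qed

text \<open>A polygonal loses almost the full parameter length of an arc of small diameter.\<close>

lemma small_arc_short:
  assumes us: "partition_points 0 L us" "L - \<delta> / 2 \<le> polygon_length c us"
    and s: "0 \<le> s" "s + \<delta> \<le> L" "\<delta> > 0"
    and \<rho>: "\<And>x y. x \<in> {s..s + \<delta>} \<Longrightarrow> y \<in> {s..s + \<delta>} \<Longrightarrow> dist (c x) (c y) \<le> \<rho>"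
  shows "\<delta> / 2 \<le> real (length us - 1) * \<rho>"
proof -
  note U = partition_pointsD[OF us(1)]
  \<comment> \<open>\<open>g\<close> clamps a parameter to the arc. A segment costs at most its
    parameter length outside the arc, plus \<rho> if it meets the arc; the outside lengths telescope
    to L - \<delta>.\<close>
  define g where "g u = max s (min (s + \<delta>) u)" for u
  have gmem: "g u \<in> {s..s + \<delta>}" for u using s by (auto simp: g_def)
  have "\<rho> \<ge> 0" using \<rho>[of s s] s by simp
  have seg: "dist (c u) (c u') \<le> (u' - u) - (g u' - g u) + \<rho>" if u: "0 \<le> u" "u \<le> u'" "u' \<le> L" for u u'
  proof (cases "g u = g u'")
    case True
    then show ?thesis using dist_le[OF u] \<open>\<rho> \<ge> 0\<close> by simp
  next
    case False
    then have o: "u \<le> g u" "g u' \<le> u'" "0 \<le> g u'" "g u \<le> L" using u s by (auto simp: g_def max_def min_def split: if_splits)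
    have "dist (c u) (c u') \<le> dist (c u) (c (g u)) + dist (c (g u)) (c (g u')) + dist (c (g u')) (c u')"
      using dist_triangle[of "c u" "c u'" "c (g u)"] dist_triangle[of "c (g u)" "c u'" "c (g u')"] by simp
    also have "\<dots> \<le> (g u - u) + \<rho> + (u' - g u')"
      using u o by (intro add_mono dist_le \<rho> gmem) auto
    finally show ?thesis by simp
  qed
  define d where "d u = u - g u" for u
  have seg': "dist (c u) (c u') \<le> (d u' - d u) + \<rho>" if "0 \<le> u" "u \<le> u'" "u' \<le> L" for u u'
    using seg[OF that] by (simp add: d_def)
  have "polygon_length c us \<le> (\<Sum>j<length us - 1. (d (us ! Suc j) - d (us ! j)) + \<rho>)"
    unfolding polygon_length_def
  proof (intro sum_mono seg')
    fix j assume "j \<in> {..<length us - 1}"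
    then show "0 \<le> us ! j" "us ! j \<le> us ! Suc j" "us ! Suc j \<le> L"
      using U(6)[of j] U(6)[of "Suc j"] U(5)[of j "Suc j"] by auto
  qed
  also have "\<dots> = d (us ! (length us - 1)) - d (us ! 0) + real (length us - 1) * \<rho>"
    by (simp add: sum.distrib sum_lessThan_telescope[of "\<lambda>j. d (us ! j)"])
  also have "\<dots> = L - \<delta> + real (length us - 1) * \<rho>"
    using s unfolding U(2,3) by (simp add: d_def g_def)
  finally show ?thesis using us(2) by simp
qed

lemma dist_le_modulus:
  assumes "partition_points 0 L ts" "i < length ts - 1" "x \<in> {ts ! i..ts ! Suc i}" "y \<in> {ts ! i..ts ! Suc i}"
  shows "dist (c x) (c y) \<le> polygonal_modulus c ts"
proof -
  note T = partition_pointsD[OF assms(1)]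
  have sub: "{ts ! i..ts ! Suc i} \<subseteq> {0..L}" using T(6)[of i] T(6)[of "Suc i"] assms(2) by auto
  have "bounded (c ` {ts ! i..ts ! Suc i})"
    by (intro compact_imp_bounded compact_continuous_image continuous_on_subset[OF continuous_curve sub]) auto
  then have "dist (c x) (c y) \<le> diameter (c ` {ts ! i..ts ! Suc i})"
    by (rule diameter_bounded_bound) (use assms in auto)
  also have "\<dots> \<le> polygonal_modulus c ts"
    unfolding polygonal_modulus_def using assms(2) by (intro Max_ge) auto
  finally show ?thesis .
qed

lemma modulus_le_mesh:
  assumes "partition_points 0 L ts"
  shows "0 \<le> polygonal_modulus c ts" "polygonal_modulus c ts \<le> mesh ts"
proof -
  note T = partition_pointsD[OF assms]
  show "0 \<le> polygonal_modulus c ts"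
    using dist_le_modulus[OF assms, of 0 0 0] T(4)[of 0 1] T(1,2) by simp
  have ne: "{..<length ts - 1} \<noteq> {}" using T(1) by (simp add: lessThan_empty_iff)
  have "diameter (c ` {ts ! i..ts ! Suc i}) \<le> mesh ts" if i: "i < length ts - 1" for i
  proof -
    have Ti: "ts ! i \<in> {0..L}" "ts ! Suc i \<in> {0..L}" "ts ! i \<le> ts ! Suc i"
      using T(6)[of i] T(6)[of "Suc i"] T(5)[of i "Suc i"] i by auto
    have "dist (c a) (c b) \<le> mesh ts" if "a \<in> {ts ! i..ts ! Suc i}" "b \<in> {ts ! i..ts ! Suc i}" for a b
    proof -
      have "dist (c a) (c b) \<le> \<bar>b - a\<bar>" using Ti that by (auto intro!: dist_le_abs)
      also have "\<dots> \<le> ts ! Suc i - ts ! i" using that by auto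
      also have "\<dots> \<le> mesh ts" using mesh_ge i by blast
      finally show ?thesis .
    qed
    then show ?thesis
      unfolding diameter_def using Ti by (auto intro!: cSUP_least)
  qed
  then show "polygonal_modulus c ts \<le> mesh ts"
    unfolding polygonal_modulus_def using ne by (subst Max_le_iff) auto
qed

text \<open>A small diameter alone does not exclude a long curled-up arc. But a fixed polygonal with
  n segments and length above L - \<delta>/2 forces every arc of parameter length \<delta> to have
  diameter at least \<delta>/(2n), by \<open>small_arc_short\<close>; a smaller modulus therefore
  bounds all steps by \<delta>.\<close>

lemma mesh_tendsto_0:
  assumes ts: "\<And>h. partition_points 0 L (ts h)" and mod: "(\<lambda>h. polygonal_modulus c (ts h)) \<longlonglongrightarrow> 0"
  shows "(\<lambda>h. mesh (ts h)) \<longlonglongrightarrow> 0"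
proof (rule tendstoI)
  fix \<delta>' :: real assume "\<delta>' > 0"
  define \<delta> where "\<delta> = \<delta>' / 2"
  have \<delta>: "\<delta> > 0" "\<delta> < \<delta>'" using \<open>\<delta>' > 0\<close> by (auto simp: \<delta>_def)
  obtain us where us: "partition_points 0 L us" "L - \<delta> / 2 < polygon_length c us"
    using polygon_length_approx[of L "\<delta> / 2"] \<delta> L_pos by auto
  define n where "n = real (length us - 1)"
  have n: "n > 0" using partition_pointsD(1)[OF us(1)] by (simp add: n_def)
  have "eventually (\<lambda>h. polygonal_modulus c (ts h) < \<delta> / (2 * n)) sequentially"
    using mod by (rule order_tendstoD(2)) (use \<delta> n in auto)
  then show "eventually (\<lambda>h. dist (mesh (ts h)) 0 < \<delta>') sequentially"
  proof eventually_elim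
    case (elim h)
    note T = partition_pointsD[OF ts[of h]]
    have "mesh (ts h) \<le> \<delta>"
    proof (rule mesh_le[OF T(1)], rule ccontr)
      fix i assume i: "i < length (ts h) - 1" and "\<not> ts h ! Suc i - ts h ! i \<le> \<delta>"
      then have *: "ts h ! i + \<delta> < ts h ! Suc i" by simp
      have "\<delta> / 2 \<le> n * polygonal_modulus c (ts h)"
        unfolding n_def
      proof (rule small_arc_short[OF us(1) less_imp_le[OF us(2)]])
        show "0 \<le> ts h ! i" "ts h ! i + \<delta> \<le> L" using T(6)[of i] T(6)[of "Suc i"] less_diff_conv[THEN iffD1, OF i] * by auto
        show "dist (c x) (c y) \<le> polygonal_modulus c (ts h)"
          if "x \<in> {ts h ! i..ts h ! i + \<delta>}" "y \<in> {ts h ! i..ts h ! i + \<delta>}" for x y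
          using that * by (intro dist_le_modulus[OF ts i]) auto
      qed (rule \<delta>)
      also have "\<dots> < n * (\<delta> / (2 * n))" by (rule mult_strict_left_mono[OF elim n])
      finally show False using n by simp
    qed
    then show ?case using mesh_pos[OF ts[of h]] \<delta> by simp
  qed
qed

text \<open>A fixed polygonal within e/2 of the full length is compared with the fine ones; the
  threshold e/(4n) keeps the loss of twice the mesh per segment below the other e/2.\<close>

lemma polygon_length_tendsto:
  assumes ts: "\<And>h. partition_points 0 L (ts h)" and mesh: "(\<lambda>h. mesh (ts h)) \<longlonglongrightarrow> 0"
  shows "(\<lambda>h. polygon_length c (ts h)) \<longlonglongrightarrow> L"
proof (rule tendstoI)
  fix e :: real assume e: "e > 0"
  obtain us where us: "partition_points 0 L us" "L - e / 2 < polygon_length c us"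
    using polygon_length_approx[of L "e / 2"] e L_pos by auto
  define n where "n = real (length us - 1)"
  have n: "n > 0" using partition_pointsD(1)[OF us(1)] by (simp add: n_def)
  have "eventually (\<lambda>h. mesh (ts h) < e / (4 * n)) sequentially"
    using mesh by (rule order_tendstoD(2)) (use e n in auto)
  then show "eventually (\<lambda>h. dist (polygon_length c (ts h)) L < e) sequentially"
  proof eventually_elim
    case (elim h)
    have "mesh (ts h) * (4 * n) < e" using elim n by (simp add: pos_less_divide_eq)
    then have "2 * n * mesh (ts h) < e / 2" by (simp add: algebra_simps)
    then have "polygon_length c (ts h) > L - e"
      using polygon_length_le_fine[OF us(1) ts[of h]] us(2) by (simp add: n_def)
    then show ?case using polygon_length_le[OF ts[of h]] by (simp add: dist_real_def)
  qed
qed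

end

section \<open>Turning angles\<close>

text \<open>The half-angle formula: the squared distance of unit vectors at angle \<theta> is 2 - 2
  cos \<theta> = 4 sin^2(\<theta>/2).\<close>

lemma unit_chord_eq_sin:
  fixes a b :: "'a::real_inner"
  assumes "a \<noteq> 0" "b \<noteq> 0"
  defines "\<theta> \<equiv> arccos ((a \<bullet> b) / (norm a * norm b))"
  shows "\<theta> \<in> {0..pi}" "norm (b /\<^sub>R norm b - a /\<^sub>R norm a) = 2 * sin (\<theta> / 2)"
proof -
  define q where "q = (a \<bullet> b) / (norm a * norm b)"
  have n: "norm a * norm b > 0" using assms by simp
  have "\<bar>a \<bullet> b\<bar> \<le> norm a * norm b" by (rule Cauchy_Schwarz_ineq2)
  then have q: "-1 \<le> q" "q \<le> 1" using n by (auto simp: q_def field_simps abs_le_iff)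
  then show \<theta>: "\<theta> \<in> {0..pi}"
    using arccos_bounded[of q] by (auto simp: \<theta>_def q_def)
  have c: "cos \<theta> = q" using cos_arccos[OF q] by (simp add: \<theta>_def q_def)
  have "(norm (b /\<^sub>R norm b - a /\<^sub>R norm a))\<^sup>2 = 2 - 2 * q"
  proof -
    have "(b /\<^sub>R norm b) \<bullet> (b /\<^sub>R norm b) = 1" "(a /\<^sub>R norm a) \<bullet> (a /\<^sub>R norm a) = 1"
      using assms by (auto simp: power2_norm_eq_inner[symmetric] power2_eq_square)
    moreover have "(b /\<^sub>R norm b) \<bullet> (a /\<^sub>R norm a) = q" by (simp add: q_def inner_commute field_simps)
    ultimately show ?thesis
      by (simp only: power2_norm_eq_inner inner_diff_left inner_diff_right inner_commute[of "a /\<^sub>R norm a" "b /\<^sub>R norm b"])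
  qed
  also have "\<dots> = (2 * sin (\<theta> / 2))\<^sup>2"
    using cos_double_sin[of "\<theta> / 2"] c by (simp add: power_mult_distrib)
  finally have eq: "(norm (b /\<^sub>R norm b - a /\<^sub>R norm a))\<^sup>2 = (2 * sin (\<theta> / 2))\<^sup>2" .
  have "sin (\<theta> / 2) \<ge> 0" using \<theta> by (intro sin_ge_zero) auto
  then show "norm (b /\<^sub>R norm b - a /\<^sub>R norm a) = 2 * sin (\<theta> / 2)"
    using power2_eq_imp_eq[OF eq] by simp
qed

text \<open>For unit vectors x, y in the directions of a, b one has |b - a|^2 = (|b| - |a|)^2 + |a|
  |b| |y - x|^2. So the radial projection is Lipschitz with constant 1/m away from the ball of
  radius m.\<close>

lemma norm_unit_diff_le:
  fixes a b :: "'a::real_inner"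
  assumes "norm a \<ge> m" "norm b \<ge> m" "m > 0"
  shows "norm (b /\<^sub>R norm b - a /\<^sub>R norm a) \<le> norm (b - a) / m"
proof -
  define x y where "x = a /\<^sub>R norm a" and "y = b /\<^sub>R norm b"
  have n: "norm a > 0" "norm b > 0" using assms by auto
  have xy: "norm x = 1" "norm y = 1" using n by (auto simp: x_def y_def)
  then have xx: "x \<bullet> x = 1" "y \<bullet> y = 1" by (auto simp: norm_eq_1)
  have ab: "a = norm a *\<^sub>R x" "b = norm b *\<^sub>R y" using n by (auto simp: x_def y_def)
  have "(norm (b - a))\<^sup>2 = (norm b - norm a)\<^sup>2 + norm a * norm b * (2 - 2 * (x \<bullet> y))"
  proof -
    have "(norm (B *\<^sub>R y - A *\<^sub>R x))\<^sup>2 = (B - A)\<^sup>2 + A * B * (2 - 2 * (x \<bullet> y))" for A B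
      by (simp add: power2_norm_eq_inner inner_diff_left inner_diff_right xx inner_commute[of y x])
         (simp add: power2_eq_square algebra_simps)
    then show ?thesis using ab by metis
  qed
  also have "2 - 2 * (x \<bullet> y) = (norm (y - x))\<^sup>2"
    by (simp add: power2_norm_eq_inner inner_diff_left inner_diff_right xx inner_commute[of y x])
  finally have "(norm (b - a))\<^sup>2 \<ge> norm a * norm b * (norm (y - x))\<^sup>2" by simp
  moreover have "m * m * (norm (y - x))\<^sup>2 \<le> norm a * norm b * (norm (y - x))\<^sup>2"
    using assms by (intro mult_right_mono mult_mono) auto
  ultimately have "(m * norm (y - x))\<^sup>2 \<le> (norm (b - a))\<^sup>2"
    by (simp add: power_mult_distrib power2_eq_square[of m])
  then have "m * norm (y - x) \<le> norm (b - a)"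
    by (rule power2_le_imp_le) simp
  then show ?thesis using assms by (simp add: x_def y_def field_simps)
qed

text \<open>In terms of the half angle \<open>x\<close>, the weight is \<open>2 x\<^sup>1\<^sup>-\<^sup>\<alpha> (tan x)\<^sup>p\<^sup>-\<^sup>1\<^sup>+\<^sup>\<alpha>\<close>, to be compared with
  \<open>2 (sin x)\<^sup>p\<close>.\<close>

lemma angle_weight_half_angle:
  assumes "0 < x" "x < pi / 2"
  shows "angle_weight p \<alpha> (2 * x) = ennreal (2 * (x powr (1 - \<alpha>) * tan x powr (p - 1 + \<alpha>)))"
proof -
  have "2 powr \<alpha> * (2 * x) powr (1 - \<alpha>) = 2 * x powr (1 - \<alpha>)"
    using assms by (simp add: powr_mult powr_diff)
  then show ?thesis using assms by (simp add: angle_weight_def mult.assoc[symmetric])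
qed

lemma sin_powr_chord: "0 \<le> x \<Longrightarrow> x \<le> pi / 2 \<Longrightarrow> 2 powr (1 - p) * (2 * sin x) powr p = 2 * sin x powr p"
  by (simp add: powr_mult powr_diff sin_ge_zero)

text \<open>In the half angle x: sin^p = sin * sin^(p-1) is at most x * tan^(p-1), and x =
  x^(1-\<alpha>) x^\<alpha> is at most x^(1-\<alpha>) tan^\<alpha>. Only the nonnegative exponents p
  - 1 and \<alpha> are compared; 1 - \<alpha> may have either sign and stays untouched.\<close>

lemma angle_weight_ge:
  assumes "p > 1" "\<alpha> \<ge> 0" "\<theta> \<in> {0..pi}"
  shows "ennreal (2 powr (1 - p) * (2 * sin (\<theta> / 2)) powr p) \<le> angle_weight p \<alpha> \<theta>"
proof -
  consider "\<theta> = 0" | "\<theta> = pi" | "0 < \<theta>" "\<theta> < pi" using assms by force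
  then show ?thesis
  proof cases
    case 1
    then show ?thesis using assms by simp
  next
    case 2
    then show ?thesis by (simp add: angle_weight_def)
  next
    case 3
    define x where "x = \<theta> / 2"
    have x: "0 < x" "x < pi / 2" "\<theta> = 2 * x" using 3 by (auto simp: x_def)
    have sx: "sin x > 0" "sin x \<le> x" using x sin_gt_zero[of x] sin_x_le_x[of x] by auto
    have cx: "cos x > 0" "cos x \<le> 1" using x cos_gt_zero[of x] by auto
    have t1: "sin x \<le> tan x" using sx cx by (simp add: tan_def field_simps)
    have t2: "x \<le> tan x" using abs_tan_ge[of x] x tan_gt_zero[of x] by simp
    have "2 * sin x powr p = 2 * (sin x * sin x powr (p - 1))"
      using sx powr_add[of "sin x" 1 "p - 1"] by simp
    also have "\<dots> \<le> 2 * (x * tan x powr (p - 1))"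
      using sx t1 assms by (intro mult_left_mono mult_mono powr_mono2) auto
    also have "\<dots> = 2 * (x powr (1 - \<alpha>) * (x powr \<alpha> * tan x powr (p - 1)))"
      using x powr_add[of x "1 - \<alpha>" \<alpha>] by (simp add: mult.assoc[symmetric])
    also have "\<dots> \<le> 2 * (x powr (1 - \<alpha>) * (tan x powr \<alpha> * tan x powr (p - 1)))"
      using x t2 assms by (intro mult_left_mono mult_right_mono powr_mono2) auto
    also have "tan x powr \<alpha> * tan x powr (p - 1) = tan x powr (p - 1 + \<alpha>)"
      by (simp add: powr_add[symmetric] algebra_simps)
    finally show ?thesis
      using angle_weight_half_angle[OF x(1,2)] x sin_powr_chord[of x p] by (simp add: ennreal_leI)
  qed
qed

text \<open>The ratio of the weight to the chord term is (x / sin x)^(1-\<alpha>) (1 / cos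
  x)^(p-1+\<alpha>) in the half angle x, which tends to 1 at 0.\<close>

lemma angle_weight_le:
  assumes "p > 1" "e > 0"
  obtains \<eta> where "\<eta> > 0" "\<And>\<theta>. \<theta> \<in> {0..pi} \<Longrightarrow> 2 * sin (\<theta> / 2) \<le> \<eta> \<Longrightarrow>
     angle_weight p \<alpha> \<theta> \<le> ennreal ((1 + e) * (2 powr (1 - p) * (2 * sin (\<theta> / 2)) powr p))"
proof -
  define R where "R x = (x / sin x) powr (1 - \<alpha>) * (1 / cos x) powr (p - 1 + \<alpha>)" for x :: real
  have l1: "((\<lambda>x::real. x / sin x) \<longlongrightarrow> 1) (at_right 0)"
  proof -
    have "((\<lambda>x::real. sin x / x) \<longlongrightarrow> 1) (at 0)"
      using DERIV_sin[of 0] by (simp add: has_field_derivative_iff)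
    then have "((\<lambda>x::real. inverse (sin x / x)) \<longlongrightarrow> inverse 1) (at 0)"
      by (rule tendsto_inverse) simp
    then show ?thesis by (auto intro: tendsto_mono[OF at_le])
  qed
  have l2: "((\<lambda>x::real. 1 / cos x) \<longlongrightarrow> 1) (at_right 0)"
  proof -
    have "((\<lambda>x::real. 1 / cos x) \<longlongrightarrow> 1 / cos 0) (at_right 0)"
      by (intro tendsto_intros) auto
    then show ?thesis by simp
  qed
  have "(R \<longlongrightarrow> 1 powr (1 - \<alpha>) * 1 powr (p - 1 + \<alpha>)) (at_right 0)"
    unfolding R_def by (intro tendsto_mult tendsto_powr tendsto_const l1 l2) auto
  then have "(R \<longlongrightarrow> 1) (at_right 0)" by simp
  then have "eventually (\<lambda>x. R x < 1 + e) (at_right 0)"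
    by (rule order_tendstoD(2)) (use assms in auto)
  then obtain b where b: "b > 0" "\<And>x. 0 < x \<Longrightarrow> x < b \<Longrightarrow> R x < 1 + e"
    by (auto simp: eventually_at_right_field)
  \<comment> \<open>The sine increases up to pi/2, so a chord of at most \<open>sin x0\<close>
    forces the half angle below \<open>x0\<close>, where the ratio is under control.\<close>
  define x0 where "x0 = min b (pi / 4)"
  have x0: "0 < x0" "x0 \<le> b" "x0 \<le> pi / 4" using b by (auto simp: x0_def)
  then have "x0 < pi / 2" using pi_gt_zero by linarith
  note x0 = x0 this
  have "sin x0 > 0" using x0 by (intro sin_gt_zero) auto
  moreover have "angle_weight p \<alpha> \<theta> \<le> ennreal ((1 + e) * (2 powr (1 - p) * (2 * sin (\<theta> / 2)) powr p))"
    if \<theta>: "\<theta> \<in> {0..pi}" "2 * sin (\<theta> / 2) \<le> sin x0" for \<theta>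
  proof (cases "\<theta> = 0")
    case False
    define x where "x = \<theta> / 2"
    have x: "0 < x" "x \<le> pi / 2" "\<theta> = 2 * x" using \<theta> False by (auto simp: x_def)
    have xb: "x < x0"
    proof (rule ccontr)
      assume "\<not> x < x0"
      then have "sin x0 \<le> sin x" using x x0 by (intro sin_monotone_2pi_le) auto
      then show False using \<theta>(2) \<open>sin x0 > 0\<close> by (simp add: x_def)
    qed
    have sx: "sin x > 0" and cx: "cos x > 0"
      using x xb x0 by (auto intro!: sin_gt_zero cos_gt_zero)
    have "x powr (1 - \<alpha>) * tan x powr (p - 1 + \<alpha>) = R x * sin x powr p"
    proof -
      have "R x * sin x powr p = x powr (1 - \<alpha>) / sin x powr (1 - \<alpha>) * (1 / cos x powr (p - 1 + \<alpha>)) * sin x powr ((1 - \<alpha>) + (p - 1 + \<alpha>))"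
        using x sx cx by (simp add: R_def powr_divide)
      also have "\<dots> = x powr (1 - \<alpha>) * (sin x powr (p - 1 + \<alpha>) / cos x powr (p - 1 + \<alpha>))"
        using sx by (simp only: powr_add[of "sin x" "1 - \<alpha>" "p - 1 + \<alpha>"]) simp
      also have "sin x powr (p - 1 + \<alpha>) / cos x powr (p - 1 + \<alpha>) = tan x powr (p - 1 + \<alpha>)"
        using sx cx by (simp add: tan_def powr_divide)
      finally show ?thesis by simp
    qed
    also have "\<dots> \<le> (1 + e) * sin x powr p"
      using b(2)[of x] x xb x0 by (intro mult_right_mono) auto
    finally show ?thesis
      using angle_weight_half_angle[of x p \<alpha>] x xb x0 sin_powr_chord[of x p]
      by (simp add: ennreal_leI)
  qed (simp add: angle_weight_def)
  ultimately show ?thesis using that by blast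
qed

section \<open>Lower bound\<close>

text \<open>The graph of y^p lies above its tangent at \<open>A\<close>; obtained from Young's
  inequality with weights 1/p and 1 - 1/p.\<close>

lemma powr_tangent:
  fixes p y A :: real
  assumes "p > 1" "y \<ge> 0" "A \<ge> 0"
  shows "p * A powr (p - 1) * y \<le> y powr p + (p - 1) * A powr p"
proof (cases "y = 0 \<or> A = 0")
  case True
  then show ?thesis using assms by auto
next
  case False
  then have pos: "y > 0" "A > 0" using assms by auto
  have "(y powr p) powr (1 / p) * (A powr p) powr (1 - 1 / p) \<le> 1 / p * y powr p + (1 - 1 / p) * A powr p"
    using assms pos by (intro Youngs_inequality_0) auto
  moreover have "(y powr p) powr (1 / p) = y" "(A powr p) powr (1 - 1 / p) = A powr (p - 1)"
    using assms pos by (auto simp: powr_powr right_diff_distrib)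
  ultimately have "p * (y * A powr (p - 1)) \<le> p * (1 / p * y powr p + (1 - 1 / p) * A powr p)"
    using assms by (intro mult_left_mono) auto
  also have "\<dots> = y powr p + (p - 1) * A powr p"
    using assms by (simp add: field_simps)
  finally show ?thesis by (simp add: mult_ac)
qed

text \<open>Hoelder's inequality in Jensen form: for the ratios x/m with weights m, the tangents at
  the mean ratio \<open>A\<close> are summed.\<close>

lemma sum_powr_le:
  fixes x m :: "'i \<Rightarrow> real"
  assumes "finite I" "p > 1" "\<And>k. k \<in> I \<Longrightarrow> x k \<ge> 0" "\<And>k. k \<in> I \<Longrightarrow> m k > 0"
  shows "(\<Sum>k\<in>I. x k) powr p \<le> (\<Sum>k\<in>I. x k powr p / m k powr (p - 1)) * (\<Sum>k\<in>I. m k) powr (p - 1)"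
proof (cases "I = {}")
  case False
  define X Y where "X = (\<Sum>k\<in>I. x k)" and "Y = (\<Sum>k\<in>I. m k)"
  have Y: "Y > 0" unfolding Y_def using assms False by (intro sum_pos) auto
  have X: "X \<ge> 0" unfolding X_def using assms by (intro sum_nonneg) auto
  define A where "A = X / Y"
  have A: "A \<ge> 0" using X Y by (simp add: A_def)
  have t: "p * A powr (p - 1) * x k - (p - 1) * A powr p * m k \<le> x k powr p / m k powr (p - 1)" if k: "k \<in> I" for k
  proof -
    note mk = assms(4)[OF k] and xk = assms(3)[OF k]
    have "m k * (p * A powr (p - 1) * (x k / m k)) \<le> m k * ((x k / m k) powr p + (p - 1) * A powr p)"
      using powr_tangent[OF assms(2) _ A, of "x k / m k"] mk xk by (intro mult_left_mono) auto
    moreover have "m k * (p * A powr (p - 1) * (x k / m k)) = p * A powr (p - 1) * x k" using mk by simp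
    moreover have "m k * (x k / m k) powr p = x k powr p / m k powr (p - 1)"
      using mk xk by (simp add: powr_divide powr_diff)
    ultimately show ?thesis by (simp add: algebra_simps)
  qed
  have "X powr p = A powr p * Y powr p" using X Y by (simp add: A_def powr_divide)
  also have "\<dots> = (A powr p * Y) * Y powr (p - 1)" using Y by (simp add: powr_diff)
  also have "A powr p * Y = p * A powr (p - 1) * X - (p - 1) * A powr p * Y"
  proof -
    have "A powr (p - 1) * X = A powr p * Y"
    proof (cases "A = 0")
      case False
      then have "A powr p = A powr (p - 1) * A" using A by (simp add: powr_diff)
      then show ?thesis using Y by (simp add: A_def)
    qed auto
    then show ?thesis by (simp add: algebra_simps)
  qed
  also have "\<dots> = (\<Sum>k\<in>I. p * A powr (p - 1) * x k - (p - 1) * A powr p * m k)"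
    by (simp add: sum_subtractf sum_distrib_left X_def Y_def)
  also have "\<dots> * Y powr (p - 1) \<le> (\<Sum>k\<in>I. x k powr p / m k powr (p - 1)) * Y powr (p - 1)"
    by (intro mult_right_mono sum_mono t) auto
  finally show ?thesis by (simp add: X_def Y_def)
qed simp

section \<open>The discrete energy of the unit edges\<close>

definition edge :: "(real \<Rightarrow> 'a::real_inner) \<Rightarrow> real list \<Rightarrow> nat \<Rightarrow> 'a" where
  "edge c ts i = c (ts ! Suc i) - c (ts ! i)"

definition unit_edge :: "(real \<Rightarrow> 'a::real_inner) \<Rightarrow> real list \<Rightarrow> nat \<Rightarrow> 'a" where
  "unit_edge c ts i = edge c ts i /\<^sub>R norm (edge c ts i)"

text \<open>Belongs to the interior vertex \<open>ts ! Suc i\<close>, where segments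
  \<open>i\<close> and \<open>Suc i\<close> meet.\<close>

definition half_gap :: "real list \<Rightarrow> nat \<Rightarrow> real" where
  "half_gap ts i = (ts ! Suc (Suc i) - ts ! i) / 2"

definition bend :: "real \<Rightarrow> (real \<Rightarrow> 'a::real_inner) \<Rightarrow> real list \<Rightarrow> nat \<Rightarrow> real" where
  "bend p c ts i = norm (unit_edge c ts (Suc i) - unit_edge c ts i) powr p / half_gap ts i powr (p - 1)"

lemma bend_nonneg: "bend p c ts i \<ge> 0" by (simp add: bend_def)

text \<open>Each half gap is the distance between the midpoints of two neighbouring cells, so the
  sum telescopes.\<close>

lemma sum_half_gap:
  assumes "i \<le> j"
  shows "(\<Sum>k=i..<j. half_gap ts k) = (ts ! j + ts ! Suc j) / 2 - (ts ! i + ts ! Suc i) / 2"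
  using assms by (induction j rule: dec_induct) (auto simp: half_gap_def field_simps)

locale euclidean_arc = arc_length_curve c L for c :: "real \<Rightarrow> 'a::euclidean_space" and L :: real
begin

text \<open>A chord is at most its parameter step and a minimum at most a mean, so r is at most the
  half gap; as 1 - p < 0 this lowers the factor. The power of 2 in \<open>angle_weight_ge\<close>
  cancels the one from r/2.\<close>

lemma modified_rotation_ge:
  assumes ins: "inscribed_polygonal c L ts P" and p: "p > 1" and \<alpha>: "\<alpha> \<ge> 0"
  shows "ennreal (\<Sum>i<length ts - 2. bend p c ts i) \<le> modified_rotation p \<alpha> P"
proof -
  have part: "partition_points 0 L ts" and P: "P = map c ts" and nd: "nondegenerate_polygonal P"
    using ins by (auto simp: inscribed_polygonal_def)
  note T = partition_pointsD[OF part]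
  have "ennreal (\<Sum>i<length ts - 2. bend p c ts i) = (\<Sum>i<length P - 2. ennreal (bend p c ts i))"
    by (simp add: P sum_ennreal bend_nonneg)
  also have "\<dots> \<le> modified_rotation p \<alpha> P"
    unfolding modified_rotation_def
  proof (rule sum_mono)
    fix i assume "i \<in> {..<length P - 2}"
    then have i: "Suc (Suc i) < length ts" by (auto simp: P)
    have seg: "segment_vector P i = edge c ts i" "segment_vector P (Suc i) = edge c ts (Suc i)"
      using i by (auto simp: segment_vector_def edge_def P)
    have ne: "edge c ts i \<noteq> 0" "edge c ts (Suc i) \<noteq> 0"
    proof -
      have "edge c ts k \<noteq> 0" if "Suc k < length ts" for k
      proof -
        have "map c ts ! k \<noteq> map c ts ! Suc k"
          using nd that unfolding nondegenerate_polygonal_def P by auto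
        then show ?thesis using that by (auto simp: edge_def)
      qed
      then show "edge c ts i \<noteq> 0" "edge c ts (Suc i) \<noteq> 0" using i by auto
    qed
    define r where "r = min_adjacent_length P i"
    define \<theta> where "\<theta> = turning_angle P i"
    define x where "x = norm (unit_edge c ts (Suc i) - unit_edge c ts i)"
    have \<theta>: "\<theta> \<in> {0..pi}" "x = 2 * sin (\<theta> / 2)"
      using unit_chord_eq_sin[OF ne] by (auto simp: \<theta>_def turning_angle_def seg x_def unit_edge_def)
    have r: "r > 0" "r \<le> half_gap ts i"
    proof -
      have "norm (edge c ts i) \<le> ts ! Suc i - ts ! i"
        using dist_le[of "ts ! i" "ts ! Suc i"] T(6)[of i] T(6)[of "Suc i"] T(5)[of i "Suc i"] i
        by (simp add: edge_def dist_norm norm_minus_commute)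
      moreover have "norm (edge c ts (Suc i)) \<le> ts ! Suc (Suc i) - ts ! Suc i"
        using dist_le[of "ts ! Suc i" "ts ! Suc (Suc i)"] T(6)[of "Suc i"] T(6)[of "Suc (Suc i)"] T(5)[of "Suc i" "Suc (Suc i)"] i
        by (simp add: edge_def dist_norm norm_minus_commute)
      ultimately show "r \<le> half_gap ts i"
        by (simp add: r_def min_adjacent_length_def seg half_gap_def)
      show "r > 0" using ne by (simp add: r_def min_adjacent_length_def seg)
    qed
    have "bend p c ts i = half_gap ts i powr (1 - p) * x powr p"
      using powr_minus_divide[of "half_gap ts i" "p - 1"] by (simp add: bend_def x_def)
    also have "\<dots> \<le> r powr (1 - p) * x powr p"
      using r p by (intro mult_right_mono powr_mono2') auto
    also have "\<dots> = (r / 2) powr (1 - p) * (2 powr (1 - p) * (2 * sin (\<theta> / 2)) powr p)"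
      using r by (simp add: powr_divide \<theta>(2))
    finally have "ennreal (bend p c ts i) \<le> ennreal ((r / 2) powr (1 - p)) * ennreal (2 powr (1 - p) * (2 * sin (\<theta> / 2)) powr p)"
      by (subst ennreal_mult[symmetric]) (auto intro!: ennreal_leI)
    also have "\<dots> \<le> ennreal ((r / 2) powr (1 - p)) * angle_weight p \<alpha> \<theta>"
      by (intro mult_left_mono angle_weight_ge p \<alpha> \<theta>) auto
    finally show "ennreal (bend p c ts i) \<le> ennreal ((min_adjacent_length P i / 2) powr (1 - p)) * angle_weight p \<alpha> (turning_angle P i)"
      by (simp add: r_def \<theta>_def)
  qed
  finally show ?thesis .
qed

context
  fixes ts :: "real list" and p M :: real
  assumes part: "partition_points 0 L ts" and p: "p > 1"
    and nd: "\<And>i. i < length ts - 1 \<Longrightarrow> edge c ts i \<noteq> 0"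
    and bends: "(\<Sum>i<length ts - 2. bend p c ts i) \<le> M"
begin

lemma M_nonneg: "0 \<le> M"
  using bends by (rule order_trans[rotated]) (auto intro: sum_nonneg bend_nonneg)

text \<open>The jumps are telescoped and Hoelder's inequality \<open>sum_powr_le\<close> is applied
  with the half gaps as weights.\<close>

lemma unit_edge_diff_le:
  assumes "i \<le> j" "j < length ts - 1"
  shows "norm (unit_edge c ts j - unit_edge c ts i) powr p \<le>
     (\<Sum>k=i..<j. bend p c ts k) * (\<Sum>k=i..<j. half_gap ts k) powr (p - 1)"
proof -
  note T = partition_pointsD[OF part]
  have "unit_edge c ts j - unit_edge c ts i = (\<Sum>k=i..<j. unit_edge c ts (Suc k) - unit_edge c ts k)"
    using assms(1) by (simp add: sum_Suc_diff')
  then have "norm (unit_edge c ts j - unit_edge c ts i) \<le> (\<Sum>k=i..<j. norm (unit_edge c ts (Suc k) - unit_edge c ts k))"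
    by (simp add: norm_sum)
  then have "norm (unit_edge c ts j - unit_edge c ts i) powr p \<le> (\<Sum>k=i..<j. norm (unit_edge c ts (Suc k) - unit_edge c ts k)) powr p"
    using p by (intro powr_mono2) auto
  also have "\<dots> \<le> (\<Sum>k=i..<j. bend p c ts k) * (\<Sum>k=i..<j. half_gap ts k) powr (p - 1)"
    unfolding bend_def
  proof (rule sum_powr_le)
    fix k assume "k \<in> {i..<j}"
    then have "Suc (Suc k) < length ts" using assms(2) by auto
    then show "half_gap ts k > 0" using T(4)[of k "Suc (Suc k)"] by (simp add: half_gap_def)
  qed (use p in auto)
  finally show ?thesis .
qed

text \<open>The sum is a distance of cell midpoints, each within half a mesh of \<open>s\<close> or
  \<open>t\<close>.\<close>

lemma sum_half_gap_le:
  assumes "0 \<le> s" "s \<le> t" "t \<le> L"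
  shows "(\<Sum>k=cell_index ts s..<cell_index ts t. half_gap ts k) \<le> t - s + mesh ts"
proof -
  define i j where "i = cell_index ts s" and "j = cell_index ts t"
  have ij: "i \<le> j" unfolding i_def j_def using assms by (intro cell_index_mono[OF part]) auto
  have I: "i < length ts - 1" "ts ! i \<le> s" "s \<le> ts ! Suc i"
    unfolding i_def using cell_index[OF part, of s] assms by auto
  have J: "j < length ts - 1" "ts ! j \<le> t" "t \<le> ts ! Suc j"
    unfolding j_def using cell_index[OF part, of t] assms by auto
  have "(\<Sum>k=i..<j. half_gap ts k) \<le> t - s + mesh ts"
    unfolding sum_half_gap[OF ij] using I J mesh_ge[OF I(1)] mesh_ge[OF J(1)] by argo
  then show ?thesis by (simp add: i_def j_def)
qed

lemma sum_bend_le: "j < length ts - 1 \<Longrightarrow> (\<Sum>k=i..<j. bend p c ts k) \<le> M"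
  by (rule order_trans[OF sum_mono2 bends]) (auto simp: bend_nonneg)

text \<open>The discrete trace of the Hoelder exponent 1 - 1/p of a primitive of an L^p function;
  the mesh enters because jumps inside one step are invisible.\<close>

lemma unit_edge_diff_le_modulus:
  assumes "0 \<le> s" "s \<le> t" "t \<le> L" "cell_index ts s \<le> k" "k \<le> l" "l \<le> cell_index ts t"
  shows "norm (unit_edge c ts l - unit_edge c ts k) \<le> (M * (t - s + mesh ts) powr (p - 1)) powr (1 / p)"
proof -
  have ln: "cell_index ts t < length ts - 1" using cell_index(1)[OF part, of t] assms by auto
  have hp: "half_gap ts i > 0" if "i < cell_index ts t" for i
    using partition_pointsD(4)[OF part, of i "Suc (Suc i)"] ln that by (simp add: half_gap_def)
  have "norm (unit_edge c ts l - unit_edge c ts k) powr p \<le> (\<Sum>i=k..<l. bend p c ts i) * (\<Sum>i=k..<l. half_gap ts i) powr (p - 1)"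
    using assms ln by (intro unit_edge_diff_le) auto
  also have "\<dots> \<le> M * (t - s + mesh ts) powr (p - 1)"
  proof (intro mult_mono powr_mono2 sum_bend_le M_nonneg)
    have "(\<Sum>i=k..<l. half_gap ts i) \<le> (\<Sum>k=cell_index ts s..<cell_index ts t. half_gap ts k)"
      using assms hp by (intro sum_mono2) (auto intro: less_imp_le)
    also have "\<dots> \<le> t - s + mesh ts" using assms by (intro sum_half_gap_le) auto
    finally show "(\<Sum>i=k..<l. half_gap ts i) \<le> t - s + mesh ts" .
    show "0 \<le> (\<Sum>i=k..<l. half_gap ts i)" using hp assms by (intro sum_nonneg) (auto intro: less_imp_le)
  qed (use p ln assms in auto)
  finally have "(norm (unit_edge c ts l - unit_edge c ts k) powr p) powr (1 / p) \<le> (M * (t - s + mesh ts) powr (p - 1)) powr (1 / p)"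
    using p by (intro powr_mono2) auto
  then show ?thesis using p by (simp add: powr_powr)
qed

text \<open>An arc is nearly straight in the direction of the edge over either of its ends. Three
  errors add up: the oscillation of the unit edges, the total excess of parameter steps over chords,
  and one mesh each for moving \<open>s\<close>, for moving \<open>t\<close> and for the resulting
  change of t - s.\<close>

lemma chord_approx:
  assumes st: "0 \<le> s" "s \<le> t" "t \<le> L" and e: "e = cell_index ts s \<or> e = cell_index ts t"
  shows "norm (c t - c s - (t - s) *\<^sub>R unit_edge c ts e) \<le>
    (L - polygon_length c ts) + 3 * mesh ts + (t - s + mesh ts) * (M * (t - s + mesh ts) powr (p - 1)) powr (1 / p)"
proof -
  note T = partition_pointsD[OF part]
  define i j where "i = cell_index ts s" and "j = cell_index ts t"
  define W where "W = (M * (t - s + mesh ts) powr (p - 1)) powr (1 / p)"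
  have ij: "i \<le> j" unfolding i_def j_def using st by (intro cell_index_mono[OF part]) auto
  have I: "i < length ts - 1" "ts ! i \<le> s" "s \<le> ts ! Suc i"
    unfolding i_def using cell_index[OF part, of s] st by auto
  have J: "j < length ts - 1" "ts ! j \<le> t" "t \<le> ts ! Suc j"
    unfolding j_def using cell_index[OF part, of t] st by auto
  define d l where "d k = ts ! Suc k - ts ! k" and "l k = norm (edge c ts k)" for k
  have ld: "l k \<le> d k" if "k < length ts - 1" for k
    using dist_le[of "ts ! k" "ts ! Suc k"] T(6)[of k] T(6)[of "Suc k"] T(5)[of k "Suc k"] that
    by (simp add: l_def d_def edge_def dist_norm norm_minus_commute)
  have d0: "d k \<ge> 0" if "k < length ts - 1" for k using ld[OF that] by (auto simp: l_def intro: order_trans[OF norm_ge_zero])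
  have unit: "norm (unit_edge c ts k) = 1" if "k < length ts - 1" for k
    using nd[OF that] by (simp add: unit_edge_def)
  have el: "e < length ts - 1" using e I J by (auto simp: i_def j_def)
  have "c (ts ! j) - c (ts ! i) = (\<Sum>k=i..<j. edge c ts k)"
    unfolding edge_def using sum_Suc_diff'[OF ij, of "\<lambda>k. c (ts ! k)"] by simp
  also have "\<dots> = (\<Sum>k=i..<j. l k *\<^sub>R unit_edge c ts k)"
  proof (intro sum.cong refl)
    fix k
    show "edge c ts k = l k *\<^sub>R unit_edge c ts k"
      by (cases "edge c ts k = 0") (auto simp: l_def unit_edge_def)
  qed
  finally have E1: "c (ts ! j) - c (ts ! i) = (\<Sum>k=i..<j. l k *\<^sub>R unit_edge c ts k)" .
  have E2: "(ts ! j - ts ! i) = (\<Sum>k=i..<j. d k)"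
    unfolding d_def using sum_Suc_diff'[OF ij, of "\<lambda>k. ts ! k"] by simp
  \<comment> \<open>The first part measures the change of direction, the second the step length lost
    by the chord.\<close>
  have "c (ts ! j) - c (ts ! i) - (ts ! j - ts ! i) *\<^sub>R unit_edge c ts e =
     (\<Sum>k=i..<j. d k *\<^sub>R (unit_edge c ts k - unit_edge c ts e) - (d k - l k) *\<^sub>R unit_edge c ts k)"
    unfolding E1 E2 scaleR_sum_left sum_subtractf[symmetric] by (intro sum.cong refl) (simp add: algebra_simps)
  also have "norm \<dots> \<le> (\<Sum>k=i..<j. d k * W + (d k - l k))"
  proof (rule sum_norm_le)
    fix k assume k: "k \<in> {i..<j}"
    then have kl: "k < length ts - 1" using J by auto
    have "norm (unit_edge c ts k - unit_edge c ts e) \<le> W"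
      using e
    proof
      assume "e = cell_index ts s"
      then show ?thesis unfolding W_def using k st by (intro unit_edge_diff_le_modulus) (auto simp: i_def j_def)
    next
      assume "e = cell_index ts t"
      then show ?thesis unfolding W_def norm_minus_commute[of "unit_edge c ts k"]
        using k st by (intro unit_edge_diff_le_modulus) (auto simp: i_def j_def)
    qed
    then have "norm (d k *\<^sub>R (unit_edge c ts k - unit_edge c ts e)) \<le> d k * W"
      using d0[OF kl] by (simp add: mult_left_mono)
    moreover have "norm ((d k - l k) *\<^sub>R unit_edge c ts k) = d k - l k"
      using unit[OF kl] ld[OF kl] by simp
    ultimately show "norm (d k *\<^sub>R (unit_edge c ts k - unit_edge c ts e) - (d k - l k) *\<^sub>R unit_edge c ts k) \<le> d k * W + (d k - l k)"
      using norm_triangle_ineq4[of "d k *\<^sub>R (unit_edge c ts k - unit_edge c ts e)" "(d k - l k) *\<^sub>R unit_edge c ts k"] by simp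
  qed
  also have "\<dots> = (ts ! j - ts ! i) * W + (\<Sum>k=i..<j. d k - l k)"
    by (simp add: E2 sum.distrib sum_distrib_right)
  \<comment> \<open>All excesses are nonnegative, so a partial sum is at most the total length
    defect.\<close>
  also have "(\<Sum>k=i..<j. d k - l k) \<le> (\<Sum>k<length ts - 1. d k - l k)"
    using J ld by (intro sum_mono2) auto
  also have "\<dots> = L - polygon_length c ts"
  proof -
    have "(\<Sum>k<length ts - 1. d k) = L"
      unfolding d_def using T(2,3) by (simp add: sum_lessThan_telescope[of "\<lambda>k. ts ! k"])
    moreover have "(\<Sum>k<length ts - 1. l k) = polygon_length c ts"
      by (simp add: polygon_length_def l_def edge_def dist_norm norm_minus_commute)
    ultimately show ?thesis by (simp add: sum_subtractf)
  qed
  also have "(ts ! j - ts ! i) * W \<le> (t - s + mesh ts) * W"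
    using I J mesh_ge[OF I(1)] by (intro mult_right_mono) (auto simp: W_def)
  finally have main: "norm (c (ts ! j) - c (ts ! i) - (ts ! j - ts ! i) *\<^sub>R unit_edge c ts e) \<le>
     (t - s + mesh ts) * W + (L - polygon_length c ts)" by simp
  have b1: "norm (c t - c (ts ! j)) \<le> mesh ts"
    using dist_le[of "ts ! j" t] T(6)[of j] J st mesh_ge[OF J(1)] by (simp add: dist_norm norm_minus_commute)
  have b2: "norm (c s - c (ts ! i)) \<le> mesh ts"
    using dist_le[of "ts ! i" s] T(6)[of i] I st mesh_ge[OF I(1)] by (simp add: dist_norm norm_minus_commute)
  have b3: "norm (((t - s) - (ts ! j - ts ! i)) *\<^sub>R unit_edge c ts e) \<le> mesh ts"
    using unit[OF el] I J mesh_ge[OF I(1)] mesh_ge[OF J(1)] by (simp add: abs_le_iff)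
  have "c t - c s - (t - s) *\<^sub>R unit_edge c ts e =
     (c (ts ! j) - c (ts ! i) - (ts ! j - ts ! i) *\<^sub>R unit_edge c ts e) + (c t - c (ts ! j))
     - (c s - c (ts ! i)) - ((t - s) - (ts ! j - ts ! i)) *\<^sub>R unit_edge c ts e"
    by (simp add: algebra_simps)
  also have "norm \<dots> \<le> ((t - s + mesh ts) * W + (L - polygon_length c ts)) + mesh ts + mesh ts + mesh ts"
  proof -
    have "norm (x + y - z - u) \<le> norm x + norm y + norm z + norm u" for x y z u :: 'a
      using norm_triangle_ineq[of x y] norm_triangle_ineq4[of "x + y" z] norm_triangle_ineq4[of "x + y - z" u] by linarith
    then show ?thesis by (rule order_trans) (intro add_mono main b1 b2 b3)
  qed
  finally show ?thesis by (simp add: W_def)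
qed

text \<open>Consecutive parameters use disjoint ranges of vertices, so in the sum of the Hoelder
  bounds the bends telescope and are paid only once.\<close>

lemma unit_edge_variation:
  assumes u: "\<And>k. k \<le> n \<Longrightarrow> u k \<in> {0..L}" "\<And>k. k < n \<Longrightarrow> u k \<le> u (Suc k)" "\<And>k. k < n \<Longrightarrow> u (Suc k) - u k \<le> \<delta>"
  shows "(\<Sum>k<n. norm (unit_edge c ts (cell_index ts (u (Suc k))) - unit_edge c ts (cell_index ts (u k))) powr p)
     \<le> M * (\<delta> + mesh ts) powr (p - 1)"
proof -
  define S where "S j = (\<Sum>i<j. bend p c ts i)" for j
  define \<kappa> where "\<kappa> k = cell_index ts (u k)" for k
  have \<kappa>l: "\<kappa> k < length ts - 1" if "k \<le> n" for k
    unfolding \<kappa>_def by (rule cell_index(1)[OF part u(1)[OF that]])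
  have "norm (unit_edge c ts (\<kappa> (Suc k)) - unit_edge c ts (\<kappa> k)) powr p \<le> (S (\<kappa> (Suc k)) - S (\<kappa> k)) * (\<delta> + mesh ts) powr (p - 1)"
    if k: "k < n" for k
  proof -
    have le: "\<kappa> k \<le> \<kappa> (Suc k)"
      unfolding \<kappa>_def using u k by (intro cell_index_mono[OF part]) auto
    have hp: "half_gap ts i > 0" if "i < \<kappa> (Suc k)" for i
      using partition_pointsD(4)[OF part, of i "Suc (Suc i)"] \<kappa>l[of "Suc k"] k that by (simp add: half_gap_def)
    have "norm (unit_edge c ts (\<kappa> (Suc k)) - unit_edge c ts (\<kappa> k)) powr p \<le>
       (\<Sum>i=\<kappa> k..<\<kappa> (Suc k). bend p c ts i) * (\<Sum>i=\<kappa> k..<\<kappa> (Suc k). half_gap ts i) powr (p - 1)"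
      using le \<kappa>l k by (intro unit_edge_diff_le) auto
    also have "(\<Sum>i=\<kappa> k..<\<kappa> (Suc k). bend p c ts i) = S (\<kappa> (Suc k)) - S (\<kappa> k)"
      unfolding S_def using le by (simp add: sum_diff_nat_ivl lessThan_atLeast0)
    also have "\<dots> * (\<Sum>i=\<kappa> k..<\<kappa> (Suc k). half_gap ts i) powr (p - 1) \<le> \<dots> * (\<delta> + mesh ts) powr (p - 1)"
    proof (intro mult_left_mono powr_mono2)
      have "(\<Sum>i=\<kappa> k..<\<kappa> (Suc k). half_gap ts i) \<le> u (Suc k) - u k + mesh ts"
        unfolding \<kappa>_def using u(1)[of k] u(1)[of "Suc k"] u(2)[OF k] k by (intro sum_half_gap_le) auto
      then show "(\<Sum>i=\<kappa> k..<\<kappa> (Suc k). half_gap ts i) \<le> \<delta> + mesh ts" using u(3)[OF k] by simp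
      show "0 \<le> S (\<kappa> (Suc k)) - S (\<kappa> k)"
        unfolding S_def using le by (simp add: sum_mono2 bend_nonneg)
      show "0 \<le> (\<Sum>i=\<kappa> k..<\<kappa> (Suc k). half_gap ts i)" using hp by (intro sum_nonneg) (auto intro: less_imp_le)
    qed (use p in auto)
    finally show ?thesis .
  qed
  then have "(\<Sum>k<n. norm (unit_edge c ts (\<kappa> (Suc k)) - unit_edge c ts (\<kappa> k)) powr p) \<le>
     (\<Sum>k<n. (S (\<kappa> (Suc k)) - S (\<kappa> k)) * (\<delta> + mesh ts) powr (p - 1))"
    by (intro sum_mono) auto
  also have "\<dots> = (S (\<kappa> n) - S (\<kappa> 0)) * (\<delta> + mesh ts) powr (p - 1)"
    by (simp add: sum_distrib_right[symmetric] sum_lessThan_telescope[of "\<lambda>k. S (\<kappa> k)"])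
  also have "\<dots> \<le> M * (\<delta> + mesh ts) powr (p - 1)"
  proof (rule mult_right_mono)
    have "S (\<kappa> n) \<le> M" using sum_bend_le[OF \<kappa>l[of n], of 0] by (simp add: S_def lessThan_atLeast0)
    moreover have "0 \<le> S (\<kappa> 0)" by (simp add: S_def sum_nonneg bend_nonneg)
    ultimately show "S (\<kappa> n) - S (\<kappa> 0) \<le> M" by simp
  qed simp
  finally show ?thesis by (simp add: \<kappa>_def)
qed

end

end

section \<open>Passage to the limit in the edge directions\<close>

context euclidean_arc
begin

text \<open>At a fixed parameter s the directions \<open>T h s\<close> are Cauchy, as for late h all
  of them are close to one and the same difference quotient of the curve with a nearby t. The limit
  inherits the chord estimate, so it is the derivative of \<open>c\<close>, and the variation
  estimate, so the criterion of Riesz applies.\<close>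

lemma twice_primitive_of_bounded_rotation:
  assumes ins: "\<And>h :: nat. inscribed_polygonal c L (ts h) (P h)"
    and modulus: "(\<lambda>h. polygonal_modulus c (ts h)) \<longlonglongrightarrow> 0"
    and bound: "\<And>h. modified_rotation p \<alpha> (P h) \<le> ennreal M"
    and p: "p > 1" and \<alpha>: "\<alpha> \<ge> 0" and M: "M \<ge> 0"
  obtains w v where "twice_primitive 0 L c w v" "integrable lborel v" "(\<integral>\<^sup>+t. ennreal (norm (v t) powr p) \<partial>lborel) \<le> ennreal M"
proof -
  have part: "partition_points 0 L (ts h)" for h
    using ins by (auto simp: inscribed_polygonal_def)
  have nd: "edge c (ts h) i \<noteq> 0" if "i < length (ts h) - 1" for h i
  proof -
    have "map c (ts h) ! i \<noteq> map c (ts h) ! Suc i"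
      using ins[of h] that by (auto simp: inscribed_polygonal_def nondegenerate_polygonal_def)
    then show ?thesis using that by (auto simp: edge_def)
  qed
  have bends: "(\<Sum>i<length (ts h) - 2. bend p c (ts h) i) \<le> M" for h
    using order_trans[OF modified_rotation_ge[OF ins p \<alpha>] bound] M by (simp add: ennreal_le_iff)
  have mesh0: "(\<lambda>h. mesh (ts h)) \<longlonglongrightarrow> 0"
    by (rule mesh_tendsto_0[OF part modulus])
  have def0: "(\<lambda>h. L - polygon_length c (ts h)) \<longlonglongrightarrow> 0"
    using tendsto_diff[OF tendsto_const polygon_length_tendsto[OF part mesh0], of L] by simp
  have mesh_ge0: "mesh (ts h) \<ge> 0" for h using mesh_pos[OF part[of h]] by simp
  define T where "T h s = unit_edge c (ts h) (cell_index (ts h) s)" for h s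
  define W where "W x = (M * x powr (p - 1)) powr (1 / p)" for x
  define E where "E h x = (L - polygon_length c (ts h)) + 3 * mesh (ts h) + (x + mesh (ts h)) * W (x + mesh (ts h))" for h x
  \<comment> \<open>Both orders of \<open>s\<close> and \<open>t\<close> occur because at 0 and L
    only one side is available; both choices of \<open>r\<close> are needed to compare the
    directions at the two ends of one chord.\<close>
  have approx: "norm (c t - c s - (t - s) *\<^sub>R T h r) \<le> E h \<bar>t - s\<bar>"
    if "s \<in> {0..L}" "t \<in> {0..L}" "r \<in> {s, t}" for s t r h
  proof (cases "s \<le> t")
    case True
    then show ?thesis
      using chord_approx[OF part p nd bends, where s = s and t = t and e = "cell_index (ts h) r"] that
      by (auto simp: E_def W_def T_def)
  next
    case False
    then have "norm (c s - c t - (s - t) *\<^sub>R T h r) \<le> E h \<bar>s - t\<bar>"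
      using chord_approx[OF part p nd bends, where s = t and t = s and e = "cell_index (ts h) r"] that
      by (auto simp: E_def W_def T_def)
    moreover have "c t - c s - (t - s) *\<^sub>R T h r = - (c s - c t - (s - t) *\<^sub>R T h r)"
      by (simp add: algebra_simps)
    ultimately show ?thesis by (simp only: norm_minus_cancel abs_minus_commute)
  qed
  have Elim: "(\<lambda>h. E h x) \<longlonglongrightarrow> x * W x" if x: "x > 0" for x
  proof -
    have xm: "(\<lambda>h. x + mesh (ts h)) \<longlonglongrightarrow> x"
      using tendsto_add[OF tendsto_const mesh0, of x] by simp
    have "(\<lambda>h. W (x + mesh (ts h))) \<longlonglongrightarrow> W x"
      unfolding W_def using x p M mesh_ge0
      by (intro tendsto_powr' tendsto_mult tendsto_const tendsto_powr xm) auto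
    then have "(\<lambda>h. E h x) \<longlonglongrightarrow> 0 + 3 * 0 + x * W x"
      unfolding E_def by (intro tendsto_add tendsto_mult tendsto_const def0 mesh0 xm)
    then show ?thesis by simp
  qed
  have W0: "\<exists>d>0. \<forall>x. 0 < x \<and> x < d \<longrightarrow> W x < e" if "e > 0" for e
  proof -
    have l: "((\<lambda>x. x powr (p - 1)) \<longlongrightarrow> 0 powr (p - 1)) (at_right (0::real))"
      using p by (intro tendsto_powr' tendsto_ident_at tendsto_const) (auto simp: eventually_at_right_field intro!: exI[of _ 1])
    then have "((\<lambda>x. M * x powr (p - 1)) \<longlongrightarrow> M * 0 powr (p - 1)) (at_right 0)"
      by (intro tendsto_mult tendsto_const)
    then have "(W \<longlongrightarrow> (M * 0 powr (p - 1)) powr (1 / p)) (at_right 0)"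
      unfolding W_def using p M by (intro tendsto_powr' tendsto_const) auto
    then have "(W \<longlongrightarrow> 0) (at_right 0)" using p by simp
    then have "eventually (\<lambda>x. W x < e) (at_right 0)"
      by (rule order_tendstoD(2)) (rule that)
    then show ?thesis by (auto simp: eventually_at_right_field)
  qed
  have W_nonneg: "W x \<ge> 0" for x by (simp add: W_def)
  have near: "\<exists>t\<in>{0..L}. t \<noteq> s \<and> \<bar>t - s\<bar> < d" if "s \<in> {0..L}" "d > 0" for s d
  proof (cases "s < L")
    case True
    then show ?thesis using that by (intro bexI[of _ "s + min (d / 2) (L - s)"]) auto
  next
    case False
    then show ?thesis using that L_pos by (intro bexI[of _ "L - min (d / 2) L"]) auto
  qed
  have "convergent (\<lambda>h. T h s)" if s: "s \<in> {0..L}" for s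
  proof (rule Cauchy_convergent, rule metric_CauchyI)
    fix e :: real assume "e > 0"
    then obtain d where d: "d > 0" "\<And>x. 0 < x \<Longrightarrow> x < d \<Longrightarrow> W x < e / 2"
      using W0[of "e / 2"] by auto
    obtain t where t: "t \<in> {0..L}" "t \<noteq> s" "\<bar>t - s\<bar> < d" using near[OF s d(1)] by blast
    define x where "x = \<bar>t - s\<bar>"
    have x: "x > 0" "x < d" using t by (auto simp: x_def)
    have "x * W x < x * (e / 2)" using d(2)[OF x] x by simp
    then have "eventually (\<lambda>h. E h x < x * (e / 2)) sequentially"
      by (rule order_tendstoD(2)[OF Elim[OF x(1)]])
    then obtain N where N: "\<And>h. h \<ge> N \<Longrightarrow> E h x < x * (e / 2)"
      by (auto simp: eventually_sequentially)
    have close: "norm ((c t - c s) /\<^sub>R (t - s) - T h s) < e / 2" if "h \<ge> N" for h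
    proof -
      have "norm (c t - c s - (t - s) *\<^sub>R T h s) < x * (e / 2)"
        using approx[OF s t(1), of s h] N[OF that] by (simp add: x_def)
      moreover have "c t - c s - (t - s) *\<^sub>R T h s = (t - s) *\<^sub>R ((c t - c s) /\<^sub>R (t - s) - T h s)"
        using t by (simp add: scaleR_diff_right)
      ultimately show ?thesis using x by (simp add: x_def)
    qed
    have "dist (T h s) (T h' s) < e" if "h \<ge> N" "h' \<ge> N" for h h'
      using close[OF that(1)] close[OF that(2)]
        dist_triangle_half_r[of "(c t - c s) /\<^sub>R (t - s)" "T h s" e "T h' s"] by (simp add: dist_norm)
    then show "\<exists>N. \<forall>h\<ge>N. \<forall>h'\<ge>N. dist (T h s) (T h' s) < e" by blast
  qed
  then obtain w where Tlim: "\<And>s. s \<in> {0..L} \<Longrightarrow> (\<lambda>h. T h s) \<longlonglongrightarrow> w s"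
    unfolding convergent_def by metis
  have appr: "norm (c t - c s - (t - s) *\<^sub>R w r) \<le> \<bar>t - s\<bar> * W \<bar>t - s\<bar>"
    if st: "s \<in> {0..L}" "t \<in> {0..L}" "r \<in> {s, t}" "s \<noteq> t" for s t r
  proof (rule LIMSEQ_le)
    show "(\<lambda>h. norm (c t - c s - (t - s) *\<^sub>R T h r)) \<longlonglongrightarrow> norm (c t - c s - (t - s) *\<^sub>R w r)"
      using st by (intro tendsto_intros Tlim) auto
    show "(\<lambda>h. E h \<bar>t - s\<bar>) \<longlonglongrightarrow> \<bar>t - s\<bar> * W \<bar>t - s\<bar>" using st by (intro Elim) auto
    show "\<exists>N. \<forall>h\<ge>N. norm (c t - c s - (t - s) *\<^sub>R T h r) \<le> E h \<bar>t - s\<bar>"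
      using approx[OF st(1-3)] by blast
  qed
  have w_mod: "norm (w t - w s) \<le> 2 * W \<bar>t - s\<bar>" if st: "s \<in> {0..L}" "t \<in> {0..L}" "s \<noteq> t" for s t
  proof -
    \<comment> \<open>The same chord approximated with the direction at either end yields the
      modulus of continuity of the limit.\<close>
    have "(t - s) *\<^sub>R (w t - w s) = (c t - c s - (t - s) *\<^sub>R w s) - (c t - c s - (t - s) *\<^sub>R w t)"
      by (simp add: algebra_simps)
    then have "\<bar>t - s\<bar> * norm (w t - w s) \<le> norm (c t - c s - (t - s) *\<^sub>R w s) + norm (c t - c s - (t - s) *\<^sub>R w t)"
      by (metis norm_scaleR norm_triangle_ineq4)
    also have "\<dots> \<le> \<bar>t - s\<bar> * W \<bar>t - s\<bar> + \<bar>t - s\<bar> * W \<bar>t - s\<bar>"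
      using st by (intro add_mono appr) auto
    finally have "\<bar>t - s\<bar> * norm (w t - w s) \<le> \<bar>t - s\<bar> * (2 * W \<bar>t - s\<bar>)" by simp
    then show ?thesis using st by simp
  qed
  have w_cont: "continuous_on {0..L} w"
    unfolding continuous_on_iff
  proof (intro ballI allI impI)
    fix s and e :: real assume s: "s \<in> {0..L}" and "e > 0"
    then obtain d where d: "d > 0" "\<And>x. 0 < x \<Longrightarrow> x < d \<Longrightarrow> W x < e / 2"
      using W0[of "e / 2"] by auto
    have "dist (w t) (w s) < e" if "t \<in> {0..L}" "dist t s < d" for t
    proof (cases "t = s")
      case False
      then have "2 * W \<bar>t - s\<bar> < e" using d(2)[of "\<bar>t - s\<bar>"] that by (simp add: dist_real_def)
      then show ?thesis using w_mod[OF s that(1)] False by (simp add: dist_norm)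
    qed (use \<open>e > 0\<close> in simp)
    then show "\<exists>d>0. \<forall>t\<in>{0..L}. dist t s < d \<longrightarrow> dist (w t) (w s) < e" using d(1) by blast
  qed
  have c_deriv: "(c has_vector_derivative w s) (at s within {0..L})" if s: "s \<in> {0..L}" for s
    unfolding has_vector_derivative_def has_derivative_within_alt
  proof (intro conjI allI impI)
    show "bounded_linear (\<lambda>x. x *\<^sub>R w s)" by (rule bounded_linear_scaleR_left)
    fix e :: real assume "e > 0"
    then obtain d where d: "d > 0" "\<And>x. 0 < x \<Longrightarrow> x < d \<Longrightarrow> W x < e"
      using W0[OF \<open>e > 0\<close>] by blast
    have "norm (c t - c s - (t - s) *\<^sub>R w s) \<le> e * norm (t - s)" if "t \<in> {0..L}" "norm (t - s) < d" for t
    proof (cases "t = s")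
      case False
      then have "norm (c t - c s - (t - s) *\<^sub>R w s) \<le> \<bar>t - s\<bar> * W \<bar>t - s\<bar>"
        using appr[OF s that(1), of s] by auto
      also have "\<dots> \<le> \<bar>t - s\<bar> * e"
        using d(2)[of "\<bar>t - s\<bar>"] that False by (intro mult_left_mono) auto
      finally show ?thesis by (simp add: mult.commute)
    qed auto
    then show "\<exists>d>0. \<forall>t\<in>{0..L}. norm (t - s) < d \<longrightarrow> norm (c t - c s - (t - s) *\<^sub>R w s) \<le> e * norm (t - s)"
      using d(1) by blast
  qed
  \<comment> \<open>At a fixed level the mesh tends to 0, so the bound with \<delta> + mesh becomes
    one with the exact cell size.\<close>
  have dyadic: "(\<Sum>k<2 ^ n. norm (w (real (Suc k) * (L / 2 ^ n)) - w (real k * (L / 2 ^ n))) powr p / (L / 2 ^ n) powr (p - 1)) \<le> M" for n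
  proof -
    define \<delta> where "\<delta> = L / 2 ^ n"
    have \<delta>: "\<delta> > 0" using L_pos by (simp add: \<delta>_def)
    define u where "u k = real k * \<delta>" for k
    have u: "u k \<in> {0..L}" if "k \<le> 2 ^ n" for k
    proof -
      have "real k \<le> 2 ^ n" using that by (metis of_nat_le_iff of_nat_numeral of_nat_power)
      then have "real k * \<delta> \<le> 2 ^ n * \<delta>" using \<delta> by (intro mult_right_mono) auto
      then show ?thesis using \<delta> L_pos by (simp add: u_def \<delta>_def)
    qed
    have "(\<Sum>k<2 ^ n. norm (w (u (Suc k)) - w (u k)) powr p) \<le> M * \<delta> powr (p - 1)"
    proof (rule LIMSEQ_le)
      show "(\<lambda>h. \<Sum>k<2 ^ n. norm (T h (u (Suc k)) - T h (u k)) powr p) \<longlonglongrightarrow> (\<Sum>k<2 ^ n. norm (w (u (Suc k)) - w (u k)) powr p)"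
        using p u by (intro tendsto_sum tendsto_powr' tendsto_norm tendsto_diff Tlim tendsto_const) auto
      have "(\<lambda>h. \<delta> + mesh (ts h)) \<longlonglongrightarrow> \<delta>" using tendsto_add[OF tendsto_const mesh0, of \<delta>] by simp
      then show "(\<lambda>h. M * (\<delta> + mesh (ts h)) powr (p - 1)) \<longlonglongrightarrow> M * \<delta> powr (p - 1)"
        using \<delta> by (intro tendsto_mult tendsto_const tendsto_powr) auto
      have "(\<Sum>k<2 ^ n. norm (T h (u (Suc k)) - T h (u k)) powr p) \<le> M * (\<delta> + mesh (ts h)) powr (p - 1)" for h
        unfolding T_def using u \<delta> by (intro unit_edge_variation[OF part p nd bends]) (auto simp: u_def algebra_simps)
      then show "\<exists>N. \<forall>h\<ge>N. (\<Sum>k<2 ^ n. norm (T h (u (Suc k)) - T h (u k)) powr p) \<le> M * (\<delta> + mesh (ts h)) powr (p - 1)"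
        by blast
    qed
    then have "(\<Sum>k<2 ^ n. norm (w (u (Suc k)) - w (u k)) powr p) / \<delta> powr (p - 1) \<le> M"
      using \<delta> by (simp add: pos_divide_le_eq)
    then show ?thesis by (simp add: sum_divide_distrib u_def \<delta>_def)
  qed
  interpret dyadic_slopes L w p M
    by unfold_locales (fact L_pos p w_cont dyadic)+
  obtain v where v: "integrable lborel v" "\<And>t. t \<in> {0..L} \<Longrightarrow> w t = w 0 + integral {0..t} v"
    "(\<integral>\<^sup>+t. ennreal (norm (v t) powr p) \<partial>lborel) \<le> ennreal M"
    using riesz_representation by blast
  have "integrable lebesgue v" 
    by (rule integrable_completion[THEN iffD2, OF borel_measurable_integrable[OF v(1)] v(1)])
  then have vai: "v absolutely_integrable_on {0..L}"
    unfolding set_integrable_def by (intro integrable_mult_indicator) auto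
  have "twice_primitive 0 L c w v"
    by (rule twice_primitive.intro[OF L_pos vai v(2) c_deriv])
  then show ?thesis using that v(1,3) by blast
qed

end

section \<open>Upper bound\<close>

text \<open>The integral form of \<open>sum_powr_le\<close>: the tangent at the mean value
  \<open>A\<close> is integrated.\<close>

lemma integral_powr_le:
  fixes f :: "real \<Rightarrow> real"
  assumes "a < b" "p > 1" "f integrable_on {a..b}" "(\<lambda>x. f x powr p) integrable_on {a..b}"
    and "\<And>x. x \<in> {a..b} \<Longrightarrow> f x \<ge> 0"
  shows "(integral {a..b} f) powr p \<le> (b - a) powr (p - 1) * integral {a..b} (\<lambda>x. f x powr p)"
proof -
  define F where "F = integral {a..b} f"
  have F: "F \<ge> 0" unfolding F_def by (rule Henstock_Kurzweil_Integration.integral_nonneg[OF assms(3,5)])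
  define A where "A = F / (b - a)"
  have A: "A \<ge> 0" "A * (b - a) = F" using F assms(1) by (auto simp: A_def)
  have "integral {a..b} (\<lambda>x. p * A powr (p - 1) * f x) \<le> integral {a..b} (\<lambda>x. f x powr p + (p - 1) * A powr p)"
    using assms A powr_tangent[OF assms(2)] integrable_cmul[OF assms(3), of "p * A powr (p - 1)"]
    by (intro integral_le integrable_add) auto
  moreover have "integral {a..b} (\<lambda>x. f x powr p + (p - 1) * A powr p) =
      integral {a..b} (\<lambda>x. f x powr p) + (p - 1) * A powr p * (b - a)"
    using assms by (subst Henstock_Kurzweil_Integration.integral_add) auto
  moreover have "p * A powr (p - 1) * F = p * A powr p * (b - a)"
  proof (cases "A = 0")
    case False
    then have "A powr p = A powr (p - 1) * A" using A by (simp add: powr_diff)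
    then show ?thesis by (simp add: A(2)[symmetric])
  qed (use A(2) in auto)
  ultimately have "A powr p * (b - a) \<le> integral {a..b} (\<lambda>x. f x powr p)"
    by (simp add: F_def algebra_simps)
  then have "(b - a) powr (p - 1) * (A powr p * (b - a)) \<le> (b - a) powr (p - 1) * integral {a..b} (\<lambda>x. f x powr p)"
    by (intro mult_left_mono) auto
  moreover have "(b - a) powr (p - 1) * (A powr p * (b - a)) = F powr p"
  proof -
    have "(b - a) powr p = (b - a) powr (p - 1) * (b - a)" using assms(1) by (simp add: powr_diff)
    then show ?thesis using assms(1) A by (simp add: powr_mult A(2)[symmetric])
  qed
  ultimately show ?thesis by (simp add: F_def)
qed

locale sobolev_arc = euclidean_arc c L + twice_primitive 0 L c w v
  for c :: "real \<Rightarrow> 'a::euclidean_space" and L :: real and w v :: "real \<Rightarrow> 'a" +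
  fixes p :: real
  assumes p: "p > 1" and vp: "(\<lambda>t. norm (v t) powr p) integrable_on {0..L}"
begin

lemma integral_w:
  assumes "0 \<le> s" "s \<le> t" "t \<le> L"
  shows "integral {s..t} w = c t - c s"
proof (rule integral_unique, rule fundamental_theorem_of_calculus[OF assms(2)])
  fix x assume "x \<in> {s..t}"
  then show "(c has_vector_derivative w x) (at x within {s..t})"
    using assms by (intro has_vector_derivative_within_subset[OF c]) auto
qed

lemma w_integrable: "0 \<le> s \<Longrightarrow> t \<le> L \<Longrightarrow> w integrable_on {s..t}"
  by (intro integrable_continuous_real continuous_on_subset[OF continuous_w]) auto

lemma norm_w_le: "s \<in> {0..L} \<Longrightarrow> norm (w s) \<le> 1"
proof (rule field_le_epsilon)
  fix e :: real assume s: "s \<in> {0..L}" and e: "e > 0"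
  obtain d where d: "d > 0" "\<And>t. t \<in> {0..L} \<Longrightarrow> norm (t - s) < d \<Longrightarrow> norm (c t - c s - (t - s) *\<^sub>R w s) \<le> e * norm (t - s)"
    using c[OF s] e unfolding has_vector_derivative_def has_derivative_within_alt by blast
  obtain t where t: "t \<in> {0..L}" "t \<noteq> s" "\<bar>t - s\<bar> < d"
  proof (cases "s < L")
    case True
    then show ?thesis using that[of "s + min (d / 2) (L - s)"] s d(1) by auto
  next
    case False
    then show ?thesis using that[of "L - min (d / 2) L"] s d(1) L_pos by auto
  qed
  have "\<bar>t - s\<bar> * norm (w s) = norm ((c t - c s) - (c t - c s - (t - s) *\<^sub>R w s))" by simp
  also have "\<dots> \<le> norm (c t - c s) + norm (c t - c s - (t - s) *\<^sub>R w s)" by (rule norm_triangle_ineq4)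
  also have "\<dots> \<le> \<bar>t - s\<bar> + e * \<bar>t - s\<bar>"
    using d(2)[of t] t dist_le_abs[OF t(1) s] by (intro add_mono) (auto simp: dist_norm abs_minus_commute)
  finally have "\<bar>t - s\<bar> * norm (w s) \<le> \<bar>t - s\<bar> * (1 + e)" by (simp add: algebra_simps)
  then show "norm (w s) \<le> 1 + e" using t by simp
qed

text \<open>The integral of |w| is at least the length of every inscribed polygonal, hence at least
  L. As |w| <= 1, the continuous function 1 - |w| is nonnegative with integral 0.\<close>

lemma norm_w: "s \<in> {0..L} \<Longrightarrow> norm (w s) = 1"
proof -
  assume s: "s \<in> {0..L}"
  have ni: "(\<lambda>x. norm (w x)) integrable_on {a..b}" if "0 \<le> a" "b \<le> L" for a b
    using that by (intro integrable_continuous_real continuous_on_norm continuous_on_subset[OF continuous_w]) auto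
  define G where "G t = integral {0..t} (\<lambda>x. norm (w x))" for t
  have poly: "polygon_length c ts \<le> G L" if ts: "partition_points 0 L ts" for ts
  proof -
    note T = partition_pointsD[OF ts]
    have "polygon_length c ts \<le> (\<Sum>i<length ts - 1. G (ts ! Suc i) - G (ts ! i))"
      unfolding polygon_length_def
    proof (rule sum_mono)
      fix i assume "i \<in> {..<length ts - 1}"
      then have i: "0 \<le> ts ! i" "ts ! i \<le> ts ! Suc i" "ts ! Suc i \<le> L"
        using T(6)[of i] T(6)[of "Suc i"] T(5)[of i "Suc i"] by auto
      have "dist (c (ts ! i)) (c (ts ! Suc i)) = norm (integral {ts ! i..ts ! Suc i} w)"
        using integral_w[OF i] by (simp add: dist_norm norm_minus_commute)
      also have "\<dots> \<le> integral {ts ! i..ts ! Suc i} (\<lambda>x. norm (w x))"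
        by (rule integral_norm_bound_integral) (use i w_integrable ni in auto)
      also have "\<dots> = G (ts ! Suc i) - G (ts ! i)"
        unfolding G_def using Henstock_Kurzweil_Integration.integral_combine[OF i(1,2) ni] i by simp
      finally show "dist (c (ts ! i)) (c (ts ! Suc i)) \<le> G (ts ! Suc i) - G (ts ! i)" .
    qed
    also have "\<dots> = G L - G 0"
      using sum_lessThan_telescope[of "\<lambda>i. G (ts ! i)" "length ts - 1"] T(2,3) by simp
    finally show ?thesis by (simp add: G_def)
  qed
  have "L \<le> G L"
  proof (rule field_le_epsilon)
    fix e :: real assume "e > 0"
    then obtain ts where "partition_points 0 L ts" "L - e < polygon_length c ts"
      using polygon_length_approx[of L e] L_pos by auto
    then show "L \<le> G L + e" using poly[of ts] by simp
  qed
  have cn: "continuous_on {0..L} (\<lambda>x. 1 - norm (w x))"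
    by (intro continuous_intros continuous_w)
  have "integral {0..L} (\<lambda>x. 1 - norm (w x)) = L - G L"
    unfolding G_def using L_pos ni[of 0 L] by (subst Henstock_Kurzweil_Integration.integral_diff) auto
  moreover have "integral {0..L} (\<lambda>x. 1 - norm (w x)) \<ge> 0"
    by (rule Henstock_Kurzweil_Integration.integral_nonneg[OF integrable_continuous_real[OF cn]]) (use norm_w_le in auto)
  ultimately have "integral {0..L} (\<lambda>x. 1 - norm (w x)) = 0" using \<open>L \<le> G L\<close> by simp
  then have "\<forall>x\<in>{0..L}. 1 - norm (w x) = 0"
    using integral_eq_0_iff[OF cn L_pos] norm_w_le by auto
  then show ?thesis using s by auto
qed

definition V :: "real \<Rightarrow> real" where "V t = integral {0..t} (\<lambda>x. norm (v x) powr p)"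

lemma V_diff:
  assumes "0 \<le> s" "s \<le> t" "t \<le> L"
  shows "V t - V s = integral {s..t} (\<lambda>x. norm (v x) powr p)"
  unfolding V_def
  using Henstock_Kurzweil_Integration.integral_combine[OF assms(1,2), of "\<lambda>x. norm (v x) powr p"]
    integrable_on_subinterval[OF vp, of 0 t] assms by simp

lemma V_nonneg: "t \<in> {0..L} \<Longrightarrow> 0 \<le> V t"
  unfolding V_def by (rule Henstock_Kurzweil_Integration.integral_nonneg[OF integrable_on_subinterval[OF vp]]) auto

lemma V_mono: "0 \<le> s \<Longrightarrow> s \<le> t \<Longrightarrow> t \<le> L \<Longrightarrow> V s \<le> V t"
  using V_diff[of s t] Henstock_Kurzweil_Integration.integral_nonneg[OF integrable_on_subinterval[OF vp], of s t] by simp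

lemma continuous_V: "continuous_on {0..L} V"
  unfolding V_def by (rule indefinite_integral_continuous_1[OF vp])

lemma w_diff_powr_le:
  assumes "0 \<le> s" "s < t" "t \<le> L"
  shows "norm (w t - w s) powr p \<le> (t - s) powr (p - 1) * (V t - V s)"
proof -
  have vi: "v integrable_on {a..b}" "(\<lambda>x. norm (v x)) integrable_on {a..b}" if "0 \<le> a" "b \<le> L" for a b
  proof -
    have "v absolutely_integrable_on {a..b}"
      by (rule set_integrable_subset[OF v]) (use that in auto)
    then show "v integrable_on {a..b}" "(\<lambda>x. norm (v x)) integrable_on {a..b}"
      by (auto simp: absolutely_integrable_on_def)
  qed
  have "w t - w s = integral {s..t} v"
    using w[of t] w[of s] Henstock_Kurzweil_Integration.integral_combine[OF assms(1) less_imp_le[OF assms(2)] vi(1)] assms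
    by (simp add: algebra_simps)
  then have "norm (w t - w s) \<le> integral {s..t} (\<lambda>x. norm (v x))"
    using integral_norm_bound_integral[OF vi(1) vi(2), of s t] assms by auto
  then have "norm (w t - w s) powr p \<le> (integral {s..t} (\<lambda>x. norm (v x))) powr p"
    using p by (intro powr_mono2) auto
  also have "\<dots> \<le> (t - s) powr (p - 1) * integral {s..t} (\<lambda>x. norm (v x) powr p)"
    using assms p vi integrable_on_subinterval[OF vp, of s t] by (intro integral_powr_le) auto
  finally show ?thesis using V_diff[of s t] assms by simp
qed

section \<open>Polygonals inscribed at uniform parameters\<close>

definition node :: "nat \<Rightarrow> nat \<Rightarrow> real" where "node m i = real i * (L / real m)"

definition grid :: "nat \<Rightarrow> real list" where "grid m = map (node m) [0..<Suc m]"

definition chord_quotient :: "nat \<Rightarrow> nat \<Rightarrow> 'a" where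
  "chord_quotient m i = (c (node m (Suc i)) - c (node m i)) /\<^sub>R (L / real m)"

lemma node_Suc: "node m (Suc i) = node m i + L / real m"
  by (simp add: node_def algebra_simps add_divide_distrib)

lemma node_in: "m > 0 \<Longrightarrow> i \<le> m \<Longrightarrow> node m i \<in> {0..L}"
  using L_pos mult_right_mono[of "real i" "real m" "L / real m"] by (auto simp: node_def)

lemma step_pos: "m > 0 \<Longrightarrow> L / real m > 0" using L_pos by simp

lemma grid_length: "length (grid m) = Suc m" by (simp add: grid_def)

lemma grid_nth: "i \<le> m \<Longrightarrow> grid m ! i = node m i"
  unfolding grid_def by (subst nth_map) (auto simp del: upt_Suc)

lemma grid_partition:
  assumes "m > 0" shows "partition_points 0 L (grid m)"
  unfolding partition_points_def
proof (intro conjI)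
  show "2 \<le> length (grid m)" using assms by (simp add: grid_length)
  show "sorted_wrt (<) (grid m)"
    unfolding sorted_wrt_iff_nth_less
  proof (intro allI impI)
    fix i j assume ij: "i < j" "j < length (grid m)"
    then have "real i * (L / real m) < real j * (L / real m)"
      using step_pos[OF assms] by (intro mult_strict_right_mono) auto
    then show "grid m ! i < grid m ! j" using ij by (simp add: grid_length grid_nth node_def)
  qed
  have "grid m \<noteq> []" by (simp add: grid_def)
  then show "hd (grid m) = 0" "last (grid m) = L"
    using assms by (auto simp: hd_conv_nth last_conv_nth grid_length grid_nth node_def)
qed

text \<open>The increment of the difference quotient is the mean over \<open>x\<close> in a cell of \<open>w (x + \<delta>) - w x\<close>. After
  Jensen's inequality the cell integrals of \<open>V (x + \<delta>) - V x\<close> telescope.\<close>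

lemma sum_chord_quotient_powr:
  assumes m: "m > 0"
  shows "(\<Sum>i<m - 1. norm (chord_quotient m (Suc i) - chord_quotient m i) powr p * (L / real m) powr (1 - p)) \<le> V L"
proof -
  define \<delta> where "\<delta> = L / real m"
  have \<delta>: "\<delta> > 0" unfolding \<delta>_def by (rule step_pos[OF m])
  define A where "A i = integral {node m i..node m (Suc i)} V" for i
  have seg: "norm (chord_quotient m (Suc i) - chord_quotient m i) powr p * \<delta> powr (1 - p) \<le> (A (Suc i) - A i) / \<delta>"
    if i: "i < m - 1" for i
  proof -
    define a b where "a = node m i" and "b = node m (Suc i)"
    have ab: "b = a + \<delta>" "node m (Suc (Suc i)) = b + \<delta>" by (auto simp: a_def b_def node_Suc \<delta>_def)
    have in0: "0 \<le> a" "b + \<delta> \<le> L"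
      using node_in[OF m, of i] node_in[OF m, of "Suc (Suc i)"] i ab by (auto simp: a_def)
    define g where "g x = w (x + \<delta>) - w x" for x
    have cg: "continuous_on {a..b} g"
      unfolding g_def using in0 ab \<delta>
      by (intro continuous_intros continuous_on_compose2[OF continuous_w] continuous_on_subset[OF continuous_w]) auto
    have cV: "continuous_on {a..b} V" "continuous_on {a..b} (\<lambda>x. V (x + \<delta>))"
      using in0 ab \<delta>
      by (intro continuous_intros continuous_on_compose2[OF continuous_V] continuous_on_subset[OF continuous_V]; auto)+
    have sh: "integral {a..b} (\<lambda>x. f (x + \<delta>)) = integral {b..b + \<delta>} f" for f :: "real \<Rightarrow> 'b::euclidean_space"
      using integral_shift_Icc_real[of a b f \<delta>] ab by (simp add: o_def add.commute)
    have "integral {a..b} g = integral {a..b} (\<lambda>x. w (x + \<delta>)) - integral {a..b} w"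
      unfolding g_def using in0 ab \<delta>
      by (intro Henstock_Kurzweil_Integration.integral_diff integrable_continuous_real
          continuous_on_compose2[OF continuous_w] continuous_on_subset[OF continuous_w] continuous_intros) auto
    also have "\<dots> = (c (b + \<delta>) - c b) - (c b - c a)"
      unfolding sh using in0 ab \<delta> by (simp add: integral_w)
    finally have ig: "chord_quotient m (Suc i) - chord_quotient m i = integral {a..b} g /\<^sub>R \<delta>"
      by (simp add: chord_quotient_def ab(2) scaleR_diff_right flip: a_def b_def \<delta>_def)
    have "norm (chord_quotient m (Suc i) - chord_quotient m i) powr p = norm (integral {a..b} g) powr p / \<delta> powr p"
      unfolding ig using \<delta> by (simp add: powr_divide divide_inverse[symmetric] mult.commute inverse_eq_divide)
    also have "norm (integral {a..b} g) powr p \<le> (integral {a..b} (\<lambda>x. norm (g x))) powr p"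
      using p by (intro powr_mono2 integral_norm_bound_integral integrable_continuous_real continuous_on_norm cg) auto
    also have "\<dots> \<le> \<delta> powr (p - 1) * integral {a..b} (\<lambda>x. norm (g x) powr p)"
    proof -
      have "continuous_on {a..b} (\<lambda>x. norm (g x) powr p)"
        using p by (intro continuous_on_powr' continuous_on_norm cg continuous_on_const) auto
      then show ?thesis
        using integral_powr_le[of a b p "\<lambda>x. norm (g x)", OF _ p
            integrable_continuous_real[OF continuous_on_norm[OF cg]] integrable_continuous_real] \<delta> ab(1) by simp
    qed
    also have "integral {a..b} (\<lambda>x. norm (g x) powr p) \<le> integral {a..b} (\<lambda>x. \<delta> powr (p - 1) * (V (x + \<delta>) - V x))"
    proof (rule integral_le)
      show "(\<lambda>x. norm (g x) powr p) integrable_on {a..b}"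
        using p by (intro integrable_continuous_real continuous_on_powr' continuous_on_norm cg continuous_on_const) auto
      show "(\<lambda>x. \<delta> powr (p - 1) * (V (x + \<delta>) - V x)) integrable_on {a..b}"
        by (intro integrable_continuous_real continuous_intros cV)
      show "norm (g x) powr p \<le> \<delta> powr (p - 1) * (V (x + \<delta>) - V x)" if "x \<in> {a..b}" for x
        using w_diff_powr_le[of x "x + \<delta>"] that in0 ab \<delta> by (auto simp: g_def)
    qed
    also have "\<dots> = \<delta> powr (p - 1) * (integral {a..b} (\<lambda>x. V (x + \<delta>)) - integral {a..b} V)"
      using cV by (simp add: Henstock_Kurzweil_Integration.integral_diff integrable_continuous_real)
    also have "\<dots> = \<delta> powr (p - 1) * (A (Suc i) - A i)"
      unfolding sh by (simp add: A_def ab(2) flip: a_def b_def)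
    finally have "norm (chord_quotient m (Suc i) - chord_quotient m i) powr p \<le> \<delta> powr (p - 1) * (\<delta> powr (p - 1) * (A (Suc i) - A i)) / \<delta> powr p"
      using \<delta> by (simp add: divide_right_mono mult_left_mono)
    then have "norm (chord_quotient m (Suc i) - chord_quotient m i) powr p * \<delta> powr (1 - p) \<le>
       \<delta> powr (p - 1) * (\<delta> powr (p - 1) * (A (Suc i) - A i)) / \<delta> powr p * \<delta> powr (1 - p)"
      by (intro mult_right_mono) auto
    also have "\<dots> = (A (Suc i) - A i) / \<delta>"
    proof -
      have "\<delta> powr p = \<delta> powr (p - 1) * \<delta>" "\<delta> powr (1 - p) = 1 / \<delta> powr (p - 1)"
        using \<delta> powr_minus_divide[of \<delta> "p - 1"] by (auto simp: powr_diff)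
      then show ?thesis using \<delta> by simp
    qed
    finally show ?thesis .
  qed
  have "(\<Sum>i<m - 1. norm (chord_quotient m (Suc i) - chord_quotient m i) powr p * \<delta> powr (1 - p)) \<le> (\<Sum>i<m - 1. (A (Suc i) - A i) / \<delta>)"
    by (intro sum_mono seg) auto
  also have "\<dots> = (A (m - 1) - A 0) / \<delta>"
    by (simp add: sum_divide_distrib[symmetric] sum_lessThan_telescope)
  \<comment> \<open>Of the telescoped sum only the last cell integral counts: it is at most \<delta>
    V L because V increases, and the first one is nonnegative.\<close>
  also have "\<dots> \<le> V L"
  proof -
    have Vint: "V integrable_on {node m i..node m (Suc i)}" if "i < m" for i
      using node_in[OF m, of i] node_in[OF m, of "Suc i"] that
      by (intro integrable_continuous_real continuous_on_subset[OF continuous_V]) auto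
    have A0: "A 0 \<ge> 0"
      unfolding A_def using node_in[OF m, of 0] node_in[OF m, of 1] m
      by (intro Henstock_Kurzweil_Integration.integral_nonneg[OF Vint] V_nonneg) auto
    have "A (m - 1) \<le> integral {node m (m - 1)..node m (Suc (m - 1))} (\<lambda>_. V L)"
      unfolding A_def using node_in[OF m, of "m - 1"] node_in[OF m, of m] m
      by (intro integral_le Vint V_mono) auto
    moreover have "node m m = node m (m - 1) + \<delta>"
      using node_Suc[of m "m - 1"] m by (simp add: \<delta>_def)
    ultimately have "A (m - 1) \<le> \<delta> * V L" using m \<delta> by simp
    then show ?thesis using \<delta> A0 by (simp add: pos_divide_le_eq mult.commute)
  qed
  finally show ?thesis by (simp add: \<delta>_def)
qed

text \<open>The difference quotient is the mean of \<open>w\<close> over a cell, and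
  \<open>w\<close> is uniformly continuous.\<close>

lemma chord_quotient_near_w:
  assumes "\<epsilon> > 0"
  obtains m0 where "m0 > 0" "\<And>m i. m \<ge> m0 \<Longrightarrow> i < m \<Longrightarrow> norm (chord_quotient m i - w (node m i)) \<le> \<epsilon>"
    "\<And>m i. m \<ge> m0 \<Longrightarrow> i < m \<Longrightarrow> norm (w (node m (Suc i)) - w (node m i)) \<le> \<epsilon>"
proof -
  have "uniformly_continuous_on {0..L} w"
    by (rule compact_uniformly_continuous[OF continuous_w]) auto
  then obtain d where d: "d > 0" "\<And>s t. s \<in> {0..L} \<Longrightarrow> t \<in> {0..L} \<Longrightarrow> dist t s < d \<Longrightarrow> dist (w t) (w s) < \<epsilon>"
    using assms unfolding uniformly_continuous_on_def by metis
  obtain m0 :: nat where m0: "L / d < real m0" using reals_Archimedean2 by blast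
  have m0pos: "m0 > 0" using m0 L_pos d(1) by (metis divide_pos_pos less_trans of_nat_0_less_iff)
  have small: "L / real m < d" "m > 0" if "m \<ge> m0" for m
  proof -
    show "m > 0" using that m0pos by simp
    moreover have "L / d < real m" using m0 that by (meson less_le_trans of_nat_le_iff)
    ultimately show "L / real m < d" using d(1) by (simp add: field_simps)
  qed
  have osc: "norm (w x - w (node m i)) \<le> \<epsilon>" if "m \<ge> m0" "i < m" "x \<in> {node m i..node m (Suc i)}" for m i x
  proof -
    have "x \<in> {0..L}" "node m i \<in> {0..L}" "dist x (node m i) < d"
      using that node_in[of m i] node_in[of m "Suc i"] small[OF that(1)] by (auto simp: node_Suc dist_real_def)
    then show ?thesis using d(2) by (auto simp: dist_norm intro: less_imp_le)
  qed
  have "norm (chord_quotient m i - w (node m i)) \<le> \<epsilon>" if mi: "m \<ge> m0" "i < m" for m i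
  proof -
    define \<delta> where "\<delta> = L / real m"
    have \<delta>: "\<delta> > 0" unfolding \<delta>_def using small(2)[OF mi(1)] by (rule step_pos)
    define a where "a = node m i"
    have a: "0 \<le> a" "a + \<delta> \<le> L" using node_in[of m i] node_in[of m "Suc i"] mi by (auto simp: a_def node_Suc \<delta>_def)
    have wi: "w integrable_on {a..a + \<delta>}" using a by (intro w_integrable)
    have "c (a + \<delta>) - c a - \<delta> *\<^sub>R w a = integral {a..a + \<delta>} (\<lambda>x. w x - w a)"
      using a \<delta> wi by (subst Henstock_Kurzweil_Integration.integral_diff) (auto simp: integral_w)
    also have "norm \<dots> \<le> integral {a..a + \<delta>} (\<lambda>_. \<epsilon>)"
      using osc[OF mi] wi by (intro integral_norm_bound_integral integrable_diff) (auto simp: a_def node_Suc \<delta>_def)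
    finally have "norm (c (a + \<delta>) - c a - \<delta> *\<^sub>R w a) \<le> \<delta> * \<epsilon>" using \<delta> by simp
    moreover have "c (a + \<delta>) - c a - \<delta> *\<^sub>R w a = \<delta> *\<^sub>R (chord_quotient m i - w a)"
      using \<delta> by (simp add: chord_quotient_def node_Suc scaleR_diff_right flip: a_def \<delta>_def)
    ultimately show ?thesis using \<delta> by (simp add: a_def)
  qed
  moreover have "norm (w (node m (Suc i)) - w (node m i)) \<le> \<epsilon>" if mi: "m \<ge> m0" "i < m" for m i
    using osc[OF mi, of "node m (Suc i)"] step_pos[of m] mi by (simp add: node_Suc)
  ultimately show ?thesis using that m0pos by blast
qed

lemma edge_grid: "i < m \<Longrightarrow> edge c (grid m) i = (L / real m) *\<^sub>R chord_quotient m i"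
  using L_pos by (simp add: edge_def grid_nth chord_quotient_def)

lemma chord_quotient_bounds:
  assumes "0 < \<epsilon>" "\<epsilon> < 1"
  obtains m0 where "m0 > 0" "\<And>m i. m \<ge> m0 \<Longrightarrow> i < m \<Longrightarrow> norm (chord_quotient m i) \<ge> 1 - \<epsilon>"
    "\<And>m i. m \<ge> m0 \<Longrightarrow> Suc i < m \<Longrightarrow> norm (chord_quotient m (Suc i) - chord_quotient m i) \<le> 3 * \<epsilon>"
proof -
  obtain m0 where m0: "m0 > 0" "\<And>m i. m \<ge> m0 \<Longrightarrow> i < m \<Longrightarrow> norm (chord_quotient m i - w (node m i)) \<le> \<epsilon>"
    "\<And>m i. m \<ge> m0 \<Longrightarrow> i < m \<Longrightarrow> norm (w (node m (Suc i)) - w (node m i)) \<le> \<epsilon>"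
    using chord_quotient_near_w[OF assms(1)] by metis
  have "norm (chord_quotient m i) \<ge> 1 - \<epsilon>" if mi: "m \<ge> m0" "i < m" for m i
  proof -
    have "norm (w (node m i)) = 1" using mi m0(1) by (intro norm_w node_in) auto
    then show ?thesis using m0(2)[OF mi] norm_triangle_ineq3[of "chord_quotient m i" "w (node m i)"] by (simp add: abs_le_iff)
  qed
  moreover have "norm (chord_quotient m (Suc i) - chord_quotient m i) \<le> 3 * \<epsilon>" if mi: "m \<ge> m0" "Suc i < m" for m i
  proof -
    have "chord_quotient m (Suc i) - chord_quotient m i = (chord_quotient m (Suc i) - w (node m (Suc i))) + (w (node m (Suc i)) - w (node m i))
       - (chord_quotient m i - w (node m i))" by simp
    also have "norm \<dots> \<le> 3 * \<epsilon>"
    proof -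
      have "norm (x + y - z) \<le> norm x + norm y + norm z" for x y z :: 'a
        using norm_triangle_ineq[of x y] norm_triangle_ineq4[of "x + y" z] by linarith
      from this[of "chord_quotient m (Suc i) - w (node m (Suc i))" "w (node m (Suc i)) - w (node m i)" "chord_quotient m i - w (node m i)"]
      show ?thesis using m0(2)[OF mi] m0(2)[of m i] m0(3)[of m i] mi by simp
    qed
    finally show ?thesis .
  qed
  ultimately show ?thesis using that m0(1) by blast
qed

text \<open>Three losses occur: 1 + e from the angle weight, (1 - e)^(1-p) from edges shorter than
  their step, and (1 - e)^(-p) from normalizing the edges. Their product (1 + e)(1 - e)^(1-2p) tends
  to 1 with e.\<close>

lemma grid_rotation_le:
  assumes q: "q > 0"
  obtains m0 where "m0 > 0" "\<And>m. m \<ge> m0 \<Longrightarrow> nondegenerate_polygonal (map c (grid m))"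
    "\<And>m. m \<ge> m0 \<Longrightarrow> modified_rotation p \<alpha> (map c (grid m)) \<le> ennreal ((1 + q) * V L)"
proof -
  have "((\<lambda>x. (1 + x) * (1 - x) powr (1 - 2 * p)) \<longlongrightarrow> (1 + 0) * (1 - 0) powr (1 - 2 * p)) (at_right (0::real))"
    by (intro tendsto_intros) auto
  then have "((\<lambda>x. (1 + x) * (1 - x) powr (1 - 2 * p)) \<longlongrightarrow> 1) (at_right (0::real))" by simp
  then have "eventually (\<lambda>x. (1 + x) * (1 - x) powr (1 - 2 * p) < 1 + q) (at_right (0::real))"
    by (rule order_tendstoD(2)) (use q in auto)
  then obtain b where b: "b > 0" "\<And>x. 0 < x \<Longrightarrow> x < b \<Longrightarrow> (1 + x) * (1 - x) powr (1 - 2 * p) < 1 + q"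
    by (auto simp: eventually_at_right_field)
  define e where "e = min (b / 2) (1 / 2)"
  have e: "e > 0" "e < b" "e \<le> 1 / 2" using b(1) by (auto simp: e_def)
  obtain \<eta> where \<eta>: "\<eta> > 0" "\<And>\<theta>. \<theta> \<in> {0..pi} \<Longrightarrow> 2 * sin (\<theta> / 2) \<le> \<eta> \<Longrightarrow>
     angle_weight p \<alpha> \<theta> \<le> ennreal ((1 + e) * (2 powr (1 - p) * (2 * sin (\<theta> / 2)) powr p))"
    using angle_weight_le[OF p e(1)] by blast
  \<comment> \<open>Neighbouring quotients differ by at most 3\<epsilon>, and division by 1 - e >=
    1/2 at most doubles this; 6\<epsilon> must stay below the threshold \<eta>.\<close>
  define \<epsilon> where "\<epsilon> = min e (\<eta> / 6)"
  have \<epsilon>: "0 < \<epsilon>" "\<epsilon> \<le> e" "6 * \<epsilon> \<le> \<eta>" "\<epsilon> < 1" using e \<eta>(1) by (auto simp: \<epsilon>_def)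
  obtain m0 where m0: "m0 > 0" "\<And>m i. m \<ge> m0 \<Longrightarrow> i < m \<Longrightarrow> norm (chord_quotient m i) \<ge> 1 - \<epsilon>"
    "\<And>m i. m \<ge> m0 \<Longrightarrow> Suc i < m \<Longrightarrow> norm (chord_quotient m (Suc i) - chord_quotient m i) \<le> 3 * \<epsilon>"
    using chord_quotient_bounds[OF \<epsilon>(1,4)] by metis
  have edge_ge: "norm (edge c (grid m) i) \<ge> L / real m * (1 - e)" if mi: "m \<ge> m0" "i < m" for m i
  proof -
    have "1 - e \<le> norm (chord_quotient m i)" using m0(2)[OF mi] \<epsilon>(2) by simp
    then have "L / real m * (1 - e) \<le> L / real m * norm (chord_quotient m i)" using L_pos by (intro mult_left_mono) auto
    then show ?thesis using L_pos mi by (simp add: edge_grid)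
  qed
  have edge_pos: "edge c (grid m) i \<noteq> 0" if mi: "m \<ge> m0" "i < m" for m i
  proof -
    have "L / real m * (1 - e) > 0" using e(3) step_pos[of m] mi by (intro mult_pos_pos) auto
    then show ?thesis using edge_ge[OF mi] by auto
  qed
  have nd: "nondegenerate_polygonal (map c (grid m))" if m: "m \<ge> m0" for m
    unfolding nondegenerate_polygonal_def
  proof (intro conjI allI impI)
    show "2 \<le> length (map c (grid m))" using m m0(1) by (simp add: grid_length)
    fix i assume "i < length (map c (grid m)) - 1"
    then have "i < m" by (simp add: grid_length)
    then show "map c (grid m) ! i \<noteq> map c (grid m) ! Suc i"
      using edge_pos[OF m, of i] by (auto simp: grid_length edge_def)
  qed
  have rot: "modified_rotation p \<alpha> (map c (grid m)) \<le> ennreal ((1 + q) * V L)" if m: "m \<ge> m0" for m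
  proof -
    have mpos: "m > 0" using m m0(1) by simp
    define \<delta> where "\<delta> = L / real m"
    have \<delta>: "\<delta> > 0" unfolding \<delta>_def by (rule step_pos[OF mpos])
    define \<beta> where "\<beta> = (1 + e) * (1 - e) powr (1 - 2 * p)"
    have \<beta>: "0 \<le> \<beta>" "\<beta> \<le> 1 + q" using b(2)[of e] e by (auto simp: \<beta>_def)
    define Q where "Q i = norm (chord_quotient m (Suc i) - chord_quotient m i)" for i
    let ?P = "map c (grid m)"
    have "modified_rotation p \<alpha> ?P \<le> (\<Sum>i<m - 1. ennreal (\<beta> * (Q i powr p * \<delta> powr (1 - p))))"
      unfolding modified_rotation_def
    proof (rule order_trans[OF sum_mono])
      fix i assume "i \<in> {..<length ?P - 2}"
      then have i: "Suc i < m" by (auto simp: grid_length)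
      have seg: "segment_vector ?P i = edge c (grid m) i" "segment_vector ?P (Suc i) = edge c (grid m) (Suc i)"
        using i by (auto simp: segment_vector_def edge_def grid_length)
      note ne = edge_pos[OF m Suc_lessD[OF i]] edge_pos[OF m i]
      define r where "r = min_adjacent_length ?P i"
      define \<theta> where "\<theta> = turning_angle ?P i"
      define x where "x = norm (unit_edge c (grid m) (Suc i) - unit_edge c (grid m) i)"
      have \<theta>: "\<theta> \<in> {0..pi}" "x = 2 * sin (\<theta> / 2)"
        using unit_chord_eq_sin[OF ne] by (auto simp: \<theta>_def turning_angle_def seg x_def unit_edge_def)
      have de: "\<delta> * (1 - e) > 0" using \<delta> e(3) by (intro mult_pos_pos) auto
      have r: "r \<ge> \<delta> * (1 - e)"
        unfolding r_def min_adjacent_length_def seg \<delta>_def using edge_ge[OF m] i by simp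
      have "x \<le> norm (edge c (grid m) (Suc i) - edge c (grid m) i) / (\<delta> * (1 - e))"
        unfolding x_def unit_edge_def using edge_ge[OF m] i de by (intro norm_unit_diff_le) (auto simp: \<delta>_def)
      also have "edge c (grid m) (Suc i) - edge c (grid m) i = \<delta> *\<^sub>R (chord_quotient m (Suc i) - chord_quotient m i)"
        using i by (simp add: edge_grid scaleR_diff_right flip: \<delta>_def)
      also have "norm \<dots> / (\<delta> * (1 - e)) = Q i / (1 - e)" using \<delta> by (simp add: Q_def)
      finally have xQ: "x \<le> Q i / (1 - e)" .
      also have "\<dots> \<le> 3 * \<epsilon> / (1 / 2)"
        using m0(3)[OF m i] e \<epsilon>(1) by (intro frac_le) (auto simp: Q_def)
      finally have "x \<le> \<eta>" using \<epsilon>(3) by simp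
      then have "angle_weight p \<alpha> \<theta> \<le> ennreal ((1 + e) * (2 powr (1 - p) * x powr p))"
        using \<eta>(2)[OF \<theta>(1)] \<theta>(2) by simp
      then have "ennreal ((r / 2) powr (1 - p)) * angle_weight p \<alpha> \<theta> \<le>
          ennreal ((r / 2) powr (1 - p)) * ennreal ((1 + e) * (2 powr (1 - p) * x powr p))"
        by (intro mult_left_mono) auto
      also have "\<dots> = ennreal ((1 + e) * (r powr (1 - p) * x powr p))"
        using r de e by (subst ennreal_mult[symmetric]) (auto simp: powr_divide)
      also have "\<dots> \<le> ennreal ((1 + e) * ((\<delta> * (1 - e)) powr (1 - p) * (Q i / (1 - e)) powr p))"
      proof (intro ennreal_leI mult_left_mono mult_mono)
        show "r powr (1 - p) \<le> (\<delta> * (1 - e)) powr (1 - p)" using r de p by (intro powr_mono2') auto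
        show "x powr p \<le> (Q i / (1 - e)) powr p" using xQ p by (intro powr_mono2) (auto simp: x_def)
      qed (use e in auto)
      also have "(1 + e) * ((\<delta> * (1 - e)) powr (1 - p) * (Q i / (1 - e)) powr p) = \<beta> * (Q i powr p * \<delta> powr (1 - p))"
      proof -
        have "(\<delta> * (1 - e)) powr (1 - p) = \<delta> powr (1 - p) * (1 - e) powr (1 - p)"
          using \<delta> e by (simp add: powr_mult)
        moreover have "(Q i / (1 - e)) powr p = Q i powr p / (1 - e) powr p"
          using e by (simp add: powr_divide Q_def)
        moreover have "(1 - e) powr (1 - 2 * p) = (1 - e) powr (1 - p) / (1 - e) powr p"
          by (simp add: powr_diff[symmetric])
        ultimately show ?thesis by (simp add: \<beta>_def)
      qed
      finally show "ennreal ((min_adjacent_length ?P i / 2) powr (1 - p)) * angle_weight p \<alpha> (turning_angle ?P i)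
         \<le> ennreal (\<beta> * (Q i powr p * \<delta> powr (1 - p)))" by (simp add: r_def \<theta>_def)
    qed (simp add: grid_length)
    also have "\<dots> = ennreal (\<beta> * (\<Sum>i<m - 1. Q i powr p * \<delta> powr (1 - p)))"
      using \<beta>(1) by (simp add: sum_ennreal sum_distrib_left)
    also have "\<dots> \<le> ennreal ((1 + q) * V L)"
      using sum_chord_quotient_powr[OF mpos] \<beta> V_nonneg[of L] L_pos
      by (intro ennreal_leI mult_mono) (auto simp: Q_def \<delta>_def intro!: sum_nonneg)
    finally show ?thesis .
  qed
  show ?thesis using that m0(1) nd rot by blast
qed

lemma relaxed_energy_le: "relaxed_energy p \<alpha> c L \<le> ennreal (V L)"
proof -
  obtain m0 where m0: "m0 > 0" "\<And>m. m \<ge> m0 \<Longrightarrow> nondegenerate_polygonal (map c (grid m))"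
    using grid_rotation_le[of 1] by (metis zero_less_one)
  \<comment> \<open>The shift by \<open>m0\<close> makes every member of the sequence nondegenerate,
    as the relaxation demands.\<close>
  define ts where "ts h = grid (h + m0)" for h
  have part: "partition_points 0 L (ts h)" for h unfolding ts_def using m0(1) by (intro grid_partition) simp
  have ins: "inscribed_polygonal c L (ts h) (map c (ts h))" for h
    using part m0(2)[of "h + m0"] by (simp add: inscribed_polygonal_def ts_def)
  have mod: "(\<lambda>h. polygonal_modulus c (ts h)) \<longlonglongrightarrow> 0"
  proof (rule tendsto_sandwich[of "\<lambda>_. 0"])
    have "mesh (ts h) \<le> L / real (h + m0)" for h
      unfolding ts_def using m0(1) by (intro mesh_le) (auto simp: grid_length grid_nth node_Suc)
    then show "\<forall>\<^sub>F h in sequentially. polygonal_modulus c (ts h) \<le> L / real (h + m0)"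
      using modulus_le_mesh(2)[OF part] order_trans by (intro always_eventually allI) blast
    have "(\<lambda>n. L / real n) \<longlonglongrightarrow> 0" by (rule lim_const_over_n)
    then show "(\<lambda>h. L / real (h + m0)) \<longlonglongrightarrow> 0" by (rule LIMSEQ_ignore_initial_segment)
  qed (use modulus_le_mesh(1)[OF part] in auto)
  have "relaxed_energy p \<alpha> c L \<le> liminf (\<lambda>h. modified_rotation p \<alpha> (map c (ts h)))"
    unfolding relaxed_energy_def
  proof (intro Inf_lower CollectI exI conjI allI)
    show "inscribed_polygonal c L (ts h) (map c (ts h))" for h by (rule ins)
  qed (rule refl, rule mod)
  also have "\<dots> \<le> ennreal (V L)"
  proof (rule ennreal_le_epsilon)
    fix e :: real assume e: "e > 0"
    have VL: "V L \<ge> 0" using V_nonneg[of L] L_pos by simp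
    \<comment> \<open>The added 1 covers the case of zero energy.\<close>
    define q where "q = e / (V L + 1)"
    have q: "q > 0" "q * V L \<le> e" using e VL by (auto simp: q_def field_simps)
    obtain m1 where m1: "\<And>m. m \<ge> m1 \<Longrightarrow> modified_rotation p \<alpha> (map c (grid m)) \<le> ennreal ((1 + q) * V L)"
      using grid_rotation_le[OF q(1)] by metis
    have "liminf (\<lambda>h. modified_rotation p \<alpha> (map c (ts h))) \<le> ennreal ((1 + q) * V L)"
    proof (rule Liminf_le)
      show "\<forall>\<^sub>F h in sequentially. modified_rotation p \<alpha> (map c (ts h)) \<le> ennreal ((1 + q) * V L)"
        using eventually_ge_at_top[of m1] by eventually_elim (simp add: ts_def m1)
    qed simp
    also have "\<dots> \<le> ennreal (V L + e)" using q by (intro ennreal_leI) (simp add: algebra_simps)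
    also have "\<dots> = ennreal (V L) + ennreal e" using VL e by (simp add: ennreal_plus)
    finally show "liminf (\<lambda>h. modified_rotation p \<alpha> (map c (ts h))) \<le> ennreal (V L) + ennreal e" .
  qed
  finally show ?thesis .
qed

end

section \<open>The relaxed energy\<close>

lemma in_Lp_continuous:
  fixes f :: "real \<Rightarrow> 'a::euclidean_space"
  assumes "continuous_on {a..b} f" "p > 0"
  shows "in_Lp p {a<..<b} f"
  unfolding in_Lp_def
proof
  show "f \<in> borel_measurable (lebesgue_on {a<..<b})"
    by (rule continuous_imp_measurable_on_sets_lebesgue[OF continuous_on_subset[OF assms(1)]]) auto
  have "continuous_on {a..b} (\<lambda>x. norm (f x) powr p)"
    using assms by (intro continuous_on_powr' continuous_on_norm continuous_on_const) auto
  then have "(\<lambda>x. norm (f x) powr p) absolutely_integrable_on {a<..<b}"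
    by (subst absolutely_integrable_on_Icc_iff_Ioo[symmetric]) (rule absolutely_integrable_continuous_real)
  then show "integrable (lebesgue_on {a<..<b}) (\<lambda>x. norm (f x) powr p)"
    by (rule absolutely_integrable_imp_integrable) auto
qed

text \<open>On a bounded interval |v| is dominated by 1 + |v|^p.\<close>

lemma in_Lp_imp_absolutely_integrable:
  fixes v :: "real \<Rightarrow> 'a::euclidean_space"
  assumes "in_Lp p {a<..<b} v" "p > 1"
  shows "v absolutely_integrable_on {a..b}" "(\<lambda>t. norm (v t) powr p) absolutely_integrable_on {a..b}"
proof -
  let ?M = "lebesgue_on {a<..<b}"
  have m: "v \<in> borel_measurable ?M" and ip: "integrable ?M (\<lambda>x. norm (v x) powr p)"
    using assms(1) by (auto simp: in_Lp_def)
  have i1: "integrable ?M (\<lambda>x. 1 + norm (v x) powr p)"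
    by (intro Bochner_Integration.integrable_add ip)
      (rule absolutely_integrable_imp_integrable, subst absolutely_integrable_on_Icc_iff_Ioo[symmetric],
       auto intro: absolutely_integrable_continuous_real)
  have "norm (v x) \<le> 1 + norm (v x) powr p" for x
  proof (cases "norm (v x) \<le> 1")
    case True
    then show ?thesis using powr_ge_zero[of "norm (v x)" p] by linarith
  next
    case False
    then have "norm (v x) powr 1 \<le> norm (v x) powr p" using assms(2) by (intro powr_mono) auto
    then show ?thesis using False by simp
  qed
  then have "integrable ?M v"
    by (intro Bochner_Integration.integrable_bound[OF i1 m]) (auto intro!: AE_I2 order_trans[OF _ abs_ge_self])
  moreover have conv: "integrable ?M f \<longleftrightarrow> f absolutely_integrable_on {a..b}" for f :: "real \<Rightarrow> 'a"
    unfolding absolutely_integrable_on_Icc_iff_Ioo unfolding set_integrable_def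
    by (rule integrable_restrict_space) auto
  ultimately show "v absolutely_integrable_on {a..b}" by simp
  have "integrable ?M f \<longleftrightarrow> f absolutely_integrable_on {a..b}" for f :: "real \<Rightarrow> real"
    unfolding absolutely_integrable_on_Icc_iff_Ioo unfolding set_integrable_def
    by (rule integrable_restrict_space) auto
  then show "(\<lambda>t. norm (v t) powr p) absolutely_integrable_on {a..b}" using ip by simp
qed

lemma nn_integral_Ioo_eq_integral:
  fixes f :: "real \<Rightarrow> real"
  assumes "f absolutely_integrable_on {a..b}" "\<And>x. f x \<ge> 0"
  shows "(\<integral>\<^sup>+x\<in>{a<..<b}. ennreal (f x) \<partial>lebesgue) = ennreal (integral {a..b} f)"
proof -
  have ai: "f absolutely_integrable_on {a<..<b}"
    using assms(1) by (simp add: absolutely_integrable_on_Icc_iff_Ioo)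
  have "(\<integral>\<^sup>+x\<in>{a<..<b}. ennreal (f x) \<partial>lebesgue) = (\<integral>\<^sup>+x. ennreal (indicator {a<..<b} x *\<^sub>R f x) \<partial>lebesgue)"
    by (intro nn_integral_cong) (auto simp: indicator_def)
  also have "\<dots> = ennreal (LINT x:{a<..<b}|lebesgue. f x)"
    unfolding set_lebesgue_integral_def
    by (rule nn_integral_eq_integral) (use ai assms(2) in \<open>auto simp: set_integrable_def\<close>)
  also have "\<dots> = ennreal (integral {a..b} f)" by (simp add: LINT_Ioo[OF assms(1)])
  finally show ?thesis .
qed

context euclidean_arc
begin

text \<open>A lower limit below \<open>M\<close> only bounds infinitely many members of the
  sequence; the subsequence formed by them is again inscribed with vanishing modulus.\<close>

lemma twice_primitive_of_relaxed_energy_less: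
  assumes "relaxed_energy p \<alpha> c L < ennreal M" and p: "p > 1" and \<alpha>: "\<alpha> \<ge> 0" and M: "M \<ge> 0"
  obtains w v where "twice_primitive 0 L c w v" "integrable lborel v"
    "(\<integral>\<^sup>+t. ennreal (norm (v t) powr p) \<partial>lborel) \<le> ennreal M"
proof -
  obtain P ts where ins: "\<And>h :: nat. inscribed_polygonal c L (ts h) (P h)"
    and mod: "(\<lambda>h. polygonal_modulus c (ts h)) \<longlonglongrightarrow> 0"
    and less: "liminf (\<lambda>h. modified_rotation p \<alpha> (P h)) < ennreal M"
    using assms(1) unfolding relaxed_energy_def Inf_less_iff by blast
  have "infinite {h. modified_rotation p \<alpha> (P h) < ennreal M}"
  proof
    assume "finite {h. modified_rotation p \<alpha> (P h) < ennreal M}"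
    then have "eventually (\<lambda>h. ennreal M \<le> modified_rotation p \<alpha> (P h)) sequentially"
      by (simp add: eventually_cofinite not_le flip: cofinite_eq_sequentially)
    then have "ennreal M \<le> liminf (\<lambda>h. modified_rotation p \<alpha> (P h))"
      by (rule Liminf_bounded)
    then show False using less by simp
  qed
  then obtain r :: "nat \<Rightarrow> nat" where r: "strict_mono r" "\<And>h. modified_rotation p \<alpha> (P (r h)) < ennreal M"
    using infinite_enumerate by blast
  show ?thesis
  proof (rule twice_primitive_of_bounded_rotation)
    show "inscribed_polygonal c L (ts (r h)) (P (r h))" for h by (rule ins)
    show "(\<lambda>h. polygonal_modulus c (ts (r h))) \<longlonglongrightarrow> 0"
      using LIMSEQ_subseq_LIMSEQ[OF mod r(1)] by (simp add: o_def)
    show "modified_rotation p \<alpha> (P (r h)) \<le> ennreal M" for h by (rule less_imp_le[OF r(2)])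
  qed (use p \<alpha> M that in blast)+
qed

lemma in_Sobolev_of_finite_energy:
  assumes "relaxed_energy p \<alpha> c L < \<infinity>" and p: "p > 1" and \<alpha>: "\<alpha> \<ge> 0"
  shows "in_Sobolev 2 p {0<..<L} c"
proof -
  obtain x where x: "x \<ge> 0" "relaxed_energy p \<alpha> c L = ennreal x"
    using assms(1) by (cases "relaxed_energy p \<alpha> c L") auto
  then have "relaxed_energy p \<alpha> c L < ennreal (x + 1)" by (simp add: ennreal_less_iff)
  then obtain w v where wv: "twice_primitive 0 L c w v" and vi: "integrable lborel v"
    and vp: "(\<integral>\<^sup>+t. ennreal (norm (v t) powr p) \<partial>lborel) \<le> ennreal (x + 1)"
    using twice_primitive_of_relaxed_energy_less[OF _ p \<alpha>] x(1) by (metis add_nonneg_nonneg zero_le_one)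
  interpret twice_primitive 0 L c w v by (rule wv)
  have vm: "v \<in> borel_measurable lborel" by (rule borel_measurable_integrable[OF vi])
  have "integrable lborel (\<lambda>t. norm (v t) powr p)"
    by (rule integrableI_bounded) (use vm vp in \<open>auto intro: le_less_trans\<close>)
  then have "integrable lebesgue (\<lambda>t. norm (v t) powr p)"
    by (subst integrable_completion) (use vm in auto)
  then have "(\<lambda>t. norm (v t) powr p) absolutely_integrable_on {0<..<L}"
    unfolding set_integrable_def by (intro integrable_mult_indicator) auto
  then have "integrable (lebesgue_on {0<..<L}) (\<lambda>t. norm (v t) powr p)"
    by (rule absolutely_integrable_imp_integrable) auto
  moreover have "v \<in> borel_measurable (lebesgue_on {0<..<L})"
    using vm by (intro measurable_restrict_space1 measurable_completion)
  ultimately have "in_Lp p {0<..<L} v" by (simp add: in_Lp_def)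
  moreover have "in_Lp p {0<..<L} c" "in_Lp p {0<..<L} w"
    using p by (auto intro!: in_Lp_continuous continuous_c continuous_w)
  moreover have "j = 1 \<or> j = 2" if "j \<in> {1..2}" for j :: nat using that by auto
  ultimately show ?thesis
    unfolding in_Sobolev_def using has_weak_deriv_1 has_weak_deriv_2 by blast
qed

text \<open>Every \<open>M\<close> above the energy yields some second derivative whose p-th power
  integrates to at most \<open>M\<close>. Uniqueness identifies it almost everywhere with the given
  one, so letting \<open>M\<close> decrease to the energy gives the lower bound; the uniform
  polygonals give the upper one.\<close>

lemma relaxed_energy_eq_integral:
  assumes weak: "has_weak_deriv 2 {0<..<L} c v" and Lp: "in_Lp p {0<..<L} v" and p: "p > 1" and \<alpha>: "\<alpha> \<ge> 0"
  shows "relaxed_energy p \<alpha> c L < \<infinity>"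
    and "relaxed_energy p \<alpha> c L = (\<integral>\<^sup>+s\<in>{0<..<L}. ennreal (norm (v s) powr p) \<partial>lebesgue)"
proof -
  note ai = in_Lp_imp_absolutely_integrable[OF Lp p]
  obtain w where w: "twice_primitive 0 L c w v"
    using twice_primitive_of_weak_deriv[OF L_pos continuous_curve weak ai(1)] by blast
  have "(\<lambda>t. norm (v t) powr p) integrable_on {0..L}" using ai(2) by (auto simp: absolutely_integrable_on_def)
  then have "sobolev_arc c L w v p"
    using w p by (intro sobolev_arc.intro euclidean_arc_axioms sobolev_arc_axioms.intro)
  then interpret S: sobolev_arc c L w v p .
  have VL: "ennreal (S.V L) = (\<integral>\<^sup>+s\<in>{0<..<L}. ennreal (norm (v s) powr p) \<partial>lebesgue)"
    unfolding S.V_def by (rule nn_integral_Ioo_eq_integral[OF ai(2), symmetric]) simp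
  have upper: "relaxed_energy p \<alpha> c L \<le> ennreal (S.V L)" by (rule S.relaxed_energy_le)
  then show fin: "relaxed_energy p \<alpha> c L < \<infinity>" by (simp add: le_less_trans)
  have "ennreal (S.V L) \<le> relaxed_energy p \<alpha> c L"
  proof (rule ennreal_le_epsilon)
    fix e :: real assume e: "e > 0"
    obtain x where x: "x \<ge> 0" "relaxed_energy p \<alpha> c L = ennreal x"
      using fin by (cases "relaxed_energy p \<alpha> c L") auto
    then have "relaxed_energy p \<alpha> c L < ennreal (x + e)" using e by (simp add: ennreal_less_iff)
    then obtain w' v' where v': "twice_primitive 0 L c w' v'"
      "(\<integral>\<^sup>+t. ennreal (norm (v' t) powr p) \<partial>lborel) \<le> ennreal (x + e)"
      using twice_primitive_of_relaxed_energy_less[OF _ p \<alpha>] x(1) e by (metis add_nonneg_nonneg less_imp_le)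
    have "has_weak_deriv 2 {0<..<L} c v'" by (rule twice_primitive.has_weak_deriv_2[OF v'(1)])
    then have ae: "AE t in lebesgue. t \<in> {0<..<L} \<longrightarrow> v t = v' t"
      by (rule weak_second_deriv_AE_unique[OF weak])
    have "ennreal (S.V L) \<le> (\<integral>\<^sup>+t. ennreal (norm (v' t) powr p) \<partial>lebesgue)"
      unfolding VL
    proof (rule nn_integral_mono_AE)
      show "AE t in lebesgue. ennreal (norm (v t) powr p) * indicator {0<..<L} t \<le> ennreal (norm (v' t) powr p)"
        using ae by eventually_elim (auto simp: indicator_def)
    qed
    also have "\<dots> \<le> ennreal (x + e)" using v'(2) by (simp add: nn_integral_completion)
    also have "\<dots> = relaxed_energy p \<alpha> c L + ennreal e" using x e by (simp add: ennreal_plus)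
    finally show "ennreal (S.V L) \<le> relaxed_energy p \<alpha> c L + ennreal e" .
  qed
  with upper VL show "relaxed_energy p \<alpha> c L = (\<integral>\<^sup>+s\<in>{0<..<L}. ennreal (norm (v s) powr p) \<partial>lebesgue)"
    by simp
qed

end

theorem corollary6p1:
  fixes N :: nat and c :: "real \<Rightarrow> real ^ 'n" and L \<alpha> p :: real
  assumes "N \<ge> 1" and "CARD('n) = N + 1"
    and "0 \<le> L"
    and "rectifiable_curve c 0 L"
    and "c 0 \<noteq> c L"
    and "arc_length_parametrized c L"
    and "\<alpha> \<ge> 0"
    and "p > 1"
  shows "(relaxed_energy p \<alpha> c L < \<infinity> \<longleftrightarrow> in_Sobolev 2 p {0<..<L} c) \<and>
    (in_Sobolev 2 p {0<..<L} c \<longrightarrow>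
      (\<forall>c2. has_weak_deriv 2 {0<..<L} c c2 \<longrightarrow>
        relaxed_energy p \<alpha> c L = (\<integral>\<^sup>+s\<in>{0<..<L}. ennreal (norm (c2 s) powr p) \<partial>lebesgue)))"
proof -
  \<comment> \<open>The curve is open, so its endpoints differ.\<close>
  have "L > 0" using \<open>0 \<le> L\<close> \<open>c 0 \<noteq> c L\<close> by (cases "L = 0") auto
  then interpret euclidean_arc c L
    using \<open>arc_length_parametrized c L\<close> by unfold_locales
  have weak: "\<exists>v. has_weak_deriv 2 {0<..<L} c v \<and> in_Lp p {0<..<L} v" if "in_Sobolev 2 p {0<..<L} c"
    using that by (auto simp: in_Sobolev_def)
  show ?thesis
  proof (intro conjI iffI impI allI)
    show "in_Sobolev 2 p {0<..<L} c" if "relaxed_energy p \<alpha> c L < \<infinity>"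
      by (rule in_Sobolev_of_finite_energy[OF that \<open>p > 1\<close> \<open>\<alpha> \<ge> 0\<close>])
    show "relaxed_energy p \<alpha> c L < \<infinity>" if "in_Sobolev 2 p {0<..<L} c"
      using weak[OF that] relaxed_energy_eq_integral(1)[OF _ _ \<open>p > 1\<close> \<open>\<alpha> \<ge> 0\<close>] by blast
    fix c2 assume "in_Sobolev 2 p {0<..<L} c" and c2: "has_weak_deriv 2 {0<..<L} c c2"
    then obtain v where v: "has_weak_deriv 2 {0<..<L} c v" "in_Lp p {0<..<L} v"
      using weak by blast
    \<comment> \<open>An arbitrary weak second derivative \<open>c2\<close> agrees almost everywhere
      with the one in L^p.\<close>
    have "AE t in lebesgue. t \<in> {0<..<L} \<longrightarrow> v t = c2 t"
      by (rule weak_second_deriv_AE_unique[OF v(1) c2])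
    then have "(\<integral>\<^sup>+s\<in>{0<..<L}. ennreal (norm (v s) powr p) \<partial>lebesgue) =
        (\<integral>\<^sup>+s\<in>{0<..<L}. ennreal (norm (c2 s) powr p) \<partial>lebesgue)"
      by (intro nn_integral_cong_AE) (auto elim!: eventually_mono simp: indicator_def)
    then show "relaxed_energy p \<alpha> c L = (\<integral>\<^sup>+s\<in>{0<..<L}. ennreal (norm (c2 s) powr p) \<partial>lebesgue)"
      using relaxed_energy_eq_integral(2)[OF v \<open>p > 1\<close> \<open>\<alpha> \<ge> 0\<close>] by simp
  qed
qed

end
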